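(* Let $m,n\in\mathbb{N}$. Assume that $F\colon\mathbb{R}^n\to\mathbb{C}^{m\times m}$ is measurable such that $f^\wedge F\in L^2(\mathbb{R}^n,\mathbb{C}^{m\times m})$ for all $f\in C_0^\infty(\mathbb{R}^n,\mathbb{C}^{m\times m})$, and define $$F(-i\nabla)\colon C_0^\infty(\mathbb{R}^n,\mathbb{C}^{m\times m})\to L^2(\mathbb{R}^n,\mathbb{C}^{m\times m}),\quad f\mapsto F(-i\nabla)f=(f^\wedge F)^\vee.$$ Then the following conditions (i) and (ii) are equivalent: (i) $F(-i\nabla)|_{C_0^\infty(\mathbb{R}^n,\mathbb{C}^{m\times m})}$ can be extended to a bounded operator (denoted by the same symbol) $F(-i\nabla)\in\mathcal{B}\big(L^2(\mathbb{R}^n,\mathbb{C}^{m\times m})\big)$. (ii) $F\in L^\infty(\mathbb{R}^n,\mathbb{C}^{m\times m})$. In addition, if one of conditions (i) or (ii) holds, then $$\|F(-i\nabla)\|_{\mathcal{B}(L^2(\mathbb{R}^n,\mathbb{C}^{m\times m}_{\rm HS}))}=\operatorname{ess\,sup}_{x\in\mathbb{R}^n}\|F(x)\|_{\mathcal{B}(\mathbb{C}^m)}=\|F\|_{\infty,m},$$ and moreover $$|||F|||_{\infty,m}\le\|F(-i\nabla)\|_{\mathcal{B}((L^2(\mathbb{R}^n,\mathbb{C}^{m\times m}),\,|||\cdot|||_{2,m}))}\le m\,|||F|||_{\infty,m}.$$ Both estimates in the last display are sharp (that is, the constants $1$ and $m$ are best possible).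
   Context: $\|\cdot\|_{\mathcal{B}(\mathbb{C}^m)}$ is the operator norm with respect to the Euclidean norm on $\mathbb{C}^m$. $L^2(\mathbb{R}^n,\mathbb{C}^{m\times m})$ is the space of measurable $f\colon\mathbb{R}^n\to\mathbb{C}^{m\times m}$ with $\|f\|_{2,m}=(\int\|f(x)\|_{\mathcal{B}(\mathbb{C}^m)}^2\,d^nx)^{1/2}<\infty$; $L^\infty(\mathbb{R}^n,\mathbb{C}^{m\times m})$ is defined with $\|f\|_{\infty,m}=\operatorname{ess\,sup}_x\|f(x)\|_{\mathcal{B}(\mathbb{C}^m)}$. Equivalent norms: $|||f|||_{2,m}=\sum_{j,k=1}^m\|f_{j,k}\|_{L^2(\mathbb{R}^n)}$ and $|||f|||_{\infty,m}=\max_{1\le j,k\le m}\|f_{j,k}\|_{L^\infty(\mathbb{R}^n)}$. $L^2(\mathbb{R}^n,\mathbb{C}^{m\times m}_{\rm HS})$ is the same set as $L^2(\mathbb{R}^n,\mathbb{C}^{m\times m})$ but with the norm $\big(\int_{\mathbb{R}^n}\sum_{j,k=1}^m|f_{j,k}(x)|^2\,d^nx\big)^{1/2}$. Fourier transforms (entrywise): $f^\wedge(y)=(2\pi)^{-n/2}\int e^{-iy\cdot x}f(x)\,d^nx$, with inverse $g^\vee(x)=(2\pi)^{-n/2}\int e^{ix\cdot y}g(y)\,d^ny$, extended to $L^2$. The product $f^\wedge F$ is the pointwise matrix product with $F$ on the right. *)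

theory Defs
  imports "HOL-Analysis.Analysis" "HOL-Probability.Essential_Supremum"
begin

text \<open>
  The space of dimension \<open>n\<close> is \<open>real ^ 'n\<close> and the \<open>m \<times> m\<close> complex matrices are
  \<open>complex ^ 'm ^ 'm\<close>. Lebesgue classes are represented by functions, and equality in
  \<open>L2\<close> is equality almost everywhere with respect to \<open>lebesgue\<close>.
\<close>

definition mat_opnorm :: "complex^'m^'m \<Rightarrow> real" where
  "mat_opnorm A = onorm (\<lambda>v. A *v v)"

definition mat_scale :: "complex \<Rightarrow> complex^'m^'m \<Rightarrow> complex^'m^'m" where
  "mat_scale c A = (\<chi> j k. c * A $ j $ k)"

definition L1_fun :: "(real^'n \<Rightarrow> complex) set" where
  "L1_fun = {f. integrable lebesgue f}"

definition L2_fun :: "(real^'n \<Rightarrow> complex) set" where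
  "L2_fun = {f \<in> borel_measurable lebesgue. integrable lebesgue (\<lambda>x. (norm (f x))\<^sup>2)}"

definition L2_fun_norm :: "(real^'n \<Rightarrow> complex) \<Rightarrow> real" where
  "L2_fun_norm f = sqrt (LINT x|lebesgue. (norm (f x))\<^sup>2)"

definition Linf_fun_norm :: "(real^'n \<Rightarrow> complex) \<Rightarrow> ereal" where
  "Linf_fun_norm f = esssup lebesgue (\<lambda>x. ereal (norm (f x)))"

definition L2_mat :: "(real^'n \<Rightarrow> complex^'m^'m) set" where
  "L2_mat = {f \<in> borel_measurable lebesgue. integrable lebesgue (\<lambda>x. (mat_opnorm (f x))\<^sup>2)}"

definition L2_norm :: "(real^'n \<Rightarrow> complex^'m^'m) \<Rightarrow> real" where
  "L2_norm f = sqrt (LINT x|lebesgue. (mat_opnorm (f x))\<^sup>2)"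

definition L2_HS_norm :: "(real^'n \<Rightarrow> complex^'m^'m) \<Rightarrow> real" where
  "L2_HS_norm f = sqrt (LINT x|lebesgue. (\<Sum>j\<in>UNIV. \<Sum>k\<in>UNIV. (norm (f x $ j $ k))\<^sup>2))"

definition L2_triple_norm :: "(real^'n \<Rightarrow> complex^'m^'m) \<Rightarrow> real" where
  "L2_triple_norm f = (\<Sum>j\<in>UNIV. \<Sum>k\<in>UNIV. L2_fun_norm (\<lambda>x. f x $ j $ k))"

definition Linf_norm :: "(real^'n \<Rightarrow> complex^'m^'m) \<Rightarrow> ereal" where
  "Linf_norm F = esssup lebesgue (\<lambda>x. ereal (mat_opnorm (F x)))"

definition Linf_mat :: "(real^'n \<Rightarrow> complex^'m^'m) set" where
  "Linf_mat = {F \<in> borel_measurable lebesgue. Linf_norm F < \<infinity>}"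

definition Linf_triple_norm :: "(real^'n \<Rightarrow> complex^'m^'m) \<Rightarrow> ereal" where
  "Linf_triple_norm F = Max {Linf_fun_norm (\<lambda>x. F x $ j $ k) | j k. True}"

text \<open>
  Being \<open>C^k\<close> on the whole space, expressed through directional derivatives of the Frechet
  derivative; for finite-dimensional domains this agrees with the definition by partial derivatives.
\<close>

primrec C_diff :: "nat \<Rightarrow> ('a::real_normed_vector \<Rightarrow> 'b::real_normed_vector) \<Rightarrow> bool" where
  "C_diff 0 f \<longleftrightarrow> continuous_on UNIV f"
| "C_diff (Suc k) f \<longleftrightarrow> (\<forall>x. f differentiable (at x)) \<and>
     (\<forall>v. C_diff k (\<lambda>x. frechet_derivative f (at x) v))"

definition C0inf :: "('a::real_normed_vector \<Rightarrow> 'b::real_normed_vector) set" where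
  "C0inf = {f. (\<forall>k. C_diff k f) \<and> compact (closure {x. f x \<noteq> 0})}"

definition fourier_fun :: "(real^'n \<Rightarrow> complex) \<Rightarrow> real^'n \<Rightarrow> complex" where
  "fourier_fun f y = complex_of_real ((2 * pi) powr (- (real CARD('n) / 2))) *
     (LINT x|lebesgue. exp (- (\<i> * complex_of_real (y \<bullet> x))) * f x)"

definition inv_fourier_fun :: "(real^'n \<Rightarrow> complex) \<Rightarrow> real^'n \<Rightarrow> complex" where
  "inv_fourier_fun g x = complex_of_real ((2 * pi) powr (- (real CARD('n) / 2))) *
     (LINT y|lebesgue. exp (\<i> * complex_of_real (x \<bullet> y)) * g y)"

text \<open>
  The extension of the inverse transform to \<open>L2\<close> by continuity from \<open>L1 \<inter> L2\<close>: \<open>h\<close> is the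
  \<open>L2\<close>-limit of the inverse transforms of some \<open>L1 \<inter> L2\<close> functions converging to \<open>g\<close> in \<open>L2\<close>.
  By Plancherel's theorem such an \<open>h\<close> exists for every \<open>g\<close> in \<open>L2\<close> and is unique almost
  everywhere. The choice operator in \<open>L2_inv_fourier_fun\<close> only picks a representative.
\<close>

definition is_L2_inv_fourier_fun :: "(real^'n \<Rightarrow> complex) \<Rightarrow> (real^'n \<Rightarrow> complex) \<Rightarrow> bool" where
  "is_L2_inv_fourier_fun g h \<longleftrightarrow> g \<in> L2_fun \<and> h \<in> L2_fun \<and>
     (\<exists>u :: nat \<Rightarrow> real^'n \<Rightarrow> complex.
        (\<forall>i. u i \<in> L1_fun \<inter> L2_fun \<and> inv_fourier_fun (u i) \<in> L2_fun) \<and>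
        (\<lambda>i. L2_fun_norm (\<lambda>y. u i y - g y)) \<longlonglongrightarrow> 0 \<and>
        (\<lambda>i. L2_fun_norm (\<lambda>x. inv_fourier_fun (u i) x - h x)) \<longlonglongrightarrow> 0)"

definition L2_inv_fourier_fun :: "(real^'n \<Rightarrow> complex) \<Rightarrow> real^'n \<Rightarrow> complex" where
  "L2_inv_fourier_fun g = (SOME h. is_L2_inv_fourier_fun g h)"

definition fourier :: "(real^'n \<Rightarrow> complex^'m^'m) \<Rightarrow> real^'n \<Rightarrow> complex^'m^'m" where
  "fourier f y = (\<chi> j k. fourier_fun (\<lambda>x. f x $ j $ k) y)"

definition L2_inv_fourier :: "(real^'n \<Rightarrow> complex^'m^'m) \<Rightarrow> real^'n \<Rightarrow> complex^'m^'m" where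
  "L2_inv_fourier g x = (\<chi> j k. L2_inv_fourier_fun (\<lambda>y. g y $ j $ k) x)"

definition multiplier_symbol :: "(real^'n \<Rightarrow> complex^'m^'m) \<Rightarrow> bool" where
  "multiplier_symbol F \<longleftrightarrow> F \<in> borel_measurable lebesgue \<and>
     (\<forall>f\<in>C0inf. (\<lambda>y. fourier f y ** F y) \<in> L2_mat)"

definition multiplier ::
  "(real^'n \<Rightarrow> complex^'m^'m) \<Rightarrow> (real^'n \<Rightarrow> complex^'m^'m) \<Rightarrow> real^'n \<Rightarrow> complex^'m^'m" where
  "multiplier F f = L2_inv_fourier (\<lambda>y. fourier f y ** F y)"

text \<open>
  Bounded complex-linear operators on \<open>L2\<close>, acting on representatives. That such an operator
  respects equality almost everywhere follows from additivity and the norm bound.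
\<close>

definition bounded_L2_operator ::
  "((real^'n \<Rightarrow> complex^'m^'m) \<Rightarrow> real^'n \<Rightarrow> complex^'m^'m) \<Rightarrow> bool" where
  "bounded_L2_operator T \<longleftrightarrow>
     (\<forall>f\<in>L2_mat. T f \<in> L2_mat) \<and>
     (\<forall>f\<in>L2_mat. \<forall>g\<in>L2_mat. AE x in lebesgue. T (\<lambda>y. f y + g y) x = T f x + T g x) \<and>
     (\<forall>c. \<forall>f\<in>L2_mat. AE x in lebesgue. T (\<lambda>y. mat_scale c (f y)) x = mat_scale c (T f x)) \<and>
     (\<exists>K. \<forall>f\<in>L2_mat. L2_norm (T f) \<le> K * L2_norm f)"

definition bounded_extension ::
  "(real^'n \<Rightarrow> complex^'m^'m) \<Rightarrow> ((real^'n \<Rightarrow> complex^'m^'m) \<Rightarrow> real^'n \<Rightarrow> complex^'m^'m) \<Rightarrow> bool"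
  where
  "bounded_extension F T \<longleftrightarrow> bounded_L2_operator T \<and>
     (\<forall>f\<in>C0inf. AE x in lebesgue. T f x = multiplier F f x)"

text \<open>
  The operator norm when \<open>L2_mat\<close> carries the norm \<open>N\<close>. It is extended-real valued, so that an
  equation with a finite value includes boundedness with respect to \<open>N\<close>.
\<close>

definition L2_operator_norm ::
  "((real^'n \<Rightarrow> complex^'m^'m) \<Rightarrow> real) \<Rightarrow>
   ((real^'n \<Rightarrow> complex^'m^'m) \<Rightarrow> real^'n \<Rightarrow> complex^'m^'m) \<Rightarrow> ereal" where
  "L2_operator_norm N T = (SUP f\<in>{f \<in> L2_mat. N f \<le> 1}. ereal (N (T f)))"

end

theory Submission
  imports Defs "HOL-Probability.Characteristic_Functions"
begin

text \<open>
  By Plancherel's theorem the operator norm of \<open>F(-i\<nabla>)\<close> is that of right multiplication by \<open>F\<close>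
  on the transforms of test functions. The upper bounds are pointwise: rows of \<open>g F\<close> are images of
  rows of \<open>g\<close> under the transpose of \<open>F\<close>, which has the operator norm of \<open>F\<close>, and the triple norm
  grows at most by the largest row sum of the bounds of the entries of \<open>F\<close>. For the lower bounds
  one tests with matrices having a single nonzero row \<open>\<phi> v\<close>: a bound \<open>K\<close> for the operator gives
  \<open>\<integral> |\<phi>^|\<^sup>2 |F^T v|\<^sup>2 \<le> K\<^sup>2 |v|\<^sup>2 \<integral> |\<phi>|\<^sup>2\<close> for all test functions \<open>\<phi>\<close>, and since their transforms
  are dense in \<open>L2\<close> one may replace \<open>\<phi>^\<close> by indicators, whence \<open>|F^T v| \<le> K |v|\<close> almost everywhere.
  The constants \<open>1\<close> and \<open>m\<close> are attained by the identity matrix and by the matrix with all entries \<open>1\<close>.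

  Plancherel's theorem is proved by Gauss summation of the transform of the autocorrelation
  \<open>z \<mapsto> \<integral> u(x) cnj u(x - z) dx\<close>. Density of the transforms follows because the extended Fourier
  transform and its adjoint are both isometries.
\<close>

section \<open>Smooth functions with compact support\<close>

text \<open>Three obstacles shape the argument. Nothing is known beforehand about the local
  integrability of |F^T v|^2, so the passage from transforms of test functions to indicators uses an
  almost everywhere convergent subsequence and Fatou's lemma, not convergence of weighted integrals.
  Each vector v yields its own null set, so the operator norm of \<open>F y\<close> is reached only
  through a countable dense set of vectors. And an extension \<open>T\<close> is known explicitly
  only on test functions, so every upper bound is proved there and carried to all of L2 by
  continuity.

  The autocorrelation suits Plancherel's theorem because it is bounded and continuous at 0 for every
  square-integrable \<open>u\<close>, while its transform is a nonnegative function, the squared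
  modulus of the transform of \<open>u\<close>. Hence the Gauss means increase, and monotone
  convergence gives the integrability of the squared transform together with its integral.

  The Hilbert-Schmidt norm gives an equality because it adds up the rows independently and right
  multiplication acts on each of them by the same matrix; a single row therefore already detects the
  full operator norm.\<close>

lemma C_diff_SucI:
  assumes "\<And>x. (f has_derivative f' x) (at x)" "\<And>v. C_diff k (\<lambda>x. f' x v)"
  shows "C_diff (Suc k) f"
proof -
  have "frechet_derivative f (at x) = f' x" for x
    using assms(1) frechet_derivative_at by metis
  then show ?thesis
    using assms by (auto intro: differentiableI)
qed

text \<open>Together with \<open>C_diff_SucI\<close> this trades the choice term
  \<open>frechet_derivative\<close> for an arbitrary explicit derivative, so that the closure
  properties become inductions over the usual differentiation rules.\<close>

lemma C_diff_SucD_derivative: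
  assumes "C_diff (Suc k) f"
  shows "\<exists>f'. (\<forall>x. (f has_derivative f' x) (at x)) \<and> (\<forall>v. C_diff k (\<lambda>x. f' x v))"
  using assms by (intro exI[of _ "\<lambda>x. frechet_derivative f (at x)"]) (auto simp: frechet_derivative_works)

lemma C_diff_SucD: "C_diff (Suc k) f \<Longrightarrow> C_diff k f"
proof (induction k arbitrary: f)
  case 0
  then show ?case
    by (auto simp: continuous_on_eq_continuous_at differentiable_imp_continuous_within)
next
  case (Suc k)
  then show ?case
    by (metis C_diff.simps(2))
qed

lemma C_diff_imp_continuous: "C_diff k f \<Longrightarrow> continuous_on UNIV f"
  by (induction k) (auto dest: C_diff_SucD simp del: C_diff.simps(2))

lemma C_diff_const: "C_diff k (\<lambda>_. c)"
proof (induction k arbitrary: c)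
  case (Suc k)
  show ?case by (rule C_diff_SucI[OF has_derivative_const Suc])
qed simp

lemma C_diff_add: "C_diff k f \<Longrightarrow> C_diff k g \<Longrightarrow> C_diff k (\<lambda>x. f x + g x)"
proof (induction k arbitrary: f g)
  case (Suc k)
  obtain f' where f': "\<And>x. (f has_derivative f' x) (at x)" "\<And>v. C_diff k (\<lambda>x. f' x v)"
    using C_diff_SucD_derivative[OF Suc.prems(1)] by blast
  obtain g' where g': "\<And>x. (g has_derivative g' x) (at x)" "\<And>v. C_diff k (\<lambda>x. g' x v)"
    using C_diff_SucD_derivative[OF Suc.prems(2)] by blast
  show ?case
    by (rule C_diff_SucI[OF has_derivative_add[OF f'(1) g'(1)]]) (rule Suc.IH[OF f'(2) g'(2)])
qed (auto intro: continuous_intros)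

lemma C_diff_bounded_linear:
  assumes "bounded_linear L" shows "C_diff k f \<Longrightarrow> C_diff k (\<lambda>x. L (f x))"
proof (induction k arbitrary: f)
  case 0
  then show ?case using assms by (auto intro: bounded_linear.continuous_on)
next
  case (Suc k)
  obtain f' where f': "\<And>x. (f has_derivative f' x) (at x)" "\<And>v. C_diff k (\<lambda>x. f' x v)"
    using C_diff_SucD_derivative[OF Suc.prems(1)] by blast
  show ?case
    by (rule C_diff_SucI[OF bounded_linear.has_derivative[OF assms f'(1)]]) (rule Suc.IH[OF f'(2)])
qed

lemma C_diff_sum: "(\<And>i. i \<in> I \<Longrightarrow> C_diff k (f i)) \<Longrightarrow> C_diff k (\<lambda>x. \<Sum>i\<in>I. f i x)"
  by (induction I rule: infinite_finite_induct) (auto intro: C_diff_const C_diff_add)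

lemma C_diff_ident: "C_diff k (\<lambda>x. x)"
proof (cases k)
  case (Suc j)
  show ?thesis unfolding Suc by (rule C_diff_SucI[OF has_derivative_ident C_diff_const])
qed auto

lemma C_diff_bounded_bilinear:
  assumes "bounded_bilinear pr"
  shows "C_diff k f \<Longrightarrow> C_diff k g \<Longrightarrow> C_diff k (\<lambda>x. pr (f x) (g x))"
proof (induction k arbitrary: f g)
  case 0
  then show ?case using assms by (auto intro: bounded_bilinear.continuous_on)
next
  case (Suc k)
  obtain f' where f': "\<And>x. (f has_derivative f' x) (at x)" "\<And>v. C_diff k (\<lambda>x. f' x v)"
    using C_diff_SucD_derivative[OF Suc.prems(1)] by blast
  obtain g' where g': "\<And>x. (g has_derivative g' x) (at x)" "\<And>v. C_diff k (\<lambda>x. g' x v)"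
    using C_diff_SucD_derivative[OF Suc.prems(2)] by blast
  show ?case
    by (rule C_diff_SucI[OF bounded_bilinear.FDERIV[OF assms f'(1) g'(1)]])
      (intro C_diff_add Suc.IH f' g' C_diff_SucD[OF Suc.prems(1)] C_diff_SucD[OF Suc.prems(2)])
qed

text \<open>The outer function comes as a whole chain, each member the derivative of the one before:
  differentiating the composition replaces \<open>G j\<close> by \<open>G (Suc j)\<close>, so the
  induction has to cover all \<open>j\<close> at once.\<close>

lemma C_diff_compose_real:
  assumes G: "\<And>j t. (G j has_real_derivative G (Suc j) t) (at t)"
  shows "C_diff k u \<Longrightarrow> C_diff k (\<lambda>x. G j (u x))"
proof (induction k arbitrary: u j)
  case 0
  have "continuous_on UNIV (G j)"
    using G[THEN DERIV_isCont] by (auto simp: continuous_on_eq_continuous_at)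
  with 0 show ?case
    by (auto intro: continuous_on_compose2)
next
  case (Suc k)
  obtain u' where u': "\<And>x. (u has_derivative u' x) (at x)" "\<And>v. C_diff k (\<lambda>x. u' x v)"
    using C_diff_SucD_derivative[OF Suc.prems(1)] by blast
  have D: "((\<lambda>x. G j (u x)) has_derivative (\<lambda>v. u' x v * G (Suc j) (u x))) (at x)" for x
    using has_derivative_compose[OF u'(1)[of x] G[of j "u x", unfolded has_field_derivative_def]]
    by (simp add: mult.commute)
  show ?case
    by (rule C_diff_SucI[OF D])
      (intro C_diff_bounded_bilinear[OF bounded_bilinear_mult] u' Suc.IH C_diff_SucD[OF Suc.prems(1)])
qed

text \<open>The recursion is the chain rule: the derivative of p(1/t) exp(-1/t) is (1/t)^2 (p(1/t) -
  p'(1/t)) exp(-1/t).\<close>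

definition flat_poly :: "nat \<Rightarrow> real poly" where
  "flat_poly j = ((\<lambda>p. monom 1 2 * (p - pderiv p)) ^^ j) 1"

text \<open>\<open>flat j\<close> is the \<open>j\<close>-th derivative of the function \<open>exp (- 1 / t)\<close>, extended by zero to \<open>t \<le> 0\<close>.\<close>

definition flat :: "nat \<Rightarrow> real \<Rightarrow> real" where
  "flat j t = (if t > 0 then poly (flat_poly j) (1 / t) / exp (1 / t) else 0)"

lemma tendsto_poly_div_exp_0: "((\<lambda>s::real. poly p s / exp s) \<longlongrightarrow> 0) at_top"
proof -
  have "((\<lambda>s::real. \<Sum>i\<le>degree p. coeff p i * (s ^ i / exp s)) \<longlongrightarrow> (\<Sum>i\<le>degree p. coeff p i * 0)) at_top"
    by (intro tendsto_sum tendsto_mult tendsto_const tendsto_power_div_exp_0)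
  then show ?thesis
    by (simp add: poly_altdef sum_divide_distrib)
qed

lemma flat_derivative: "(flat j has_real_derivative flat (Suc j) t) (at t)"
proof -
  consider "t > 0" | "t < 0" | "t = 0" by linarith
  then show ?thesis
  proof cases
    case 1
    have "((\<lambda>t. poly (flat_poly j) (1 / t) / exp (1 / t)) has_real_derivative flat (Suc j) t) (at t)"
      using 1 by (auto intro!: derivative_eq_intros DERIV_chain2[OF poly_DERIV]
          simp: flat_def flat_poly_def poly_monom power2_eq_square divide_simps)
        (simp add: algebra_simps)
    then show ?thesis
      by (rule has_field_derivative_transform_within_open[where S = "{0<..}"])
        (use 1 in \<open>auto simp: flat_def\<close>)
  next
    case 2
    have "((\<lambda>t. 0) has_real_derivative flat (Suc j) t) (at t)"
      using 2 by (simp add: flat_def)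
    then show ?thesis
      by (rule has_field_derivative_transform_within_open[where S = "{..<0}"])
        (use 2 in \<open>auto simp: flat_def\<close>)
  next
    case 3
    \<comment> \<open>With s = 1/h the right difference quotient at 0 is s p(s) / exp s; dividing by
      h is the origin of the factor \<open>monom 1 1\<close>.\<close>
    have "((\<lambda>s::real. poly (monom 1 1 * flat_poly j) s / exp s) \<longlongrightarrow> 0) at_top"
      by (rule tendsto_poly_div_exp_0)
    then have *: "((\<lambda>h::real. poly (monom 1 1 * flat_poly j) (inverse h) / exp (inverse h)) \<longlongrightarrow> 0) (at_right 0)"
      by (rule filterlim_compose[OF _ filterlim_inverse_at_top_right])
    have "((\<lambda>h. (flat j (0 + h) - flat j 0) / h) \<longlongrightarrow> 0) (at_right 0)"
      by (rule Lim_transform_eventually[OF *])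
        (auto simp: eventually_at_filter flat_def poly_monom field_simps)
    moreover have "((\<lambda>h. (flat j (0 + h) - flat j 0) / h) \<longlongrightarrow> 0) (at_left 0)"
      by (rule Lim_transform_eventually[OF tendsto_const])
        (auto simp: eventually_at_filter flat_def)
    ultimately have "((\<lambda>h. (flat j (0 + h) - flat j 0) / h) \<longlongrightarrow> 0) (at 0)"
      by (rule filterlim_split_at[rotated])
    then show ?thesis
      using 3 by (simp add: DERIV_def flat_def)
  qed
qed

lemma flat_0_pos: "t > 0 \<Longrightarrow> flat 0 t > 0" and flat_0_nonpos: "t \<le> 0 \<Longrightarrow> flat 0 t = 0"
  by (auto simp: flat_def flat_poly_def)

lemma C_diff_flat: "C_diff k u \<Longrightarrow> C_diff k (\<lambda>x. flat 0 (u x))"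
  by (rule C_diff_compose_real[where G = flat]) (rule flat_derivative)

lemma C_diff_exp: "C_diff k u \<Longrightarrow> C_diff k (\<lambda>x. exp (u x) :: real)"
  by (rule C_diff_compose_real[where G = "\<lambda>_. exp"]) (rule DERIV_exp)

section \<open>Test functions: closure properties and approximation of indicators of open
  sets\<close>

lemma C0infI:
  assumes "\<And>k. C_diff k f" "compact K" "\<And>x. f x \<noteq> 0 \<Longrightarrow> x \<in> K"
  shows "f \<in> C0inf"
proof -
  have "closure {x. f x \<noteq> 0} \<subseteq> K"
    using assms by (intro closure_minimal) (auto intro: compact_imp_closed)
  then have "compact (K \<inter> closure {x. f x \<noteq> 0})" "K \<inter> closure {x. f x \<noteq> 0} = closure {x. f x \<noteq> 0}"
    using assms by auto
  then show ?thesis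
    using assms by (simp add: C0inf_def)
qed

lemma C0infD:
  assumes "f \<in> C0inf"
  shows "\<exists>K. compact K \<and> (\<forall>x. f x \<noteq> 0 \<longrightarrow> x \<in> K) \<and> (\<forall>k. C_diff k f)"
  using assms closure_subset[of "{x. f x \<noteq> 0}"]
  by (intro exI[of _ "closure {x. f x \<noteq> 0}"]) (auto simp: C0inf_def)

lemma C0inf_add:
  assumes "f \<in> C0inf" "g \<in> C0inf" shows "(\<lambda>x. f x + g x) \<in> C0inf"
proof -
  obtain K where K: "compact K" "\<And>x. f x \<noteq> 0 \<Longrightarrow> x \<in> K" "\<And>k. C_diff k f"
    using C0infD[OF assms(1)] by blast
  obtain K' where K': "compact K'" "\<And>x. g x \<noteq> 0 \<Longrightarrow> x \<in> K'" "\<And>k. C_diff k g"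
    using C0infD[OF assms(2)] by blast
  show ?thesis
    by (rule C0infI[OF C_diff_add compact_Un[OF K(1) K'(1)]]) (use K(2,3) K'(2,3) in \<open>blast | force\<close>)+
qed

lemma C0inf_zero: "(\<lambda>_. 0) \<in> C0inf"
  by (rule C0infI[OF C_diff_const compact_empty]) auto

lemma C0inf_sum: "(\<And>i. i \<in> I \<Longrightarrow> f i \<in> C0inf) \<Longrightarrow> (\<lambda>x. \<Sum>i\<in>I. f i x) \<in> C0inf"
  by (induction I rule: infinite_finite_induct) (auto intro: C0inf_zero C0inf_add)

lemma C0inf_bounded_linear:
  assumes "bounded_linear L" "f \<in> C0inf" shows "(\<lambda>x. L (f x)) \<in> C0inf"
proof -
  obtain K where K: "compact K" "\<And>x. f x \<noteq> 0 \<Longrightarrow> x \<in> K" "\<And>k. C_diff k f"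
    using C0infD[OF assms(2)] by blast
  show ?thesis
    by (rule C0infI[OF C_diff_bounded_linear[OF assms(1)] K(1)])
      (metis K(2,3) bounded_linear.linear[OF assms(1), THEN linear_0])+
qed

text \<open>For bumps \<open>b i\<close> that are positive exactly on balls covering \<open>U\<close>, the functions
  \<open>1 - exp (- k * (\<Sum>i<k. b i))\<close> approximate the indicator of \<open>U\<close> from below.\<close>

lemma C0inf_approx_open_indicator:
  fixes U :: "'a::euclidean_space set"
  assumes "open U"
  obtains \<phi> :: "nat \<Rightarrow> 'a \<Rightarrow> real" where "\<And>k. \<phi> k \<in> C0inf" "\<And>k x. 0 \<le> \<phi> k x"
    "\<And>k x. \<phi> k x \<le> indicator U x" "\<And>x. (\<lambda>k. \<phi> k x) \<longlonglongrightarrow> indicator U x"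
proof (cases "U = {}")
  case True
  show ?thesis
    by (rule that[of "\<lambda>_ _. 0"]) (auto simp: True C0inf_zero)
next
  case False
  define \<B> where "\<B> = {(c, r) | c r. ball c r \<subseteq> U}"
  obtain \<F>' where \<F>': "\<F>' \<subseteq> (\<lambda>(c, r). ball c r) ` \<B>" "countable \<F>'"
      "\<Union>\<F>' = \<Union>((\<lambda>(c, r). ball c r) ` \<B>)"
    using Lindelof[of "(\<lambda>(c, r). ball c r) ` \<B>"] by (auto simp: case_prod_beta)
  have "\<Union>((\<lambda>(c, r). ball c r) ` \<B>) = U"
    using assms by (fastforce simp: \<B>_def open_contains_ball)
  with \<F>' have U: "\<Union>\<F>' = U" by simp
  \<comment> \<open>A nonempty countable family is enumerated by all natural numbers, possibly with
    repetitions; this is why the empty set was split off.\<close>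
  with False have "\<F>' \<noteq> {}" by auto
  then have ran: "range (from_nat_into \<F>') = \<F>'"
    using \<F>'(2) by simp
  have "\<forall>i. \<exists>c r. from_nat_into \<F>' i = ball c r"
  proof
    fix i
    have "from_nat_into \<F>' i \<in> (\<lambda>(c, r). ball c r) ` \<B>"
      using \<F>'(1) ran by blast
    then show "\<exists>c r. from_nat_into \<F>' i = ball c r" by auto
  qed
  then obtain c r where cr: "\<And>i. from_nat_into \<F>' i = ball (c i) (r i)"
    by metis
  have U_eq: "U = (\<Union>i. ball (c i) (r i))"
    using U ran by (simp flip: cr)
  \<comment> \<open>A ball of negative radius is empty, yet squaring the radius would forget the
    sign and produce a nonzero bump; hence the case distinction.\<close>
  define b where "b i x = (if r i > 0 then flat 0 ((r i)\<^sup>2 - (x - c i) \<bullet> (x - c i)) else 0)" for i x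
  have b_diff: "C_diff k (b i)" for k i
  proof (cases "r i > 0")
    case True
    have "C_diff k (\<lambda>x. x - c i)"
      using C_diff_add[OF C_diff_ident C_diff_const[of k "- c i"]] by simp
    from C_diff_bounded_linear[OF bounded_linear_minus[OF bounded_linear_ident]
      C_diff_bounded_bilinear[OF bounded_bilinear_inner this this]]
    have "C_diff k (\<lambda>x. (r i)\<^sup>2 + - ((x - c i) \<bullet> (x - c i)))"
      by (rule C_diff_add[OF C_diff_const])
    from C_diff_flat[OF this] show ?thesis
      using True by (simp add: b_def[abs_def])
  qed (simp add: b_def[abs_def] C_diff_const)
  have mem: "x \<in> ball (c i) (r i) \<longleftrightarrow> r i > 0 \<and> (r i)\<^sup>2 - (x - c i) \<bullet> (x - c i) > 0" for x i
    by (auto simp: dist_norm norm_minus_commute dot_square_norm power2_less_imp_less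
        intro: power_strict_mono le_less_trans[OF norm_ge_zero])
  have b_pos: "b i x > 0 \<longleftrightarrow> x \<in> ball (c i) (r i)" for i x
    unfolding mem using flat_0_pos flat_0_nonpos[of "(r i)\<^sup>2 - (x - c i) \<bullet> (x - c i)"]
    by (cases "(r i)\<^sup>2 - (x - c i) \<bullet> (x - c i) > 0") (auto simp: b_def)
  have b_nonneg: "b i x \<ge> 0" for i x
    by (simp add: b_def flat_def flat_poly_def)
  define s where "s k x = (\<Sum>i<k. b i x)" for k x
  have s_nonneg: "s k x \<ge> 0" for k x
    by (simp add: s_def b_nonneg sum_nonneg)
  have s_0: "s k x = 0" if "x \<notin> (\<Union>i<k. ball (c i) (r i))" for k x
    unfolding s_def
  proof (rule sum.neutral, intro ballI)
    fix i assume "i \<in> {..<k}"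
    then have "x \<notin> ball (c i) (r i)" using that by blast
    then show "b i x = 0" using b_pos[of i x] b_nonneg[of i x] by force
  qed
  define \<phi> where "\<phi> k x = 1 - exp (- (real k * s k x))" for k x
  show ?thesis
  proof (rule that[of \<phi>])
    fix k
    have "C_diff j (\<lambda>x. - (real k * s k x))" for j
      unfolding s_def
      by (intro C_diff_bounded_linear[OF bounded_linear_minus[OF bounded_linear_ident]]
          C_diff_bounded_linear[OF bounded_linear_mult_right] C_diff_sum b_diff)
    from C_diff_bounded_linear[OF bounded_linear_minus[OF bounded_linear_ident] C_diff_exp[OF this]]
    have "C_diff j (\<lambda>x. 1 + - exp (- (real k * s k x)))" for j
      by (rule C_diff_add[OF C_diff_const])
    then show "\<phi> k \<in> C0inf"
    proof (intro C0infI[where K = "\<Union>i<k. cball (c i) (r i)"] compact_UN)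
      fix x assume "\<phi> k x \<noteq> 0"
      then have "x \<in> (\<Union>i<k. ball (c i) (r i))"
        using s_0[of x k] by (auto simp: \<phi>_def)
      then show "x \<in> (\<Union>i<k. cball (c i) (r i))"
        using ball_subset_cball by blast
    qed (simp_all add: \<phi>_def[abs_def])
  next
    fix k x
    show "0 \<le> \<phi> k x" using s_nonneg by (simp add: \<phi>_def)
    show "\<phi> k x \<le> indicator U x"
      using s_0[of x k] by (auto simp: \<phi>_def U_eq indicator_def)
  next
    fix x
    show "(\<lambda>k. \<phi> k x) \<longlonglongrightarrow> indicator U x"
    proof (cases "x \<in> U")
      case True
      then obtain i where i: "x \<in> ball (c i) (r i)" by (auto simp: U_eq)
      \<comment> \<open>One bump that is positive at \<open>x\<close> suffices: once
        \<open>i < k\<close> it occurs in the sum, and the factor \<open>k\<close> then drives the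
        exponent to infinity.\<close>
      have "filterlim (\<lambda>k. b i x * real k) at_top sequentially"
        by (rule filterlim_tendsto_pos_mult_at_top[OF tendsto_const _ filterlim_real_sequentially])
          (use b_pos[of i x] i in simp)
      moreover have "\<forall>\<^sub>F k in sequentially. b i x * real k \<le> real k * s k x"
        using eventually_gt_at_top[of i]
        by eventually_elim (auto simp: s_def mult.commute[of _ "real _"] intro!: mult_left_mono member_le_sum b_nonneg)
      ultimately have "filterlim (\<lambda>k. real k * s k x) at_top sequentially"
        by (rule filterlim_at_top_mono)
      then have "(\<lambda>k. exp (- (real k * s k x))) \<longlonglongrightarrow> 0"
        by (intro filterlim_compose[OF exp_at_bot] filterlim_uminus_at_bot[THEN iffD2]) simp
      from tendsto_diff[OF tendsto_const[of 1] this] show ?thesis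
        using True by (simp add: \<phi>_def)
    next
      case False
      then have "\<phi> k x = 0" for k using s_0[of x k] by (auto simp: \<phi>_def U_eq)
      with False show ?thesis by simp
    qed
  qed
qed

section \<open>Square-integrable functions\<close>

lemma L2_fun_measurable: "f \<in> L2_fun \<Longrightarrow> f \<in> borel_measurable lebesgue"
  by (simp add: L2_fun_def)

lemma L2_fun_integrable: "f \<in> L2_fun \<Longrightarrow> integrable lebesgue (\<lambda>x. (norm (f x))\<^sup>2)"
  by (simp add: L2_fun_def)

lemma L2_fun_norm_nonneg: "L2_fun_norm f \<ge> 0"
  by (simp add: L2_fun_norm_def)

lemma L2_fun_norm_power2: "(L2_fun_norm f)\<^sup>2 = (LINT x|lebesgue. (norm (f x))\<^sup>2)"
  by (simp add: L2_fun_norm_def)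

lemma L2_fun_iff_nn_integral:
  "f \<in> borel_measurable lebesgue \<Longrightarrow> f \<in> L2_fun \<longleftrightarrow> (\<integral>\<^sup>+x. ennreal ((norm (f x))\<^sup>2) \<partial>lebesgue) < \<infinity>"
  by (auto simp: L2_fun_def integrable_iff_bounded)

lemma nn_integral_L2_fun:
  "f \<in> L2_fun \<Longrightarrow> (\<integral>\<^sup>+x. ennreal ((norm (f x))\<^sup>2) \<partial>lebesgue) = ennreal ((L2_fun_norm f)\<^sup>2)"
  unfolding L2_fun_norm_power2 by (intro nn_integral_eq_integral L2_fun_integrable) auto

text \<open>A nonnegative integral makes sense before integrability is known, so one estimate
  delivers membership and the norm bound together.\<close>

lemma nn_integral_le_L2_fun:
  assumes "f \<in> borel_measurable lebesgue" "(\<integral>\<^sup>+x. ennreal ((norm (f x))\<^sup>2) \<partial>lebesgue) \<le> ennreal (c\<^sup>2)" "c \<ge> 0"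
  shows "f \<in> L2_fun" "L2_fun_norm f \<le> c"
proof -
  have "(\<integral>\<^sup>+x. ennreal ((norm (f x))\<^sup>2) \<partial>lebesgue) < \<infinity>"
    using assms(2) by (rule le_less_trans) simp
  then show f: "f \<in> L2_fun"
    using assms(1) by (simp add: L2_fun_iff_nn_integral)
  have "(L2_fun_norm f)\<^sup>2 \<le> c\<^sup>2"
    using assms(2) by (simp add: nn_integral_L2_fun[OF f])
  then show "L2_fun_norm f \<le> c"
    using assms(3) power2_le_imp_le by blast
qed

lemma L2_fun_bound:
  assumes g: "g \<in> borel_measurable lebesgue" and f: "f \<in> L2_fun" and c: "c \<ge> 0"
    and bd: "AE x in lebesgue. norm (g x) \<le> c * norm (f x)"
  shows "g \<in> L2_fun" "L2_fun_norm g \<le> c * L2_fun_norm f"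
proof -
  have [measurable]: "f \<in> borel_measurable lebesgue" using f by (rule L2_fun_measurable)
  have "(\<integral>\<^sup>+x. ennreal ((norm (g x))\<^sup>2) \<partial>lebesgue) \<le> (\<integral>\<^sup>+x. ennreal (c\<^sup>2) * ennreal ((norm (f x))\<^sup>2) \<partial>lebesgue)"
  proof (rule nn_integral_mono_AE)
    show "AE x in lebesgue. ennreal ((norm (g x))\<^sup>2) \<le> ennreal (c\<^sup>2) * ennreal ((norm (f x))\<^sup>2)"
      using bd
    proof eventually_elim
      case (elim x)
      have "(norm (g x))\<^sup>2 \<le> (c * norm (f x))\<^sup>2"
        using elim by (intro power_mono) auto
      then show ?case by (simp add: ennreal_mult[symmetric] power_mult_distrib)
    qed
  qed
  also have "\<dots> = ennreal ((c * L2_fun_norm f)\<^sup>2)"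
    by (subst nn_integral_cmult) (simp_all add: nn_integral_L2_fun[OF f] ennreal_mult[symmetric] power_mult_distrib)
  finally show "g \<in> L2_fun" "L2_fun_norm g \<le> c * L2_fun_norm f"
    using nn_integral_le_L2_fun[OF g] c L2_fun_norm_nonneg by (metis mult_nonneg_nonneg)+
qed

lemma L2_fun_norm_cong_AE:
  assumes [measurable]: "f \<in> borel_measurable lebesgue" "g \<in> borel_measurable lebesgue"
    and "AE x in lebesgue. f x = g x"
  shows "L2_fun_norm f = L2_fun_norm g"
  unfolding L2_fun_norm_def
  by (rule arg_cong[where f = sqrt], rule integral_cong_AE) (use assms(3) in auto)

lemma L2_fun_cong_AE:
  assumes "f \<in> L2_fun" "g \<in> borel_measurable lebesgue" "AE x in lebesgue. f x = g x"
  shows "g \<in> L2_fun"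
  by (rule L2_fun_bound(1)[OF assms(2,1), of 1]) (use assms(3) in auto)

lemma L2_fun_zero: "(\<lambda>_. 0) \<in> L2_fun"
  by (simp add: L2_fun_def)

lemma L2_fun_norm_zero: "L2_fun_norm (\<lambda>_. 0) = 0"
  by (simp add: L2_fun_norm_def)

lemma L2_fun_mult:
  assumes "f \<in> L2_fun" shows "(\<lambda>x. c * f x) \<in> L2_fun"
  using L2_fun_bound(1)[of "\<lambda>x. c * f x" f "norm c"] L2_fun_measurable[OF assms] assms
  by (auto simp: norm_mult)

lemma L2_fun_norm_mult: "L2_fun_norm (\<lambda>x. c * f x) = norm c * L2_fun_norm f"
  by (simp add: L2_fun_norm_def norm_mult power_mult_distrib real_sqrt_mult)

lemma L2_fun_cnj: "f \<in> L2_fun \<Longrightarrow> (\<lambda>x. cnj (f x)) \<in> L2_fun"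
  by (auto simp: L2_fun_def intro: borel_measurable_continuous_onI[THEN measurable_compose[rotated]]
      continuous_intros)

lemma L2_fun_norm_cnj: "L2_fun_norm (\<lambda>x. cnj (f x)) = L2_fun_norm f"
  by (simp add: L2_fun_norm_def)

text \<open>This is 2 |x| |y| <= (b/a) |x|^2 + (a/b) |y|^2. If \<open>a\<close> and \<open>b\<close>
  are the L2 norms of the two summands, integrating the right-hand side gives exactly (a + b)^2,
  which is Minkowski's inequality.\<close>

lemma norm_add_power2_le_weighted:
  fixes x y :: "'a::real_normed_vector"
  assumes "a > 0" "b > 0"
  shows "(norm (x + y))\<^sup>2 \<le> (1 + b / a) * (norm x)\<^sup>2 + (1 + a / b) * (norm y)\<^sup>2"
proof -
  have "(norm (x + y))\<^sup>2 \<le> (norm x + norm y)\<^sup>2"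
    by (intro power_mono norm_triangle_ineq) auto
  also have "\<dots> \<le> (1 + b / a) * (norm x)\<^sup>2 + (1 + a / b) * (norm y)\<^sup>2"
  proof -
    have "0 \<le> (b * norm x - a * norm y)\<^sup>2 / (a * b)"
      using assms by simp
    also have "\<dots> = b / a * (norm x)\<^sup>2 + a / b * (norm y)\<^sup>2 - 2 * norm x * norm y"
      using assms by (simp add: field_simps power2_eq_square)
    finally show ?thesis by (simp add: power2_sum algebra_simps)
  qed
  finally show ?thesis .
qed

text \<open>Minkowski's inequality: the weights of the pointwise bound are taken slightly above the two
  norms, since a norm may be zero.\<close>

lemma
  assumes f: "f \<in> L2_fun" and g: "g \<in> L2_fun"
  shows L2_fun_add: "(\<lambda>x. f x + g x) \<in> L2_fun"
    and L2_fun_norm_triangle: "L2_fun_norm (\<lambda>x. f x + g x) \<le> L2_fun_norm f + L2_fun_norm g"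
proof -
  have [measurable]: "f \<in> borel_measurable lebesgue" "g \<in> borel_measurable lebesgue"
    using f g by (auto intro: L2_fun_measurable)
  have *: "(\<lambda>x. f x + g x) \<in> L2_fun \<and> L2_fun_norm (\<lambda>x. f x + g x) \<le> a + b"
    if a: "a > L2_fun_norm f" and b: "b > L2_fun_norm g" for a b
  proof -
    have pos: "a > 0" "b > 0"
      using a b L2_fun_norm_nonneg[of f] L2_fun_norm_nonneg[of g] by auto
    have "(\<integral>\<^sup>+x. ennreal ((norm (f x + g x))\<^sup>2) \<partial>lebesgue) \<le>
        (\<integral>\<^sup>+x. ennreal (1 + b / a) * ennreal ((norm (f x))\<^sup>2) + ennreal (1 + a / b) * ennreal ((norm (g x))\<^sup>2) \<partial>lebesgue)"
      using norm_add_power2_le_weighted[OF pos] pos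
      by (intro nn_integral_mono) (simp add: ennreal_mult[symmetric] ennreal_plus[symmetric] del: ennreal_plus)
    also have "\<dots> = ennreal (1 + b / a) * ennreal ((L2_fun_norm f)\<^sup>2) + ennreal (1 + a / b) * ennreal ((L2_fun_norm g)\<^sup>2)"
      by (simp add: nn_integral_add nn_integral_cmult nn_integral_L2_fun f g)
    also have "\<dots> = ennreal ((1 + b / a) * (L2_fun_norm f)\<^sup>2 + (1 + a / b) * (L2_fun_norm g)\<^sup>2)"
      using pos by (simp add: ennreal_mult[symmetric] ennreal_plus[symmetric] del: ennreal_plus)
    also have "\<dots> \<le> ennreal ((a + b)\<^sup>2)"
    proof (rule ennreal_leI)
      have "(1 + b / a) * (L2_fun_norm f)\<^sup>2 + (1 + a / b) * (L2_fun_norm g)\<^sup>2 \<le> (1 + b / a) * a\<^sup>2 + (1 + a / b) * b\<^sup>2"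
        using a b pos by (intro add_mono mult_left_mono power_mono L2_fun_norm_nonneg) auto
      also have "\<dots> = (a + b)\<^sup>2"
        using pos by (simp add: field_simps power2_eq_square)
      finally show "(1 + b / a) * (L2_fun_norm f)\<^sup>2 + (1 + a / b) * (L2_fun_norm g)\<^sup>2 \<le> (a + b)\<^sup>2" .
    qed
    finally show ?thesis
      using nn_integral_le_L2_fun[of "\<lambda>x. f x + g x" "a + b"] pos by simp
  qed
  show "(\<lambda>x. f x + g x) \<in> L2_fun"
    using *[of "L2_fun_norm f + 1" "L2_fun_norm g + 1"] by simp
  show "L2_fun_norm (\<lambda>x. f x + g x) \<le> L2_fun_norm f + L2_fun_norm g"
  proof (rule field_le_epsilon)
    fix e :: real assume "e > 0"
    then show "L2_fun_norm (\<lambda>x. f x + g x) \<le> L2_fun_norm f + L2_fun_norm g + e"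
      using *[of "L2_fun_norm f + e / 2" "L2_fun_norm g + e / 2"] by simp
  qed
qed

lemma L2_fun_diff: "f \<in> L2_fun \<Longrightarrow> g \<in> L2_fun \<Longrightarrow> (\<lambda>x. f x - g x) \<in> L2_fun"
  using L2_fun_add[of f "\<lambda>x. - 1 * g x"] L2_fun_mult[of g "-1"] by simp

lemma L2_fun_norm_minus_commute: "L2_fun_norm (\<lambda>x. f x - g x) = L2_fun_norm (\<lambda>x. g x - f x)"
  by (simp add: L2_fun_norm_def norm_minus_commute)

lemma L2_fun_norm_diff_triangle:
  assumes "f \<in> L2_fun" "g \<in> L2_fun" "h \<in> L2_fun"
  shows "L2_fun_norm (\<lambda>x. f x - h x) \<le> L2_fun_norm (\<lambda>x. f x - g x) + L2_fun_norm (\<lambda>x. g x - h x)"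
  using L2_fun_norm_triangle[OF L2_fun_diff[OF assms(1,2)] L2_fun_diff[OF assms(2,3)]] by simp

lemma L2_fun_norm_reverse_triangle:
  assumes "f \<in> L2_fun" "g \<in> L2_fun"
  shows "\<bar>L2_fun_norm f - L2_fun_norm g\<bar> \<le> L2_fun_norm (\<lambda>x. f x - g x)"
  using L2_fun_norm_triangle[OF L2_fun_diff[OF assms] assms(2)]
    L2_fun_norm_triangle[OF L2_fun_diff[OF assms(2,1)] assms(1)]
    L2_fun_norm_minus_commute[of f g] by simp

lemma L2_fun_sum: "(\<And>i. i \<in> I \<Longrightarrow> f i \<in> L2_fun) \<Longrightarrow> (\<lambda>x. \<Sum>i\<in>I. f i x) \<in> L2_fun"
  by (induction I rule: infinite_finite_induct) (auto intro: L2_fun_zero L2_fun_add)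

lemma L2_fun_norm_sum:
  "(\<And>i. i \<in> I \<Longrightarrow> f i \<in> L2_fun) \<Longrightarrow> L2_fun_norm (\<lambda>x. \<Sum>i\<in>I. f i x) \<le> (\<Sum>i\<in>I. L2_fun_norm (f i))"
proof (induction I rule: infinite_finite_induct)
  case (insert i I)
  then show ?case
    using L2_fun_norm_triangle[of "f i" "\<lambda>x. \<Sum>i\<in>I. f i x"] by (force intro: L2_fun_sum)
qed (auto simp: L2_fun_norm_zero)

lemma L2_fun_norm_eq_0_AE:
  assumes "f \<in> L2_fun" "L2_fun_norm f = 0" shows "AE x in lebesgue. f x = 0"
proof -
  have "(LINT x|lebesgue. (norm (f x))\<^sup>2) = 0"
    using assms(2) L2_fun_norm_power2[of f] by simp
  then show ?thesis
    using integral_nonneg_eq_0_iff_AE[OF L2_fun_integrable[OF assms(1)]] by simp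
qed

lemma L2_fun_norm_diff_eq_0_AE:
  assumes "f \<in> L2_fun" "g \<in> L2_fun" "L2_fun_norm (\<lambda>x. f x - g x) = 0"
  shows "AE x in lebesgue. f x = g x"
  using L2_fun_norm_eq_0_AE[OF L2_fun_diff[OF assms(1,2)] assms(3)] by simp

lemma L2_fun_norm_diff_0_if_AE:
  fixes f g :: "real^'n \<Rightarrow> complex"
  assumes "f \<in> borel_measurable lebesgue" "g \<in> borel_measurable lebesgue" "AE x in lebesgue. f x = g x"
  shows "L2_fun_norm (\<lambda>x. f x - g x) = 0"
proof -
  have "L2_fun_norm (\<lambda>x. f x - g x) = L2_fun_norm (\<lambda>_::real^'n. 0)"
    by (rule L2_fun_norm_cong_AE) (use assms in auto)
  then show ?thesis by (simp add: L2_fun_norm_zero)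
qed

text \<open>Cauchy-Schwarz by the same weighting: |f g| <= (b/a |f|^2 + a/b |g|^2) / 2 integrates to
  at most a b when \<open>a\<close> and \<open>b\<close> exceed the two norms, and the excess is
  then sent to 0. The pairing is bilinear, without conjugation.\<close>

lemma
  assumes f: "f \<in> L2_fun" and g: "g \<in> L2_fun"
  shows integrable_mult_L2_fun: "integrable lebesgue (\<lambda>x. f x * g x)"
    and norm_integral_mult_L2_fun: "norm (LINT x|lebesgue. f x * g x) \<le> L2_fun_norm f * L2_fun_norm g"
proof -
  have [measurable]: "f \<in> borel_measurable lebesgue" "g \<in> borel_measurable lebesgue"
    using f g by (auto intro: L2_fun_measurable)
  have int: "integrable lebesgue (\<lambda>x. (b / a * (norm (f x))\<^sup>2 + a / b * (norm (g x))\<^sup>2) / 2)" for a b :: real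
    using f g by (intro integrable_divide Bochner_Integration.integrable_add integrable_mult_right L2_fun_integrable)
  have le: "norm (f x * g x) \<le> (b / a * (norm (f x))\<^sup>2 + a / b * (norm (g x))\<^sup>2) / 2"
    if "a > 0" "b > 0" for a b x
  proof -
    have "0 \<le> (b * norm (f x) - a * norm (g x))\<^sup>2 / (a * b)"
      using that by simp
    also have "\<dots> = b / a * (norm (f x))\<^sup>2 + a / b * (norm (g x))\<^sup>2 - 2 * norm (f x) * norm (g x)"
      using that by (simp add: field_simps power2_eq_square)
    finally show ?thesis by (simp add: norm_mult)
  qed
  show fg: "integrable lebesgue (\<lambda>x. f x * g x)"
    by (rule Bochner_Integration.integrable_bound[OF int[of 1 1]]) (use le[of 1 1] in auto)
  have *: "norm (LINT x|lebesgue. f x * g x) \<le> a * b"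
    if a: "a > L2_fun_norm f" and b: "b > L2_fun_norm g" for a b
  proof -
    have pos: "a > 0" "b > 0"
      using a b L2_fun_norm_nonneg[of f] L2_fun_norm_nonneg[of g] by auto
    have "norm (LINT x|lebesgue. f x * g x) \<le> (LINT x|lebesgue. norm (f x * g x))"
      by simp
    also have "\<dots> \<le> (LINT x|lebesgue. (b / a * (norm (f x))\<^sup>2 + a / b * (norm (g x))\<^sup>2) / 2)"
      by (intro integral_mono integrable_norm fg int le pos)
    also have "\<dots> = (b / a * (L2_fun_norm f)\<^sup>2 + a / b * (L2_fun_norm g)\<^sup>2) / 2"
      using f g by (simp add: L2_fun_norm_power2 L2_fun_integrable)
    also have "\<dots> \<le> (b / a * a\<^sup>2 + a / b * b\<^sup>2) / 2"
      using a b pos by (intro divide_right_mono add_mono mult_left_mono power_mono L2_fun_norm_nonneg) auto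
    also have "\<dots> = a * b"
      using pos by (simp add: field_simps power2_eq_square)
    finally show ?thesis .
  qed
  have "((\<lambda>e. (L2_fun_norm f + e) * (L2_fun_norm g + e)) \<longlongrightarrow> (L2_fun_norm f + 0) * (L2_fun_norm g + 0)) (at_right (0::real))"
    by (intro tendsto_intros)
  moreover have "\<forall>\<^sub>F e in at_right (0::real). norm (LINT x|lebesgue. f x * g x) \<le> (L2_fun_norm f + e) * (L2_fun_norm g + e)"
    using eventually_at_right_less[of "0::real"] by eventually_elim (auto intro: *)
  ultimately have "norm (LINT x|lebesgue. f x * g x) \<le> (L2_fun_norm f + 0) * (L2_fun_norm g + 0)"
    by (intro tendsto_lowerbound) auto
  then show "norm (LINT x|lebesgue. f x * g x) \<le> L2_fun_norm f * L2_fun_norm g"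
    by simp
qed

text \<open>Membership is part of the notion because the Bochner integral of a non-integrable
  function is 0 by convention: a vanishing \<open>L2_fun_norm\<close> alone would say nothing
  outside \<open>L2_fun\<close>.\<close>

definition L2_tendsto :: "(nat \<Rightarrow> real^'n \<Rightarrow> complex) \<Rightarrow> (real^'n \<Rightarrow> complex) \<Rightarrow> bool" where
  "L2_tendsto u g \<longleftrightarrow> (\<forall>i. u i \<in> L2_fun) \<and> g \<in> L2_fun \<and> (\<lambda>i. L2_fun_norm (\<lambda>x. u i x - g x)) \<longlonglongrightarrow> 0"

lemma L2_tendsto_norm:
  assumes "L2_tendsto u g" shows "(\<lambda>i. L2_fun_norm (u i)) \<longlonglongrightarrow> L2_fun_norm g"
proof (rule Lim_null[THEN iffD2], rule Lim_null_comparison)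
  show "\<forall>\<^sub>F i in sequentially. norm (L2_fun_norm (u i) - L2_fun_norm g) \<le> L2_fun_norm (\<lambda>x. u i x - g x)"
    using assms L2_fun_norm_reverse_triangle by (force simp: L2_tendsto_def intro: always_eventually)
qed (use assms in \<open>simp add: L2_tendsto_def\<close>)

lemma L2_tendsto_add:
  assumes "L2_tendsto u f" "L2_tendsto v g"
  shows "L2_tendsto (\<lambda>i x. u i x + v i x) (\<lambda>x. f x + g x)"
  unfolding L2_tendsto_def
proof (intro conjI allI)
  show "(\<lambda>i. L2_fun_norm (\<lambda>x. u i x + v i x - (f x + g x))) \<longlonglongrightarrow> 0"
  proof (rule Lim_null_comparison)
    show "\<forall>\<^sub>F i in sequentially. norm (L2_fun_norm (\<lambda>x. u i x + v i x - (f x + g x)))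
        \<le> L2_fun_norm (\<lambda>x. u i x - f x) + L2_fun_norm (\<lambda>x. v i x - g x)"
    proof (intro always_eventually allI)
      fix i
      have "L2_fun_norm (\<lambda>x. (u i x - f x) + (v i x - g x))
        \<le> L2_fun_norm (\<lambda>x. u i x - f x) + L2_fun_norm (\<lambda>x. v i x - g x)"
        using assms by (intro L2_fun_norm_triangle L2_fun_diff) (auto simp: L2_tendsto_def)
      then show "norm (L2_fun_norm (\<lambda>x. u i x + v i x - (f x + g x)))
        \<le> L2_fun_norm (\<lambda>x. u i x - f x) + L2_fun_norm (\<lambda>x. v i x - g x)"
        by (simp add: L2_fun_norm_nonneg algebra_simps)
    qed
    show "(\<lambda>i. L2_fun_norm (\<lambda>x. u i x - f x) + L2_fun_norm (\<lambda>x. v i x - g x)) \<longlonglongrightarrow> 0"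
      using assms tendsto_add[of _ 0 _ _ 0] by (fastforce simp: L2_tendsto_def)
  qed
qed (use assms in \<open>auto simp: L2_tendsto_def intro: L2_fun_add\<close>)

lemma L2_tendsto_mult:
  assumes "L2_tendsto u f" shows "L2_tendsto (\<lambda>i x. c * u i x) (\<lambda>x. c * f x)"
proof -
  have "(\<lambda>i. L2_fun_norm (\<lambda>x. c * (u i x - f x))) \<longlonglongrightarrow> norm c * 0"
    unfolding L2_fun_norm_mult using assms by (intro tendsto_intros) (simp add: L2_tendsto_def)
  then show ?thesis
    using assms by (auto simp: L2_tendsto_def algebra_simps intro: L2_fun_mult)
qed

lemma L2_tendsto_const: "f \<in> L2_fun \<Longrightarrow> L2_tendsto (\<lambda>_. f) f"
  by (simp add: L2_tendsto_def L2_fun_norm_zero)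

lemma L2_tendsto_cnj: "L2_tendsto u f \<Longrightarrow> L2_tendsto (\<lambda>i x. cnj (u i x)) (\<lambda>x. cnj (f x))"
  using L2_fun_norm_cnj[of "\<lambda>x. u i x - f x" for i]
  by (auto simp: L2_tendsto_def L2_fun_cnj)

lemma L2_tendsto_cong_AE:
  assumes "L2_tendsto u f" "\<And>i. AE x in lebesgue. u i x = v i x" "AE x in lebesgue. f x = g x"
    "\<And>i. v i \<in> borel_measurable lebesgue" "g \<in> borel_measurable lebesgue"
  shows "L2_tendsto v g"
proof -
  have "L2_fun_norm (\<lambda>x. v i x - g x) = L2_fun_norm (\<lambda>x. u i x - f x)" for i
  proof (rule L2_fun_norm_cong_AE)
    show "AE x in lebesgue. v i x - g x = u i x - f x"
      using assms(2)[of i] assms(3) by eventually_elim simp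
  qed (use assms in \<open>auto simp: L2_tendsto_def L2_fun_def intro!: borel_measurable_diff\<close>)
  then show ?thesis
    using assms(1) L2_fun_cong_AE[OF _ assms(4) assms(2)] L2_fun_cong_AE[OF _ assms(5) assms(3)]
    by (auto simp: L2_tendsto_def)
qed

lemma L2_tendsto_integral_mult:
  assumes "L2_tendsto u f" "L2_tendsto v g"
  shows "(\<lambda>i. LINT x|lebesgue. u i x * v i x) \<longlonglongrightarrow> (LINT x|lebesgue. f x * g x)"
proof (rule Lim_null[THEN iffD2], rule Lim_null_comparison)
  have L: "u i \<in> L2_fun" "v i \<in> L2_fun" "f \<in> L2_fun" "g \<in> L2_fun" for i
    using assms by (auto simp: L2_tendsto_def)
  show "\<forall>\<^sub>F i in sequentially. norm ((LINT x|lebesgue. u i x * v i x) - (LINT x|lebesgue. f x * g x))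
     \<le> L2_fun_norm (u i) * L2_fun_norm (\<lambda>x. v i x - g x) + L2_fun_norm (\<lambda>x. u i x - f x) * L2_fun_norm g"
  proof (intro always_eventually allI)
    fix i
    have "(LINT x|lebesgue. u i x * v i x) - (LINT x|lebesgue. f x * g x) =
        (LINT x|lebesgue. u i x * v i x - f x * g x)"
      by (intro Bochner_Integration.integral_diff[symmetric] integrable_mult_L2_fun L)
    also have "\<dots> = (LINT x|lebesgue. u i x * (v i x - g x) + (u i x - f x) * g x)"
      by (simp add: algebra_simps)
    also have "\<dots> = (LINT x|lebesgue. u i x * (v i x - g x)) + (LINT x|lebesgue. (u i x - f x) * g x)"
      by (intro Bochner_Integration.integral_add integrable_mult_L2_fun L2_fun_diff L)
    finally show "norm ((LINT x|lebesgue. u i x * v i x) - (LINT x|lebesgue. f x * g x))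
     \<le> L2_fun_norm (u i) * L2_fun_norm (\<lambda>x. v i x - g x) + L2_fun_norm (\<lambda>x. u i x - f x) * L2_fun_norm g"
      by (auto intro!: norm_triangle_le add_mono norm_integral_mult_L2_fun L2_fun_diff L)
  qed
  have "(\<lambda>i. L2_fun_norm (u i) * L2_fun_norm (\<lambda>x. v i x - g x) + L2_fun_norm (\<lambda>x. u i x - f x) * L2_fun_norm g)
     \<longlonglongrightarrow> L2_fun_norm f * 0 + 0 * L2_fun_norm g"
    using assms by (intro tendsto_intros L2_tendsto_norm) (auto simp: L2_tendsto_def)
  then show "(\<lambda>i. L2_fun_norm (u i) * L2_fun_norm (\<lambda>x. v i x - g x) + L2_fun_norm (\<lambda>x. u i x - f x) * L2_fun_norm g)
     \<longlonglongrightarrow> 0" by simp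
qed

text \<open>Integrating \<open>\<Sum>k. 4 ^ k * (norm (d k x))\<^sup>2\<close> shows \<open>norm (d k x) = O(2 ^ -k)\<close> almost everywhere.\<close>

lemma AE_summable_L2_fun:
  assumes d: "\<And>k. d k \<in> L2_fun" "\<And>k. L2_fun_norm (d k) \<le> (1 / 4) ^ k"
  shows "AE x in lebesgue. summable (\<lambda>k. norm (d k x))"
proof -
  have [measurable]: "d k \<in> borel_measurable lebesgue" for k
    using d(1) by (rule L2_fun_measurable)
  have "(\<integral>\<^sup>+x. (\<Sum>k. ennreal (4 ^ k * (norm (d k x))\<^sup>2)) \<partial>lebesgue) =
      (\<Sum>k. \<integral>\<^sup>+x. ennreal (4 ^ k) * ennreal ((norm (d k x))\<^sup>2) \<partial>lebesgue)"
    by (subst nn_integral_suminf) (simp_all add: ennreal_mult)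
  also have "\<dots> = (\<Sum>k. ennreal (4 ^ k * (L2_fun_norm (d k))\<^sup>2))"
    by (simp add: nn_integral_cmult nn_integral_L2_fun d ennreal_mult)
  also have "\<dots> \<le> (\<Sum>k. ennreal ((1 / 4) ^ k))"
  proof (intro suminf_le summableI ennreal_leI)
    fix k
    have "4 ^ k * (L2_fun_norm (d k))\<^sup>2 \<le> 4 ^ k * ((1 / 4) ^ k)\<^sup>2"
      using d(2) L2_fun_norm_nonneg by (intro mult_left_mono power_mono) auto
    also have "\<dots> = (1 / 4) ^ k"
      by (simp add: power2_eq_square power_divide)
    finally show "4 ^ k * (L2_fun_norm (d k))\<^sup>2 \<le> (1 / 4) ^ k" .
  qed
  also have "\<dots> < \<infinity>"
    by (subst suminf_ennreal2) (auto intro: summable_geometric)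
  finally have "AE x in lebesgue. (\<Sum>k. ennreal (4 ^ k * (norm (d k x))\<^sup>2)) \<noteq> \<infinity>"
    by (intro nn_integral_noteq_infinite) auto
  then show ?thesis
  proof eventually_elim
    case (elim x)
    then have "(\<Sum>k. ennreal (4 ^ k * (norm (d k x))\<^sup>2)) < top"
      unfolding infinity_ennreal_def less_top .
    from ennreal_enn2real[OF this] obtain C
      where C: "C \<ge> 0" "(\<Sum>k. ennreal (4 ^ k * (norm (d k x))\<^sup>2)) = ennreal C"
      using enn2real_nonneg by metis
    have "norm (d k x) \<le> sqrt C * (1 / 2) ^ k" for k
    proof -
      have "ennreal (4 ^ k * (norm (d k x))\<^sup>2) \<le> ennreal C"
        using sum_le_suminf[OF summableI, of "{k}" "\<lambda>k. ennreal (4 ^ k * (norm (d k x))\<^sup>2)"]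
        unfolding C(2) by simp
      moreover have "(2 ^ k)\<^sup>2 = (4::real) ^ k"
        by (simp add: power2_eq_square flip: power_mult_distrib)
      ultimately have "(2 ^ k * norm (d k x))\<^sup>2 \<le> C"
        using C(1) by (simp add: power_mult_distrib)
      then have "2 ^ k * norm (d k x) \<le> sqrt C"
        by (rule real_le_rsqrt)
      then show ?thesis by (simp add: power_divide field_simps)
    qed
    then show ?case
      by (intro summable_comparison_test'[OF summable_mult[OF summable_geometric], where N = 0]) auto
  qed
qed

text \<open>Along indices where the error is at most (1/4)^k, \<open>AE_summable_L2_fun\<close>
  makes the pointwise errors summable. The indices need not increase strictly;
  \<open>k \<le> r k\<close> already sends them to infinity.\<close>

lemma L2_tendsto_AE_subseq:
  assumes "L2_tendsto u g"
  obtains r where "\<And>k. k \<le> r k" "AE x in lebesgue. (\<lambda>k. u (r k) x) \<longlonglongrightarrow> g x"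
proof -
  have "\<exists>N\<ge>k. L2_fun_norm (\<lambda>x. u N x - g x) \<le> (1 / 4) ^ k" for k
  proof -
    have "\<forall>\<^sub>F i in sequentially. L2_fun_norm (\<lambda>x. u i x - g x) < (1 / 4) ^ k"
      using assms by (intro order_tendstoD) (auto simp: L2_tendsto_def)
    then have "\<forall>\<^sub>F i in sequentially. L2_fun_norm (\<lambda>x. u i x - g x) < (1 / 4) ^ k \<and> k \<le> i"
      by (intro eventually_conj eventually_ge_at_top)
    then show ?thesis
      by (auto simp: eventually_sequentially less_imp_le)
  qed
  then obtain r where r: "\<And>k. k \<le> r k" "\<And>k. L2_fun_norm (\<lambda>x. u (r k) x - g x) \<le> (1 / 4) ^ k"
    by metis
  have "AE x in lebesgue. summable (\<lambda>k. norm (u (r k) x - g x))"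
    using r(2) assms by (intro AE_summable_L2_fun L2_fun_diff) (auto simp: L2_tendsto_def)
  then have "AE x in lebesgue. (\<lambda>k. u (r k) x) \<longlonglongrightarrow> g x"
  proof eventually_elim
    case (elim x)
    then show ?case
      using summable_LIMSEQ_zero tendsto_norm_zero_iff LIM_zero_iff by blast
  qed
  with r(1) show ?thesis by (rule that)
qed

text \<open>Riesz-Fischer: along a fast subsequence the increments are absolutely summable almost
  everywhere, which defines the limit pointwise; Fatou's lemma then turns the Cauchy bound into a
  bound for the distance to that limit.\<close>

lemma L2_fun_complete:
  assumes u: "\<And>i. u i \<in> L2_fun"
    and cauchy: "\<And>e. e > 0 \<Longrightarrow> \<exists>N. \<forall>i\<ge>N. \<forall>j\<ge>N. L2_fun_norm (\<lambda>x. u i x - u j x) \<le> e"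
  obtains h where "L2_tendsto u h"
proof -
  have [measurable]: "u i \<in> borel_measurable lebesgue" for i
    using u by (rule L2_fun_measurable)
  obtain N where N: "\<And>k i j. i \<ge> N k \<Longrightarrow> j \<ge> N k \<Longrightarrow> L2_fun_norm (\<lambda>x. u i x - u j x) \<le> (1 / 4) ^ k"
    using cauchy[of "(1 / 4) ^ k" for k] by (simp add: choice_iff) metis
  \<comment> \<open>The sum dominates every \<open>N l\<close> with \<open>l \<le> k\<close>, so
    consecutive indices stay in the range of the bound for \<open>k\<close>; the summand
    \<open>k\<close> gives \<open>r k \<ge> k\<close>, used below to pass any given
    threshold.\<close>
  define r where "r k = k + (\<Sum>l\<le>k. N l)" for k
  have r_ge: "r j \<ge> N k" if "k \<le> j" for k j
  proof -
    have "N k \<le> (\<Sum>l\<le>j. N l)" using that by (intro member_le_sum) auto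
    then show ?thesis by (simp add: r_def)
  qed
  have "AE x in lebesgue. summable (\<lambda>k. norm (u (r (Suc k)) x - u (r k) x))"
    by (intro AE_summable_L2_fun L2_fun_diff u N r_ge) auto
  then have lim: "AE x in lebesgue. (\<lambda>k. u (r k) x) \<longlonglongrightarrow> lim (\<lambda>k. u (r k) x)"
  proof eventually_elim
    case (elim x)
    then have "summable (\<lambda>k. u (r (Suc k)) x - u (r k) x)"
      by (rule summable_norm_cancel)
    then have "convergent (\<lambda>n. \<Sum>k<n. u (r (Suc k)) x - u (r k) x)"
      by (simp add: summable_iff_convergent)
    then have "convergent (\<lambda>n. u (r n) x - u (r 0) x)"
      by (simp add: sum_lessThan_telescope[of "\<lambda>n. u (r n) x"])
    from convergent_add[OF this convergent_const[of "u (r 0) x"]]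
    have "convergent (\<lambda>n. u (r n) x)" by simp
    then show ?case by (simp add: convergent_LIMSEQ_iff)
  qed
  \<comment> \<open>\<open>lim\<close> has some value also at points of divergence, so
    \<open>h\<close> is a total measurable function; its values on that null set do not affect the
    norms.\<close>
  define h where "h x = lim (\<lambda>k. u (r k) x)" for x
  have [measurable]: "h \<in> borel_measurable lebesgue"
    unfolding h_def[abs_def] by measurable
  have close: "(\<lambda>x. u i x - h x) \<in> L2_fun \<and> L2_fun_norm (\<lambda>x. u i x - h x) \<le> e"
    if e: "e > 0" and M: "\<forall>i\<ge>M. \<forall>j\<ge>M. L2_fun_norm (\<lambda>x. u i x - u j x) \<le> e" and i: "i \<ge> M" for e M i
  proof -
    have "(\<integral>\<^sup>+x. ennreal ((norm (u i x - h x))\<^sup>2) \<partial>lebesgue) =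
        (\<integral>\<^sup>+x. liminf (\<lambda>k. ennreal ((norm (u i x - u (r k) x))\<^sup>2)) \<partial>lebesgue)"
    proof (rule nn_integral_cong_AE, use lim in eventually_elim)
      case (elim x)
      have "(\<lambda>k. ennreal ((norm (u i x - u (r k) x))\<^sup>2)) \<longlonglongrightarrow> ennreal ((norm (u i x - h x))\<^sup>2)"
        using elim by (intro tendsto_ennrealI tendsto_intros) (simp add: h_def)
      then show ?case by (rule lim_imp_Liminf[OF trivial_limit_sequentially, symmetric])
    qed
    also have "\<dots> \<le> liminf (\<lambda>k. \<integral>\<^sup>+x. ennreal ((norm (u i x - u (r k) x))\<^sup>2) \<partial>lebesgue)"
      by (rule nn_integral_liminf) simp
    also have "\<dots> \<le> ennreal (e\<^sup>2)"
    proof (rule Liminf_le)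
      show "\<forall>\<^sub>F k in sequentially. (\<integral>\<^sup>+x. ennreal ((norm (u i x - u (r k) x))\<^sup>2) \<partial>lebesgue) \<le> ennreal (e\<^sup>2)"
        using eventually_ge_at_top[of M]
      proof eventually_elim
        case (elim k)
        have "r k \<ge> M" using elim by (simp add: r_def)
        then have "L2_fun_norm (\<lambda>x. u i x - u (r k) x) \<le> e" using M i by blast
        then show ?case
          using nn_integral_L2_fun[OF L2_fun_diff[OF u[of i] u[of "r k"]]]
          by (simp add: power_mono[OF _ L2_fun_norm_nonneg])
      qed
    qed simp
    finally show ?thesis
      using nn_integral_le_L2_fun[of "\<lambda>x. u i x - h x" e] e by simp
  qed
  have h: "h \<in> L2_fun"
  proof -
    obtain M where "\<forall>i\<ge>M. \<forall>j\<ge>M. L2_fun_norm (\<lambda>x. u i x - u j x) \<le> 1"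
      using cauchy[of 1] by auto
    then have "(\<lambda>x. u M x - h x) \<in> L2_fun"
      using close[of 1 M M] by auto
    from L2_fun_diff[OF u[of M] this] show ?thesis by simp
  qed
  have "(\<lambda>i. L2_fun_norm (\<lambda>x. u i x - h x)) \<longlonglongrightarrow> 0"
  proof (rule LIMSEQ_I)
    fix e :: real assume "e > 0"
    then obtain M where "\<forall>i\<ge>M. \<forall>j\<ge>M. L2_fun_norm (\<lambda>x. u i x - u j x) \<le> e / 2"
      using cauchy[of "e / 2"] by auto
    then show "\<exists>no. \<forall>n\<ge>no. norm (L2_fun_norm (\<lambda>x. u n x - h x) - 0) < e"
      using close[of "e / 2" M] \<open>e > 0\<close> by (force simp: L2_fun_norm_nonneg)
  qed
  with u h have "L2_tendsto u h" by (simp add: L2_tendsto_def)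
  then show ?thesis by (rule that)
qed

section \<open>Density of test functions\<close>

lemma C0inf_continuous: "f \<in> C0inf \<Longrightarrow> continuous_on UNIV f"
  using C0infD C_diff_imp_continuous by blast

lemma integrable_continuous_compact_support:
  fixes g :: "'a::euclidean_space \<Rightarrow> 'b::{banach, second_countable_topology}"
  assumes "continuous_on UNIV g" "compact K" "\<And>x. g x \<noteq> 0 \<Longrightarrow> x \<in> K"
  shows "integrable lebesgue g"
proof -
  have "integrable lborel (\<lambda>x. indicator K x *\<^sub>R g x)"
    by (rule borel_integrable_compact[OF assms(2) continuous_on_subset[OF assms(1)]]) simp
  moreover have "(\<lambda>x. indicator K x *\<^sub>R g x) = g"
    using assms(3) by (force simp: indicator_def)
  ultimately show ?thesis
    using assms(1) by (simp add: integrable_completion borel_measurable_continuous_onI)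
qed

lemma C0inf_integrable:
  fixes f :: "'a::euclidean_space \<Rightarrow> 'b::{banach, second_countable_topology}"
  assumes "f \<in> C0inf" shows "integrable lebesgue f"
  using C0infD[OF assms] C0inf_continuous[OF assms] by (metis integrable_continuous_compact_support)

lemma C0inf_L2_fun: assumes "f \<in> C0inf" shows "f \<in> L2_fun"
proof -
  obtain K where K: "compact K" "\<And>x. f x \<noteq> 0 \<Longrightarrow> x \<in> K"
    using C0infD[OF assms] by blast
  have "integrable lebesgue (\<lambda>x. (norm (f x))\<^sup>2)"
    by (rule integrable_continuous_compact_support[OF _ K(1)])
      (use C0inf_continuous[OF assms] K(2) in \<open>auto intro!: continuous_intros\<close>)
  then show ?thesis
    using borel_measurable_integrable[OF C0inf_integrable[OF assms]] by (simp add: L2_fun_def)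
qed

text \<open>The limit inherits the bound \<open>w\<close> almost everywhere, so the squared distance
  has the integrable majorant 4 w^2.\<close>

lemma L2_tendsto_dominated:
  fixes u :: "nat \<Rightarrow> real^'n \<Rightarrow> complex" and w :: "real^'n \<Rightarrow> real"
  assumes u: "\<And>i. u i \<in> borel_measurable lebesgue" and f: "f \<in> borel_measurable lebesgue"
    and lim: "AE x in lebesgue. (\<lambda>i. u i x) \<longlonglongrightarrow> f x"
    and bd: "\<And>i. AE x in lebesgue. norm (u i x) \<le> w x"
    and w: "w \<in> borel_measurable lebesgue" "integrable lebesgue (\<lambda>x. (w x)\<^sup>2)"
  shows "L2_tendsto u f"
proof -
  note [measurable] = u f w(1)
  have fw: "AE x in lebesgue. norm (f x) \<le> w x"
  proof -
    have "AE x in lebesgue. \<forall>i. norm (u i x) \<le> w x"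
      using bd by (simp add: AE_all_countable)
    with lim show ?thesis
    proof eventually_elim
      case (elim x)
      then show ?case
        by (intro tendsto_upperbound[OF tendsto_norm[OF elim(1)]]) auto
    qed
  qed
  have L2: "g \<in> L2_fun" if [measurable]: "g \<in> borel_measurable lebesgue" and "AE x in lebesgue. norm (g x) \<le> w x" for g :: "real^'n \<Rightarrow> complex"
  proof -
    have "integrable lebesgue (\<lambda>x. (norm (g x))\<^sup>2)"
    proof (rule Bochner_Integration.integrable_bound[OF w(2)])
      show "AE x in lebesgue. norm ((norm (g x))\<^sup>2) \<le> norm ((w x)\<^sup>2)"
        using that(2) by eventually_elim (simp add: power_mono)
    qed simp
    then show ?thesis by (simp add: L2_fun_def)
  qed
  have "(\<lambda>i. LINT x|lebesgue. (norm (u i x - f x))\<^sup>2) \<longlonglongrightarrow> (LINT x|(lebesgue :: (real^'n) measure). 0 :: real)"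
  proof (rule integral_dominated_convergence)
    show "integrable lebesgue (\<lambda>x. 4 * (w x)\<^sup>2)" using w(2) by simp
    show "AE x in lebesgue. (\<lambda>i. (norm (u i x - f x))\<^sup>2) \<longlonglongrightarrow> 0"
      using lim
    proof eventually_elim
      case (elim x)
      have "(\<lambda>i. (norm (u i x - f x))\<^sup>2) \<longlonglongrightarrow> (norm (f x - f x))\<^sup>2"
        by (intro tendsto_intros elim)
      then show ?case by simp
    qed
    show "AE x in lebesgue. norm ((norm (u i x - f x))\<^sup>2) \<le> 4 * (w x)\<^sup>2" for i
      using fw bd[of i]
    proof eventually_elim
      case (elim x)
      have "norm (u i x - f x) \<le> 2 * w x"
        using elim norm_triangle_ineq4[of "u i x" "f x"] by simp
      then have "(norm (u i x - f x))\<^sup>2 \<le> (2 * w x)\<^sup>2"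
        by (intro power_mono) auto
      then show ?case by (simp add: power_mult_distrib)
    qed
  qed simp_all
  from tendsto_real_sqrt[OF this] have "(\<lambda>i. L2_fun_norm (\<lambda>x. u i x - f x)) \<longlonglongrightarrow> 0"
    by (simp add: L2_fun_norm_def)
  then show ?thesis
    using L2[OF f fw] L2[OF u bd] by (simp add: L2_tendsto_def)
qed

definition C0inf_approx :: "(real^'n \<Rightarrow> complex) \<Rightarrow> bool" where
  "C0inf_approx f \<longleftrightarrow> (\<exists>\<phi>. (\<forall>i. \<phi> i \<in> C0inf) \<and> L2_tendsto \<phi> f)"

lemma C0inf_approx_add:
  assumes "C0inf_approx f" "C0inf_approx g" shows "C0inf_approx (\<lambda>x. f x + g x)"
proof -
  obtain \<phi> \<psi> where "\<forall>i. \<phi> i \<in> C0inf" "L2_tendsto \<phi> f" "\<forall>i. \<psi> i \<in> C0inf" "L2_tendsto \<psi> g"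
    using assms by (auto simp: C0inf_approx_def)
  then show ?thesis
    unfolding C0inf_approx_def
    by (intro exI[of _ "\<lambda>i x. \<phi> i x + \<psi> i x"]) (simp add: L2_tendsto_add C0inf_add)
qed

lemma C0inf_approx_mult:
  assumes "C0inf_approx f" shows "C0inf_approx (\<lambda>x. c * f x)"
proof -
  obtain \<phi> where "\<forall>i. \<phi> i \<in> C0inf" "L2_tendsto \<phi> f"
    using assms by (auto simp: C0inf_approx_def)
  then show ?thesis
    unfolding C0inf_approx_def
    by (intro exI[of _ "\<lambda>i x. c * \<phi> i x"])
      (auto intro: L2_tendsto_mult C0inf_bounded_linear[OF bounded_linear_mult_right])
qed

lemma C0inf_approx_zero: "C0inf_approx (\<lambda>_. 0)"
  unfolding C0inf_approx_def
  by (intro exI[of _ "\<lambda>_ _. 0"]) (auto intro: C0inf_zero L2_tendsto_const L2_fun_zero)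

lemma C0inf_approx_sum: "(\<And>i. i \<in> I \<Longrightarrow> C0inf_approx (f i)) \<Longrightarrow> C0inf_approx (\<lambda>x. \<Sum>i\<in>I. f i x)"
  by (induction I rule: infinite_finite_induct) (simp_all add: C0inf_approx_zero C0inf_approx_add)

text \<open>A diagonal choice: the test function picked for \<open>f j\<close> is within 1 / (j + 1)
  of it, an error that vanishes in the limit.\<close>

lemma C0inf_approx_closed:
  assumes f: "\<And>j. C0inf_approx (f j)" "L2_tendsto f g" shows "C0inf_approx g"
proof -
  have "\<exists>\<phi>\<in>C0inf. L2_fun_norm (\<lambda>x. \<phi> x - f j x) \<le> 1 / real (Suc j)" for j
  proof -
    obtain \<phi> where \<phi>: "\<forall>i. \<phi> i \<in> C0inf" "L2_tendsto \<phi> (f j)"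
      using f(1) by (auto simp: C0inf_approx_def)
    have "\<forall>\<^sub>F i in sequentially. L2_fun_norm (\<lambda>x. \<phi> i x - f j x) < 1 / real (Suc j)"
      using \<phi>(2) by (intro order_tendstoD) (auto simp: L2_tendsto_def)
    then obtain i where "L2_fun_norm (\<lambda>x. \<phi> i x - f j x) < 1 / real (Suc j)"
      by (auto simp: eventually_sequentially)
    with \<phi>(1) show ?thesis by (intro bexI[of _ "\<phi> i"]) auto
  qed
  then obtain \<phi> where \<phi>: "\<And>j. \<phi> j \<in> C0inf" "\<And>j. L2_fun_norm (\<lambda>x. \<phi> j x - f j x) \<le> 1 / real (Suc j)"
    by metis
  have L: "\<phi> j \<in> L2_fun" "f j \<in> L2_fun" "g \<in> L2_fun" for j
    using \<phi> f(2) by (auto intro: C0inf_L2_fun simp: L2_tendsto_def)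
  have "(\<lambda>j. L2_fun_norm (\<lambda>x. \<phi> j x - g x)) \<longlonglongrightarrow> 0"
  proof (rule Lim_null_comparison)
    show "\<forall>\<^sub>F j in sequentially. norm (L2_fun_norm (\<lambda>x. \<phi> j x - g x)) \<le> 1 / real (Suc j) + L2_fun_norm (\<lambda>x. f j x - g x)"
    proof (intro always_eventually allI)
      fix j
      show "norm (L2_fun_norm (\<lambda>x. \<phi> j x - g x)) \<le> 1 / real (Suc j) + L2_fun_norm (\<lambda>x. f j x - g x)"
        using L2_fun_norm_diff_triangle[OF L, of j j] \<phi>(2)[of j]
        unfolding real_norm_def abs_of_nonneg[OF L2_fun_norm_nonneg] by linarith
    qed
    have "(\<lambda>j. 1 / real (Suc j) + L2_fun_norm (\<lambda>x. f j x - g x)) \<longlonglongrightarrow> 0 + 0"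
      using f(2) by (intro tendsto_add LIMSEQ_Suc[OF lim_1_over_n]) (simp add: L2_tendsto_def)
    then show "(\<lambda>j. 1 / real (Suc j) + L2_fun_norm (\<lambda>x. f j x - g x)) \<longlonglongrightarrow> 0" by simp
  qed
  then show ?thesis
    using \<phi>(1) L by (auto simp: C0inf_approx_def L2_tendsto_def)
qed

lemma C0inf_approx_indicator_open:
  assumes "open U" "U \<in> lmeasurable" shows "C0inf_approx (indicator U)"
proof -
  obtain \<phi> :: "nat \<Rightarrow> real^'a \<Rightarrow> real" where \<phi>: "\<And>k. \<phi> k \<in> C0inf" "\<And>k x. 0 \<le> \<phi> k x"
    "\<And>k x. \<phi> k x \<le> indicator U x" "\<And>x. (\<lambda>k. \<phi> k x) \<longlonglongrightarrow> indicator U x"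
    using C0inf_approx_open_indicator[OF assms(1)] by blast
  have C: "(\<lambda>x. complex_of_real (\<phi> k x)) \<in> C0inf" for k
    by (rule C0inf_bounded_linear[OF bounded_linear_of_real \<phi>(1)])
  have "L2_tendsto (\<lambda>k x. complex_of_real (\<phi> k x)) (indicator U)"
  proof (rule L2_tendsto_dominated[where w = "indicator U"])
    show "AE x in lebesgue. (\<lambda>k. complex_of_real (\<phi> k x)) \<longlonglongrightarrow> indicator U x"
    proof (rule AE_I2)
      fix x
      have "(\<lambda>k. complex_of_real (\<phi> k x)) \<longlonglongrightarrow> complex_of_real (indicator U x)"
        by (intro tendsto_of_real \<phi>)
      then show "(\<lambda>k. complex_of_real (\<phi> k x)) \<longlonglongrightarrow> indicator U x"
        by (cases "x \<in> U") simp_all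
    qed
    show "AE x in lebesgue. norm (complex_of_real (\<phi> k x)) \<le> indicator U x" for k
      using \<phi>(2,3) by simp
    have "(\<lambda>x. (indicator U x)\<^sup>2) = (indicator U :: _ \<Rightarrow> real)"
      by (auto simp: indicator_def)
    then show "integrable lebesgue (\<lambda>x. (indicat_real U x)\<^sup>2)"
      using assms(2) by (simp add: lmeasurable_iff_integrable)
  qed (use C C0inf_L2_fun L2_fun_measurable assms(2) in \<open>auto intro: fmeasurableD borel_measurable_indicator\<close>)
  then show ?thesis
    unfolding C0inf_approx_def using C by (intro exI[of _ "\<lambda>k x. complex_of_real (\<phi> k x)"]) simp
qed

lemma L2_fun_indicator:
  assumes "A \<in> lmeasurable" shows "indicator A \<in> L2_fun" "L2_fun_norm (indicator A) = sqrt (measure lebesgue A)"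
proof -
  have eq: "(\<lambda>x. (norm (indicator A x :: complex))\<^sup>2) = (indicator A :: _ \<Rightarrow> real)"
    by (auto simp: indicator_def)
  show "indicator A \<in> L2_fun"
    using assms by (auto simp: L2_fun_def eq lmeasurable_iff_integrable[symmetric] fmeasurableD)
  show "L2_fun_norm (indicator A) = sqrt (measure lebesgue A)"
    using assms by (simp add: L2_fun_norm_def eq)
qed

text \<open>By outer regularity \<open>A\<close> lies in open sets exceeding it by measure less than
  1 / (k + 1), and the L2 distance of the two indicators is the square root of that excess.\<close>

lemma C0inf_approx_indicator:
  fixes A :: "(real^'n) set"
  assumes A: "A \<in> lmeasurable" shows "C0inf_approx (indicator A)"
proof -
  have "\<exists>T. open T \<and> A \<subseteq> T \<and> T - A \<in> lmeasurable \<and> measure lebesgue (T - A) < 1 / real (Suc k)" for k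
  proof -
    obtain T where T: "open T" "A \<subseteq> T" "T - A \<in> lmeasurable" "emeasure lebesgue (T - A) < ennreal (1 / real (Suc k))"
      using sets_lebesgue_outer_open[OF fmeasurableD[OF A], of "1 / real (Suc k)"] by auto
    from T(4) have "measure lebesgue (T - A) < 1 / real (Suc k)"
      unfolding emeasure_eq_measure2[OF T(3)] ennreal_less_iff[OF measure_nonneg] .
    with T show ?thesis by blast
  qed
  then obtain T where T: "\<And>k. open (T k)" "\<And>k. A \<subseteq> T k" "\<And>k. T k - A \<in> lmeasurable"
    "\<And>k. measure lebesgue (T k - A) < 1 / real (Suc k)" by metis
  have "T k = A \<union> (T k - A)" for k using T(2) by blast
  then have lm: "T k \<in> lmeasurable" for k using fmeasurable.Un[OF A T(3)] by metis
  have "L2_fun_norm (\<lambda>x. indicator (T k) x - indicator A x) = sqrt (measure lebesgue (T k - A))" for k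
  proof -
    have "(\<lambda>x. indicator (T k) x - indicator A x) = (indicator (T k - A) :: _ \<Rightarrow> complex)"
      using T(2)[of k] by (intro ext) (auto simp: indicator_def)
    then show ?thesis using L2_fun_indicator(2)[OF T(3)] by simp
  qed
  moreover have "(\<lambda>k. sqrt (measure lebesgue (T k - A))) \<longlonglongrightarrow> sqrt 0"
  proof (rule tendsto_real_sqrt, rule tendsto_sandwich[OF _ _ tendsto_const])
    show "(\<lambda>k. 1 / real (Suc k)) \<longlonglongrightarrow> 0"
      by (rule LIMSEQ_Suc[OF lim_1_over_n])
  qed (simp, intro always_eventually allI less_imp_le T(4))
  ultimately have "L2_tendsto (\<lambda>k. indicator (T k)) (indicator A)"
    by (simp add: L2_tendsto_def L2_fun_indicator(1) A lm)
  from C0inf_approx_closed[OF _ this] show ?thesis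
    by (simp add: C0inf_approx_indicator_open T(1) lm)
qed

text \<open>The last step of the chain open sets, sets of finite measure, simple functions, L2: the
  simple functions are dominated by twice the norm of \<open>f\<close>, so they converge in L2 and
  not only pointwise.\<close>

theorem C0inf_dense_L2_fun:
  fixes f :: "real^'n \<Rightarrow> complex"
  assumes f: "f \<in> L2_fun" shows "C0inf_approx f"
proof -
  have fm: "f \<in> borel_measurable lebesgue" using f by (rule L2_fun_measurable)
  obtain s where s: "\<And>i. simple_function lebesgue (s i)" "\<And>x. (\<lambda>i. s i x) \<longlonglongrightarrow> f x"
    "\<And>i x. norm (s i x) \<le> 2 * norm (f x)"
    using borel_measurable_implies_sequence_metric[OF fm, of 0] by auto
  have sm: "s i \<in> borel_measurable lebesgue" for i
    using s(1) by (rule borel_measurable_simple_function)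
  have lim: "L2_tendsto s f"
    by (rule L2_tendsto_dominated[where w = "\<lambda>x. 2 * norm (f x)"])
      (use s sm fm L2_fun_integrable[OF f] in \<open>auto simp: power_mult_distrib\<close>)
  have "C0inf_approx (s i)" for i
  proof -
    have L: "s i \<in> L2_fun" using lim by (simp add: L2_tendsto_def)
    have "C0inf_approx (\<lambda>x. y * indicator (s i -` {y}) x)" for y
    proof (cases "y = 0")
      case False
      have meas: "s i -` {y} \<in> sets lebesgue"
        using measurable_sets[OF sm, of "{y}" i] by simp
      \<comment> \<open>Chebyshev: on the level set of a nonzero value \<open>y\<close> the quotient
        of |s i|^2 by |y|^2 is 1. The value 0 was split off because its level set may have infinite
        measure.\<close>
      have "integrable lebesgue (indicat_real (s i -` {y}))"
      proof (rule Bochner_Integration.integrable_bound)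
        show "integrable lebesgue (\<lambda>x. (norm (s i x))\<^sup>2 / (norm y)\<^sup>2)"
          using L2_fun_integrable[OF L] by simp
      qed (use False meas in \<open>auto simp: indicator_def\<close>)
      then show ?thesis
        by (intro C0inf_approx_mult C0inf_approx_indicator) (simp add: lmeasurable_iff_integrable)
    qed (simp add: C0inf_approx_zero)
    then have sum: "C0inf_approx (\<lambda>x. \<Sum>y\<in>range (s i). y * indicator (s i -` {y}) x)"
      by (intro C0inf_approx_sum)
    have ind: "indicat_real A x *\<^sub>R y = y * indicator A x" for A x and y :: complex
      by (cases "x \<in> A") auto
    have "(\<lambda>x. \<Sum>y\<in>range (s i). y * indicator (s i -` {y}) x) = s i"
    proof
      fix x
      show "(\<Sum>y\<in>range (s i). y * indicator (s i -` {y}) x) = s i x"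
        using simple_function_indicator_representation_banach[OF s(1), of x i, symmetric]
        by (simp add: ind)
    qed
    from sum[unfolded this] show ?thesis .
  qed
  then show ?thesis using lim by (rule C0inf_approx_closed)
qed

section \<open>Gauss summation and Plancherel's theorem\<close>

lemma
  fixes f :: "'a::euclidean_space \<Rightarrow> real \<Rightarrow> complex"
  assumes f: "\<And>b. b \<in> Basis \<Longrightarrow> integrable lborel (f b)"
  shows integrable_lborel_prod: "integrable lborel (\<lambda>x::'a. \<Prod>b\<in>Basis. f b (x \<bullet> b))"
    and integral_lborel_prod: "(LINT x|lborel. (\<Prod>b\<in>Basis. f b (x \<bullet> b))) = (\<Prod>b\<in>Basis. (LINT t|lborel. f b t))"
proof -
  interpret product_sigma_finite "\<lambda>_::'a. lborel :: real measure" ..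
  have [measurable]: "f b \<in> borel_measurable borel" if "b \<in> Basis" for b
    using borel_measurable_integrable[OF f[OF that]] by simp
  have m: "(\<lambda>x::'a. \<Prod>b\<in>Basis. f b (x \<bullet> b)) \<in> borel_measurable borel" by measurable
  have T: "(\<lambda>g. \<Sum>b\<in>Basis. g b *\<^sub>R b) \<in> (\<Pi>\<^sub>M b\<in>(Basis::'a set). lborel) \<rightarrow>\<^sub>M borel" by measurable
  have eq: "(\<Prod>b\<in>Basis. f b ((\<Sum>b'\<in>Basis. g b' *\<^sub>R b') \<bullet> b)) = (\<Prod>b\<in>Basis. f b (g b))" for g :: "'a \<Rightarrow> real"
    by (rule prod.cong) (auto simp: inner_sum_left inner_Basis if_distrib cong: if_cong)
  show "integrable lborel (\<lambda>x::'a. \<Prod>b\<in>Basis. f b (x \<bullet> b))"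
    by (subst lborel_eq, subst integrable_distr_eq[OF T m]) (auto simp: eq intro!: product_integrable_prod f)
  show "(LINT x|lborel. (\<Prod>b\<in>Basis. f b (x \<bullet> b))) = (\<Prod>b\<in>Basis. (LINT t|lborel. f b t))"
    by (subst lborel_eq, subst integral_distr[OF T m]) (auto simp: eq intro!: product_integral_prod f)
qed

lemma std_normal_fourier:
  "(LINT x|lborel. exp (\<i> * complex_of_real (t * x)) * complex_of_real (std_normal_density x)) = complex_of_real (exp (- (t\<^sup>2) / 2))"
proof -
  have "char std_normal_distribution t = (LINT x|lborel. std_normal_density x *\<^sub>R exp (\<i> * complex_of_real (t * x)))"
    unfolding char_def by (rule integral_density) auto
  then show ?thesis
    by (simp only: char_std_normal_distribution scaleR_conv_of_real mult.commute[of "exp _"])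
qed

text \<open>The density of the standard normal law on the whole space. In the symmetric
  normalization of \<open>fourier_fun\<close> it is its own Fourier transform.\<close>

definition gauss :: "real^'n \<Rightarrow> real" where
  "gauss w = (2 * pi) powr (- (real CARD('n) / 2)) * exp (- (norm w)\<^sup>2 / 2)"

lemma gauss_eq_prod: "gauss w = (\<Prod>b\<in>Basis. std_normal_density (w \<bullet> b))"
proof -
  have "(norm w)\<^sup>2 = (\<Sum>b\<in>Basis. (w \<bullet> b)\<^sup>2)"
    unfolding power2_norm_eq_inner by (subst euclidean_inner) (simp add: power2_eq_square)
  then have "exp (- (norm w)\<^sup>2 / 2) = (\<Prod>b\<in>Basis. exp (- (w \<bullet> b)\<^sup>2 / 2))"
    by (simp add: exp_sum[symmetric] sum_negf sum_divide_distrib)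
  moreover have "(2 * pi) powr (- (real CARD('a) / 2)) = (\<Prod>b\<in>(Basis :: (real^'a) set). 1 / sqrt (2 * pi))"
  proof -
    have "(2 * pi) powr (- (real CARD('a) / 2)) = ((2 * pi) powr (- (1 / 2))) powr real CARD('a)"
      by (simp add: powr_powr)
    also have "(2 * pi) powr (- (1 / 2)) = 1 / sqrt (2 * pi)"
      by (simp add: powr_minus_divide powr_half_sqrt)
    also have "(1 / sqrt (2 * pi)) powr real CARD('a) = (1 / sqrt (2 * pi)) ^ CARD('a)"
      by (rule powr_realpow) simp
    finally show ?thesis by simp
  qed
  ultimately show ?thesis
    by (simp add: gauss_def std_normal_density_def prod.distrib prod_dividef power_one_over)
qed

lemma gauss_nonneg: "gauss w \<ge> 0"
  by (simp add: gauss_def)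

lemma gauss_measurable[measurable]: "gauss \<in> borel_measurable borel"
  unfolding gauss_def[abs_def] by measurable

lemma
  fixes t :: "real^'n"
  shows integrable_gauss: "integrable lborel (gauss :: real^'n \<Rightarrow> real)"
    and fourier_gauss: "(LINT w|lborel. exp (\<i> * complex_of_real (t \<bullet> w)) * complex_of_real (gauss w)) =
      complex_of_real (exp (- (norm t)\<^sup>2 / 2))"
proof -
  let ?f = "\<lambda>(t::real^'n) b s. exp (\<i> * complex_of_real ((t \<bullet> b) * s)) * complex_of_real (std_normal_density s)"
  have int: "integrable lborel (?f t b)" for t b
  proof (rule Bochner_Integration.integrable_bound)
    show "integrable lborel std_normal_density" by simp
  qed (auto simp: norm_mult)
  have eq: "(\<Prod>b\<in>Basis. ?f t b (w \<bullet> b)) = exp (\<i> * complex_of_real (t \<bullet> w)) * complex_of_real (gauss w)" for t w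
    unfolding gauss_eq_prod prod.distrib
    by (subst (2) euclidean_inner) (simp add: exp_sum[symmetric] sum_distrib_left)
  have norm: "exp (- (norm t)\<^sup>2 / 2) = (\<Prod>b\<in>Basis. exp (- (t \<bullet> b)\<^sup>2 / 2))" for t :: "real^'n"
  proof -
    have "(norm t)\<^sup>2 = (\<Sum>b\<in>Basis. (t \<bullet> b)\<^sup>2)"
      unfolding power2_norm_eq_inner by (subst euclidean_inner) (simp add: power2_eq_square)
    then show ?thesis
      by (simp add: exp_sum[symmetric] sum_negf sum_divide_distrib)
  qed
  have "integrable lborel (\<lambda>w::real^'n. complex_of_real (gauss w))"
    using integrable_lborel_prod[of "?f 0", OF int] by (simp only: eq) simp
  then show "integrable lborel (gauss :: real^'n \<Rightarrow> real)"
    by (simp only: complex_of_real_integrable_eq)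
  show "(LINT w|lborel. exp (\<i> * complex_of_real (t \<bullet> w)) * complex_of_real (gauss w)) =
      complex_of_real (exp (- (norm t)\<^sup>2 / 2))"
    using integral_lborel_prod[of "?f t", OF int] by (simp only: eq std_normal_fourier norm of_real_prod)
qed

lemma integral_gauss: "(LINT w|lborel. gauss w) = 1"
  using fourier_gauss[of 0] by simp

lemma exp_norm_eq_gauss: "exp (- (norm w)\<^sup>2 / 2) = (2 * pi) powr (real CARD('n) / 2) * gauss (w :: real^'n)"
proof -
  have "(2 * pi) powr (real CARD('n) / 2) * (2 * pi) powr (- (real CARD('n) / 2)) = 1"
    using powr_add[of "2 * pi" "real CARD('n) / 2" "- (real CARD('n) / 2)"] by simp
  then show ?thesis by (simp add: gauss_def flip: mult.assoc)
qed

lemma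
  fixes f :: "'a::euclidean_space \<Rightarrow> 'b::{banach, second_countable_topology}"
  assumes c: "c \<noteq> 0" and f: "f \<in> borel_measurable borel"
  shows integral_lborel_affine: "integral\<^sup>L lborel f = \<bar>c\<bar> ^ DIM('a) *\<^sub>R (LINT x|lborel. f (t + c *\<^sub>R x))"
    and integrable_lborel_affine: "integrable lborel f \<longleftrightarrow> integrable lborel (\<lambda>x. f (t + c *\<^sub>R x))"
proof -
  have pos: "\<bar>c\<bar> ^ DIM('a) > 0" using c by simp
  have sc: "integrable lborel (\<lambda>x. \<bar>c\<bar> ^ DIM('a) *\<^sub>R g x) \<longleftrightarrow> integrable lborel g" for g :: "'a \<Rightarrow> 'b"
    using integrable_scaleR_right[of "1 / \<bar>c\<bar> ^ DIM('a)" lborel "\<lambda>x. \<bar>c\<bar> ^ DIM('a) *\<^sub>R g x"] pos by auto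
  have T: "(\<lambda>x::'a. t + c *\<^sub>R x) \<in> lborel \<rightarrow>\<^sub>M borel" by simp
  show "integral\<^sup>L lborel f = \<bar>c\<bar> ^ DIM('a) *\<^sub>R (LINT x|lborel. f (t + c *\<^sub>R x))"
    by (subst lborel_affine[OF c, of t], subst integral_density)
      (use f pos in \<open>auto simp: integral_distr[OF T]\<close>)
  show "integrable lborel f \<longleftrightarrow> integrable lborel (\<lambda>x. f (t + c *\<^sub>R x))"
    by (subst lborel_affine[OF c, of t], subst integrable_density)
      (use f pos sc in \<open>auto simp: integrable_distr_eq[OF T]\<close>)
qed

text \<open>The hypothesis of Fubini's theorem for exchanges whose kernel is a character of modulus
  1. The measures are general because it is applied to \<open>lborel\<close> and to
  \<open>lebesgue\<close>.\<close>

lemma integrable_pair_mult_bounded: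
  fixes g h :: "'a \<Rightarrow> complex"
  assumes "sigma_finite_measure M" "sigma_finite_measure N"
    and g: "integrable M g" and h: "integrable N h"
    and k: "(\<lambda>(x, y). k x y) \<in> borel_measurable (M \<Otimes>\<^sub>M N)" "\<And>x y. norm (k x y) \<le> 1"
  shows "integrable (M \<Otimes>\<^sub>M N) (\<lambda>(x, y). g x * h y * k x y)"
proof -
  interpret pair_sigma_finite M N
    using assms(1,2) by (simp add: pair_sigma_finite_def)
  note [measurable] = borel_measurable_integrable[OF g] borel_measurable_integrable[OF h] k(1)
  have "integrable (M \<Otimes>\<^sub>M N) (\<lambda>(x, y). g x * h y)"
  proof (rule Fubini_integrable)
    have "integrable M (\<lambda>x. norm (g x) * (LINT y|N. norm (h y)))" using g by simp
    then show "integrable M (\<lambda>x. LINT y|N. norm (case (x, y) of (x, y) \<Rightarrow> g x * h y))"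
      by (simp add: norm_mult)
    show "AE x in M. integrable N (\<lambda>y. case (x, y) of (x, y) \<Rightarrow> g x * h y)"
      using h by simp
  qed measurable
  then show ?thesis
  proof (rule Bochner_Integration.integrable_bound)
    show "AE x in M \<Otimes>\<^sub>M N. norm (case x of (x, y) \<Rightarrow> g x * h y * k x y) \<le> norm (case x of (x, y) \<Rightarrow> g x * h y)"
      by (intro AE_I2) (use k(2) in \<open>auto simp: norm_mult intro!: mult_left_le\<close>)
  qed measurable
qed

text \<open>Substituting y = v / e reduces the integral to \<open>fourier_gauss\<close> at -z / e.
  Passing from exp(-|.|^2 / 2) to \<open>gauss\<close> happens twice, before and after, each time
  with a factor (2 pi)^(n/2); together they make (2 pi)^n.\<close>

lemma integral_scaled_gauss_fourier:
  fixes z :: "real^'n" assumes e: "e > 0"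
  shows "(LINT y|lborel. complex_of_real (exp (- (norm (e *\<^sub>R y))\<^sup>2 / 2)) * exp (- (\<i> * complex_of_real (y \<bullet> z)))) =
    complex_of_real ((2 * pi) powr (real CARD('n)) * (1 / e) ^ CARD('n) * gauss (z /\<^sub>R e))"
proof -
  let ?f = "\<lambda>y::real^'n. complex_of_real (exp (- (norm (e *\<^sub>R y))\<^sup>2 / 2)) * exp (- (\<i> * complex_of_real (y \<bullet> z)))"
  have "(LINT y|lborel. ?f y) = \<bar>1 / e\<bar> ^ DIM(real^'n) *\<^sub>R (LINT v|lborel. ?f (0 + (1 / e) *\<^sub>R v))"
    by (rule integral_lborel_affine) (use e in simp_all)
  also have "(\<lambda>v. ?f (0 + (1 / e) *\<^sub>R v)) = (\<lambda>v. complex_of_real ((2 * pi) powr (real CARD('n) / 2)) *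
      (exp (\<i> * complex_of_real ((- (z /\<^sub>R e)) \<bullet> v)) * complex_of_real (gauss v)))"
  proof
    fix v :: "real^'n"
    have "e *\<^sub>R (0 + (1 / e) *\<^sub>R v) = v" using e by simp
    moreover have "(0 + (1 / e) *\<^sub>R v) \<bullet> z = - ((- (z /\<^sub>R e)) \<bullet> v)"
      using e by (simp add: inner_commute divide_inverse)
    ultimately show "?f (0 + (1 / e) *\<^sub>R v) = complex_of_real ((2 * pi) powr (real CARD('n) / 2)) *
      (exp (\<i> * complex_of_real ((- (z /\<^sub>R e)) \<bullet> v)) * complex_of_real (gauss v))"
      by (simp only: exp_norm_eq_gauss of_real_mult of_real_minus mult_minus_right minus_minus mult.assoc
          mult.commute[of "complex_of_real (gauss v)"])
  qed
  also have "(LINT v|lborel. complex_of_real ((2 * pi) powr (real CARD('n) / 2)) *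
      (exp (\<i> * complex_of_real ((- (z /\<^sub>R e)) \<bullet> v)) * complex_of_real (gauss v))) =
      complex_of_real ((2 * pi) powr (real CARD('n) / 2) * exp (- (norm (z /\<^sub>R e))\<^sup>2 / 2))"
    by (simp only: integral_mult_right_zero fourier_gauss norm_minus_cancel of_real_mult)
  also have "(2 * pi) powr (real CARD('n) / 2) * exp (- (norm (z /\<^sub>R e))\<^sup>2 / 2) = (2 * pi) powr (real CARD('n)) * gauss (z /\<^sub>R e)"
    unfolding exp_norm_eq_gauss using powr_add[of "2 * pi" "real CARD('n) / 2" "real CARD('n) / 2"] by simp
  finally show ?thesis
    using e by (simp add: scaleR_conv_of_real[where 'a = complex] mult.left_commute)
qed

text \<open>The transform of \<open>a\<close> need not be integrable; the Gaussian factor makes the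
  outer integral absolutely convergent. Fubini moves that factor onto \<open>a\<close>, leaving (2
  pi)^n times the mean of a(e w) for a standard normal w, and this mean tends to \<open>a 0\<close>
  as e = 1 / (k + 1) tends to 0.\<close>

lemma gauss_summation:
  fixes a :: "real^'n \<Rightarrow> complex"
  assumes a: "integrable lborel a" and M: "\<And>z. norm (a z) \<le> M"
    and cont: "\<And>s. s \<longlonglongrightarrow> 0 \<Longrightarrow> (\<lambda>k. a (s k)) \<longlonglongrightarrow> a 0"
  shows "(\<lambda>k. LINT y|lborel. complex_of_real (exp (- (norm ((1 / real (Suc k)) *\<^sub>R y))\<^sup>2 / 2)) *
      (LINT z|lborel. exp (- (\<i> * complex_of_real (y \<bullet> z))) * a z)) \<longlonglongrightarrow>
    complex_of_real ((2 * pi) powr (real CARD('n))) * a 0"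
proof -
  have am[measurable]: "a \<in> borel_measurable borel"
    using borel_measurable_integrable[OF a] by simp
  let ?g = "\<lambda>e (y::real^'n). complex_of_real (exp (- (norm (e *\<^sub>R y))\<^sup>2 / 2))"
  have E: "(LINT y|lborel. ?g e y * (LINT z|lborel. exp (- (\<i> * complex_of_real (y \<bullet> z))) * a z)) =
      complex_of_real ((2 * pi) powr (real CARD('n))) * (LINT w|lborel. a (e *\<^sub>R w) * complex_of_real (gauss w))"
    if e: "e > 0" for e
  proof -
    have "integrable lborel (\<lambda>y. (2 * pi) powr (real CARD('n) / 2) * gauss (0 + e *\<^sub>R y :: real^'n))"
      by (intro integrable_mult_right integrable_lborel_affine[THEN iffD1] integrable_gauss) (use e in auto)
    then have g: "integrable lborel (?g e)"
      by (simp only: exp_norm_eq_gauss complex_of_real_integrable_eq add_0)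
    have int: "integrable (lborel \<Otimes>\<^sub>M lborel) (\<lambda>(y, z). ?g e y * a z * exp (- (\<i> * complex_of_real (y \<bullet> z))))"
      by (rule integrable_pair_mult_bounded[OF _ _ g a]) (auto intro: sigma_finite_lborel)
    have "(LINT y|lborel. ?g e y * (LINT z|lborel. exp (- (\<i> * complex_of_real (y \<bullet> z))) * a z)) =
        (LINT y|lborel. (LINT z|lborel. ?g e y * a z * exp (- (\<i> * complex_of_real (y \<bullet> z)))))"
      by (simp only: integral_mult_right_zero[symmetric] integral_mult_left_zero[symmetric] mult.assoc mult.commute mult.left_commute)
    also have "\<dots> = (LINT z|lborel. (LINT y|lborel. ?g e y * a z * exp (- (\<i> * complex_of_real (y \<bullet> z)))))"
      by (rule lborel_pair.Fubini_integral[OF int, symmetric])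
    also have "\<dots> = (LINT z|lborel. a z * (LINT y|lborel. ?g e y * exp (- (\<i> * complex_of_real (y \<bullet> z)))))"
      by (simp only: integral_mult_right_zero[symmetric] integral_mult_left_zero[symmetric] mult.assoc mult.commute mult.left_commute)
    also have "\<dots> = (LINT z|lborel. complex_of_real ((2 * pi) powr (real CARD('n)) * (1 / e) ^ CARD('n)) * (a z * complex_of_real (gauss (z /\<^sub>R e))))"
      unfolding integral_scaled_gauss_fourier[OF e] by (simp add: ac_simps)
    also have "\<dots> = complex_of_real ((2 * pi) powr (real CARD('n)) * (1 / e) ^ CARD('n)) * (LINT z|lborel. a z * complex_of_real (gauss (z /\<^sub>R e)))"
      by (rule integral_mult_right_zero)
    \<comment> \<open>The substitution z = e w contributes the Jacobian e^n, which cancels the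
      factor (1 / e)^n.\<close>
    also have "(LINT z|lborel. a z * complex_of_real (gauss (z /\<^sub>R e))) =
        \<bar>e\<bar> ^ DIM(real^'n) *\<^sub>R (LINT w|lborel. a (0 + e *\<^sub>R w) * complex_of_real (gauss ((0 + e *\<^sub>R w) /\<^sub>R e)))"
      by (rule integral_lborel_affine) (use e in simp_all)
    finally show ?thesis
      using e by (simp add: scaleR_conv_of_real[where 'a = complex] power_one_over flip: power_mult_distrib of_real_power)
  qed
  have "(\<lambda>k. LINT w|lborel. a ((1 / real (Suc k)) *\<^sub>R w) * complex_of_real (gauss w)) \<longlonglongrightarrow>
      (LINT w|(lborel :: (real^'n) measure). a 0 * complex_of_real (gauss w))"
  proof (rule integral_dominated_convergence)
    show "integrable lborel (\<lambda>w::real^'n. M * gauss w)"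
      by (intro integrable_mult_right integrable_gauss)
    show "AE w in lborel. (\<lambda>k. a ((1 / real (Suc k)) *\<^sub>R w) * complex_of_real (gauss w)) \<longlonglongrightarrow> a 0 * complex_of_real (gauss w)"
    proof (intro AE_I2 tendsto_mult tendsto_const cont)
      fix w :: "real^'n"
      have "(\<lambda>k. (1 / real (Suc k)) *\<^sub>R w) \<longlonglongrightarrow> 0 *\<^sub>R w"
        by (intro tendsto_scaleR tendsto_const LIMSEQ_Suc[OF lim_1_over_n])
      then show "(\<lambda>k. (1 / real (Suc k)) *\<^sub>R w) \<longlonglongrightarrow> 0" by simp
    qed
    show "AE w in lborel. norm (a ((1 / real (Suc k)) *\<^sub>R w) * complex_of_real (gauss w)) \<le> M * gauss w" for k
      using M by (auto simp: norm_mult abs_of_nonneg[OF gauss_nonneg] intro!: mult_right_mono gauss_nonneg)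
  qed simp_all
  also have "(LINT w|(lborel :: (real^'n) measure). a 0 * complex_of_real (gauss w)) = a 0"
    by (simp add: integral_gauss)
  finally show ?thesis
    by (subst E) (auto intro!: tendsto_mult)
qed

text \<open>For Borel \<open>u\<close> the function \<open>u (x - z)\<close> of the pair is product
  measurable at once. The autocorrelation is therefore formed from a Borel representative, and the
  result is transferred back afterwards.\<close>

lemma AE_lebesgue_ex_borel:
  fixes f :: "'a::euclidean_space \<Rightarrow> complex"
  assumes f: "f \<in> borel_measurable lebesgue"
  obtains f' where "f' \<in> borel_measurable borel" "AE x in lebesgue. f x = f' x"
proof -
  have "(\<lambda>x. Re (f x)) \<in> borel_measurable lebesgue" "(\<lambda>x. Im (f x)) \<in> borel_measurable lebesgue"
    using f by (auto intro: borel_measurable_Re borel_measurable_Im)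
  then obtain g h where gh: "g \<in> borel_measurable lborel" "AE x in lborel. Re (f x) = g x"
      "h \<in> borel_measurable lborel" "AE x in lborel. Im (f x) = h x"
    using completion_ex_borel_measurable_real by metis
  have "AE x in lborel. f x = Complex (g x) (h x)"
    using gh(2,4) by eventually_elim (simp add: complex_eq_iff)
  moreover have "(\<lambda>x. Complex (g x) (h x)) \<in> borel_measurable borel"
    using gh(1,3) by (simp add: Complex_eq)
  ultimately show ?thesis
    using that AE_completion by blast
qed

section \<open>Translations in L2 and the autocorrelation\<close>

lemma
  fixes f :: "real^'n \<Rightarrow> complex"
  assumes f: "f \<in> L2_fun" "f \<in> borel_measurable borel"
  shows L2_fun_translate: "(\<lambda>x. f (x - z)) \<in> L2_fun"
    and L2_fun_norm_translate: "L2_fun_norm (\<lambda>x. f (x - z)) = L2_fun_norm f"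
proof -
  note [measurable] = f(2)
  have eq: "(\<lambda>x. f (- z + 1 *\<^sub>R x)) = (\<lambda>x. f (x - z))" by simp
  have "integrable lborel (\<lambda>x. (norm (f x))\<^sup>2)"
    using L2_fun_integrable[OF f(1)] by (simp add: integrable_completion)
  then have "integrable lborel (\<lambda>x. (norm (f (x - z)))\<^sup>2)"
    using integrable_lborel_affine[of 1 "\<lambda>x. (norm (f x))\<^sup>2" "- z"] by simp
  moreover have "(\<lambda>x. f (x - z)) \<in> borel_measurable borel" by measurable
  ultimately show "(\<lambda>x. f (x - z)) \<in> L2_fun"
    by (simp add: L2_fun_def integrable_completion measurable_completion)
  show "L2_fun_norm (\<lambda>x. f (x - z)) = L2_fun_norm f"
    using integral_lborel_affine[of 1 "\<lambda>x. (norm (f x))\<^sup>2" "- z"]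
    by (simp add: L2_fun_norm_def integral_completion)
qed

lemma L2_tendsto_translate_C0inf:
  fixes f :: "real^'n \<Rightarrow> complex"
  assumes f: "f \<in> C0inf" and s: "s \<longlonglongrightarrow> 0"
  shows "L2_tendsto (\<lambda>k x. f (x - s k)) f"
proof -
  have cont: "continuous_on UNIV f" using f by (rule C0inf_continuous)
  then have [measurable]: "f \<in> borel_measurable borel" by (rule borel_measurable_continuous_onI)
  obtain K where K: "compact K" "\<And>x. f x \<noteq> 0 \<Longrightarrow> x \<in> K"
    using C0infD[OF f] by blast
  obtain r where r: "\<And>x. x \<in> K \<Longrightarrow> norm x \<le> r"
    using compact_imp_bounded[OF K(1)] by (auto simp: bounded_iff)
  obtain B where B: "\<And>x. x \<in> K \<Longrightarrow> norm (f x) \<le> B" "B > 0"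
    using compact_imp_bounded[OF compact_continuous_image[OF continuous_on_subset[OF cont] K(1)]]
    by (auto simp: bounded_pos)
  \<comment> \<open>A convergent sequence of shifts is bounded, so all translates are supported in
    one ball, whose indicator times the maximum serves as majorant.\<close>
  obtain Z where Z: "\<And>k. norm (s k) \<le> Z"
    using convergent_imp_Bseq[OF convergentI[OF s]] by (auto simp: Bseq_def)
  show ?thesis
  proof (rule L2_tendsto_dominated[where w = "\<lambda>x. B * indicator (cball 0 (r + Z)) x"])
    have "(\<lambda>x. f (x - s k)) \<in> borel_measurable borel" for k by measurable
    then show "(\<lambda>x. f (x - s k)) \<in> borel_measurable lebesgue" for k
      by (simp add: measurable_completion)
    show "AE x in lebesgue. (\<lambda>k. f (x - s k)) \<longlonglongrightarrow> f x"
    proof (rule AE_I2)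
      fix x
      have "(\<lambda>k. x - s k) \<longlonglongrightarrow> x - 0" by (intro tendsto_diff tendsto_const s)
      then show "(\<lambda>k. f (x - s k)) \<longlonglongrightarrow> f x"
        using cont by (intro isCont_tendsto_compose[of x f]) (auto simp: continuous_on_eq_continuous_at)
    qed
    show "AE x in lebesgue. norm (f (x - s k)) \<le> B * indicator (cball 0 (r + Z)) x" for k
    proof (rule AE_I2)
      fix x
      show "norm (f (x - s k)) \<le> B * indicator (cball 0 (r + Z)) x"
      proof (cases "f (x - s k) = 0")
        case True
        then show ?thesis using B(2) by simp
      next
        case False
        then have "x - s k \<in> K" by (rule K(2))
        then have "norm (x - s k) \<le> r" "norm (f (x - s k)) \<le> B" using r B by auto
        moreover have "norm x \<le> norm (x - s k) + norm (s k)"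
          using norm_triangle_sub by (metis add.commute)
        ultimately show ?thesis using Z[of k] by auto
      qed
    qed
    have "(\<lambda>x. (B * indicator (cball 0 (r + Z)) x)\<^sup>2) = (\<lambda>x::real^'n. B\<^sup>2 * indicator (cball 0 (r + Z)) x)"
      by (auto simp: indicator_def)
    then show "integrable lebesgue (\<lambda>x::real^'n. (B * indicator (cball 0 (r + Z)) x)\<^sup>2)"
      using lmeasurable_cball[of "0 :: real^'n" "r + Z"] by (simp add: lmeasurable_iff_integrable)
    show "(\<lambda>x::real^'n. B * indicator (cball 0 (r + Z)) x) \<in> borel_measurable lebesgue"
      by (intro borel_measurable_times borel_measurable_indicator) auto
  qed (simp add: measurable_completion)
qed

text \<open>A test function within e/3 of \<open>f\<close> moves continuously, and since translation
  preserves the norm, its translates stay within e/3 of those of \<open>f\<close>.\<close>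

lemma L2_tendsto_translate:
  fixes f :: "real^'n \<Rightarrow> complex"
  assumes f: "f \<in> L2_fun" "f \<in> borel_measurable borel" and s: "s \<longlonglongrightarrow> 0"
  shows "L2_tendsto (\<lambda>k x. f (x - s k)) f"
proof -
  have "(\<lambda>k. L2_fun_norm (\<lambda>x. f (x - s k) - f x)) \<longlonglongrightarrow> 0"
  proof (rule LIMSEQ_I)
    fix e :: real assume e: "e > 0"
    obtain \<phi> where \<phi>: "\<forall>i. \<phi> i \<in> C0inf" "L2_tendsto \<phi> f"
      using C0inf_dense_L2_fun[OF f(1)] by (auto simp: C0inf_approx_def)
    have "\<forall>\<^sub>F i in sequentially. L2_fun_norm (\<lambda>x. \<phi> i x - f x) < e / 3"
      using \<phi>(2) e by (intro order_tendstoD) (auto simp: L2_tendsto_def)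
    then obtain i where i: "L2_fun_norm (\<lambda>x. \<phi> i x - f x) < e / 3"
      by (auto simp: eventually_sequentially)
    define \<psi> where "\<psi> = \<phi> i"
    have \<psi>: "\<psi> \<in> C0inf" using \<phi>(1) by (simp add: \<psi>_def)
    then have \<psi>m: "\<psi> \<in> borel_measurable borel"
      by (intro borel_measurable_continuous_onI C0inf_continuous)
    have \<psi>L: "\<psi> \<in> L2_fun" using \<psi> by (rule C0inf_L2_fun)
    have close: "L2_fun_norm (\<lambda>x. \<psi> x - f x) < e / 3" using i by (simp add: \<psi>_def)
    have close': "L2_fun_norm (\<lambda>x. f (x - z) - \<psi> (x - z)) < e / 3" for z
      using L2_fun_norm_translate[of "\<lambda>x. f x - \<psi> x" z] L2_fun_diff[OF f(1) \<psi>L] f(2) \<psi>m close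
      by (simp add: L2_fun_norm_minus_commute[of \<psi>])
    have "\<forall>\<^sub>F k in sequentially. L2_fun_norm (\<lambda>x. \<psi> (x - s k) - \<psi> x) < e / 3"
      using L2_tendsto_translate_C0inf[OF \<psi> s] e by (intro order_tendstoD) (auto simp: L2_tendsto_def)
    then obtain N where N: "\<And>k. k \<ge> N \<Longrightarrow> L2_fun_norm (\<lambda>x. \<psi> (x - s k) - \<psi> x) < e / 3"
      by (auto simp: eventually_sequentially)
    show "\<exists>no. \<forall>n\<ge>no. norm (L2_fun_norm (\<lambda>x. f (x - s n) - f x) - 0) < e"
    proof (intro exI allI impI)
      fix n assume "n \<ge> N"
      have T: "(\<lambda>x. f (x - s n)) \<in> L2_fun" "(\<lambda>x. \<psi> (x - s n)) \<in> L2_fun"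
        using L2_fun_translate f \<psi>L \<psi>m by auto
      have "L2_fun_norm (\<lambda>x. f (x - s n) - f x)
          \<le> L2_fun_norm (\<lambda>x. f (x - s n) - \<psi> (x - s n)) + L2_fun_norm (\<lambda>x. \<psi> (x - s n) - f x)"
        by (rule L2_fun_norm_diff_triangle[OF T f(1)])
      also have "L2_fun_norm (\<lambda>x. \<psi> (x - s n) - f x) \<le>
          L2_fun_norm (\<lambda>x. \<psi> (x - s n) - \<psi> x) + L2_fun_norm (\<lambda>x. \<psi> x - f x)"
        by (rule L2_fun_norm_diff_triangle[OF T(2) \<psi>L f(1)])
      finally show "norm (L2_fun_norm (\<lambda>x. f (x - s n) - f x) - 0) < e"
        using close close'[of "s n"] N[OF \<open>n \<ge> N\<close>] L2_fun_norm_nonneg[of "\<lambda>x. f (x - s n) - f x"]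
        by simp
    qed
  qed
  then show ?thesis
    using f by (simp add: L2_tendsto_def L2_fun_translate)
qed

text \<open>The convolution of \<open>u\<close> with the reflected conjugate x -> cnj (u (-x)). Its
  value at 0 is the squared norm of \<open>u\<close>, so Plancherel's formula becomes Fourier
  inversion at the single point 0.\<close>

definition autocorr :: "(real^'n \<Rightarrow> complex) \<Rightarrow> real^'n \<Rightarrow> complex" where
  "autocorr u z = (LINT x|lborel. u x * cnj (u (x - z)))"

lemma cnj_borel_measurable[measurable (raw)]:
  "f \<in> borel_measurable M \<Longrightarrow> (\<lambda>x. cnj (f x)) \<in> borel_measurable M"
  by (rule borel_measurable_continuous_on[OF continuous_on_cnj[OF continuous_on_id]])

lemma integral_lborel_reflect:
  fixes f :: "'a::euclidean_space \<Rightarrow> 'b::{banach, second_countable_topology}"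
  assumes "f \<in> borel_measurable borel"
  shows "(LINT x|lborel. f (t - x)) = integral\<^sup>L lborel f"
    and "integrable lborel (\<lambda>x. f (t - x)) \<longleftrightarrow> integrable lborel f"
  using integral_lborel_affine[of "-1" f t] integrable_lborel_affine[of "-1" f t] assms by simp_all

context
  fixes u :: "real^'n \<Rightarrow> complex"
  assumes um[measurable]: "u \<in> borel_measurable borel" and u1: "integrable lborel u" and u2: "u \<in> L2_fun"
begin

text \<open>For fixed \<open>x\<close> the reflection z -> x - z turns the inner integral of the
  modulus into |u x| times the L1 norm of \<open>u\<close>, which is integrable in
  \<open>x\<close>.\<close>

lemma integrable_autocorr_kernel:
  assumes k[measurable]: "k \<in> borel_measurable borel" and "\<And>z. norm (k z) \<le> 1"
  shows "integrable (lborel \<Otimes>\<^sub>M lborel) (\<lambda>(x, z). u x * cnj (u (x - z)) * k z)"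
proof -
  have "integrable (lborel \<Otimes>\<^sub>M lborel) (\<lambda>(x, z). u x * cnj (u (x - z)))"
  proof (rule lborel_pair.Fubini_integrable)
    show "(\<lambda>(x, z). u x * cnj (u (x - z))) \<in> borel_measurable (lborel \<Otimes>\<^sub>M lborel)"
      by measurable
    have "(LINT z|lborel. norm (u (x - z))) = (LINT z|lborel. norm (u z))" for x
      using integral_lborel_reflect(1)[of "\<lambda>z. norm (u z)" x] by simp
    then show "integrable lborel (\<lambda>x. LINT z|lborel. norm (case (x, z) of (x, z) \<Rightarrow> u x * cnj (u (x - z))))"
      using u1 by (simp add: norm_mult)
    show "AE x in lborel. integrable lborel (\<lambda>z. case (x, z) of (x, z) \<Rightarrow> u x * cnj (u (x - z)))"
      using integral_lborel_reflect(2)[of u] u1 by (auto intro!: AE_I2)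
  qed
  then show ?thesis
  proof (rule Bochner_Integration.integrable_bound)
    show "(\<lambda>(x, z). u x * cnj (u (x - z)) * k z) \<in> borel_measurable (lborel \<Otimes>\<^sub>M lborel)"
      by measurable
    show "AE x in lborel \<Otimes>\<^sub>M lborel. norm (case x of (x, z) \<Rightarrow> u x * cnj (u (x - z)) * k z)
        \<le> norm (case x of (x, z) \<Rightarrow> u x * cnj (u (x - z)))"
      by (intro AE_I2) (use assms(2) in \<open>auto simp: norm_mult intro!: mult_left_le\<close>)
  qed
qed

lemma integrable_autocorr: "integrable lborel (autocorr u)"
  using lborel_pair.integrable_snd[OF integrable_autocorr_kernel[of "\<lambda>_. 1"]]
  by (simp add: autocorr_def[abs_def])

lemma fourier_autocorr:
  "(LINT z|lborel. exp (- (\<i> * complex_of_real (y \<bullet> z))) * autocorr u z) =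
    complex_of_real ((norm (LINT x|lborel. exp (- (\<i> * complex_of_real (y \<bullet> x))) * u x))\<^sup>2)"
proof -
  let ?e = "\<lambda>z. exp (- (\<i> * complex_of_real (y \<bullet> z)))"
  let ?A = "LINT x|lborel. ?e x * u x"
  have int: "integrable (lborel \<Otimes>\<^sub>M lborel) (\<lambda>(x, z). u x * cnj (u (x - z)) * ?e z)"
    by (rule integrable_autocorr_kernel) auto
  have inner: "(LINT z|lborel. ?e z * cnj (u (x - z))) = ?e x * cnj ?A" for x
  proof -
    \<comment> \<open>Writing z as x - (x - z) shows the integrand to be a function of x - z, the
      shape required for the reflection.\<close>
    have "(LINT z|lborel. ?e z * cnj (u (x - z))) = (LINT z|lborel. ?e (x - (x - z)) * cnj (u (x - z)))"
      by simp
    also have "\<dots> = (LINT z|lborel. ?e (x - z) * cnj (u z))"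
      by (rule integral_lborel_reflect(1)[of "\<lambda>z. ?e (x - z) * cnj (u z)"]) measurable
    also have "\<dots> = (LINT z|lborel. ?e x * cnj (?e z * u z))"
      by (simp add: exp_cnj inner_diff_right algebra_simps exp_diff[symmetric] exp_add[symmetric] mult_exp_exp)
    also have "\<dots> = ?e x * cnj ?A"
      by (simp only: integral_mult_right_zero Bochner_Integration.integral_cnj)
    finally show ?thesis .
  qed
  have "(LINT z|lborel. ?e z * autocorr u z) = (LINT z|lborel. (LINT x|lborel. u x * cnj (u (x - z)) * ?e z))"
    by (simp add: autocorr_def mult.commute)
  also have "\<dots> = (LINT x|lborel. (LINT z|lborel. u x * cnj (u (x - z)) * ?e z))"
    by (rule lborel_pair.Fubini_integral[OF int])
  also have "\<dots> = (LINT x|lborel. u x * (LINT z|lborel. ?e z * cnj (u (x - z))))"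
    by (simp add: mult.assoc mult.commute[of "?e _"])
  also have "\<dots> = (LINT x|lborel. (?e x * u x) * cnj ?A)"
    unfolding inner by (simp add: ac_simps)
  also have "\<dots> = ?A * cnj ?A"
    by (rule integral_mult_left_zero)
  finally show ?thesis
    by (simp only: complex_norm_square)
qed

lemma L2_fun_autocorr_integral:
  "autocorr u z = (LINT x|lebesgue. u x * cnj (u (x - z)))"
  unfolding autocorr_def by (rule integral_completion[symmetric]) measurable

lemma autocorr_bound: "norm (autocorr u z) \<le> (L2_fun_norm u)\<^sup>2"
  using norm_integral_mult_L2_fun[OF u2 L2_fun_cnj[OF L2_fun_translate[OF u2 um]], of z]
  by (simp add: L2_fun_autocorr_integral L2_fun_norm_cnj L2_fun_norm_translate[OF u2 um] power2_eq_square)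

lemma autocorr_0: "autocorr u 0 = complex_of_real ((L2_fun_norm u)\<^sup>2)"
  unfolding L2_fun_autocorr_integral L2_fun_norm_power2
  by (simp add: complex_norm_square[symmetric] del: of_real_power)

lemma autocorr_tendsto: "s \<longlonglongrightarrow> 0 \<Longrightarrow> (\<lambda>k. autocorr u (s k)) \<longlonglongrightarrow> autocorr u 0"
  using L2_tendsto_integral_mult[OF L2_tendsto_const[OF u2] L2_tendsto_cnj[OF L2_tendsto_translate[OF u2 um]], of s]
  by (simp add: L2_fun_autocorr_integral)

lemma fourier_fun_lborel:
  "fourier_fun u y = complex_of_real ((2 * pi) powr (- (real CARD('n) / 2))) *
     (LINT x|lborel. exp (- (\<i> * complex_of_real (y \<bullet> x))) * u x)"
  unfolding fourier_fun_def by (subst integral_completion) auto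

lemma fourier_fun_borel_measurable: "fourier_fun u \<in> borel_measurable borel"
  unfolding fourier_fun_lborel[abs_def] by measurable

text \<open>The Gauss summation of the transform of the autocorrelation of \<open>u\<close> increases to the
  integral of \<open>(norm (fourier_fun u y))\<^sup>2\<close>, up to normalization, and tends to \<open>autocorr u 0\<close>.\<close>

lemma Plancherel_borel: "fourier_fun u \<in> L2_fun" "L2_fun_norm (fourier_fun u) = L2_fun_norm u"
proof -
  let ?A = "\<lambda>y. LINT x|lborel. exp (- (\<i> * complex_of_real (y \<bullet> x))) * u x"
  have Am[measurable]: "?A \<in> borel_measurable borel" by measurable
  define f where "f k y = exp (- (norm ((1 / real (Suc k)) *\<^sub>R y))\<^sup>2 / 2) * (norm (?A y))\<^sup>2" for k y
  have fm[measurable]: "f k \<in> borel_measurable borel" for k unfolding f_def[abs_def] by measurable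
  have A_bd: "norm (?A y) \<le> (LINT x|lborel. norm (u x))" for y
    using integral_norm_bound[of lborel "\<lambda>x. exp (- (\<i> * complex_of_real (y \<bullet> x))) * u x"] by (simp add: norm_mult)
  have fint: "integrable lborel (f k)" for k
  proof (rule Bochner_Integration.integrable_bound)
    have "integrable lborel (\<lambda>y. (2 * pi) powr (real CARD('n) / 2) * gauss (0 + (1 / real (Suc k)) *\<^sub>R y :: real^'n))"
      by (intro integrable_mult_right integrable_lborel_affine[THEN iffD1] integrable_gauss) auto
    then have "integrable lborel (\<lambda>y. exp (- (norm ((1 / real (Suc k)) *\<^sub>R y :: real^'n))\<^sup>2 / 2))"
      by (simp only: exp_norm_eq_gauss add_0)
    then show "integrable lborel (\<lambda>y. exp (- (norm ((1 / real (Suc k)) *\<^sub>R y :: real^'n))\<^sup>2 / 2) * (LINT x|lborel. norm (u x))\<^sup>2)"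
      by (rule integrable_mult_left)
    show "AE y in lborel. norm (f k y) \<le> norm (exp (- (norm ((1 / real (Suc k)) *\<^sub>R y))\<^sup>2 / 2) * (LINT x|lborel. norm (u x))\<^sup>2)"
      unfolding f_def using A_bd by (intro AE_I2) (simp add: abs_mult power_mono del: norm_scaleR)
  qed measurable
  have "(\<lambda>k. LINT y|lborel. complex_of_real (exp (- (norm ((1 / real (Suc k)) *\<^sub>R y))\<^sup>2 / 2)) *
      (LINT z|lborel. exp (- (\<i> * complex_of_real (y \<bullet> z))) * autocorr u z)) \<longlonglongrightarrow>
    complex_of_real ((2 * pi) powr (real CARD('n))) * autocorr u 0"
    by (rule gauss_summation[OF integrable_autocorr autocorr_bound autocorr_tendsto])
  then have "(\<lambda>k. complex_of_real (LINT y|lborel. f k y)) \<longlonglongrightarrow>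
     complex_of_real ((2 * pi) powr (real CARD('n)) * (L2_fun_norm u)\<^sup>2)"
    unfolding fourier_autocorr autocorr_0 f_def by (simp only: of_real_mult[symmetric] integral_complex_of_real)
  then have lim: "(\<lambda>k. LINT y|lborel. f k y) \<longlonglongrightarrow> (2 * pi) powr (real CARD('n)) * (L2_fun_norm u)\<^sup>2"
    by (simp only: tendsto_of_real_iff)
  \<comment> \<open>The Gaussian factors increase to 1, so convergence of the integrals by itself
    makes the limit integrable; dominated convergence would presuppose what is to be shown.\<close>
  have "has_bochner_integral lborel (\<lambda>y. (norm (?A y))\<^sup>2) ((2 * pi) powr (real CARD('n)) * (L2_fun_norm u)\<^sup>2)"
  proof (rule has_bochner_integral_monotone_convergence[OF fint _ _ lim])
    show "AE y in lborel. mono (\<lambda>k. f k y)"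
    proof (intro AE_I2 monoI)
      fix y :: "real^'n" and k l :: nat assume "k \<le> l"
      have "norm ((1 / real (Suc l)) *\<^sub>R y) \<le> norm ((1 / real (Suc k)) *\<^sub>R y)"
        using \<open>k \<le> l\<close> by (simp add: divide_left_mono mult_right_mono frac_le)
      then have "(norm ((1 / real (Suc l)) *\<^sub>R y))\<^sup>2 \<le> (norm ((1 / real (Suc k)) *\<^sub>R y))\<^sup>2"
        by (intro power_mono) auto
      then show "f k y \<le> f l y"
        unfolding f_def by (intro mult_right_mono) auto
    qed
    show "AE y in lborel. (\<lambda>k. f k y) \<longlonglongrightarrow> (norm (?A y))\<^sup>2"
    proof (rule AE_I2)
      fix y :: "real^'n"
      have "(\<lambda>k. f k y) \<longlonglongrightarrow> exp (- (norm (0 *\<^sub>R y))\<^sup>2 / 2) * (norm (?A y))\<^sup>2"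
        unfolding f_def by (intro tendsto_intros LIMSEQ_Suc[OF lim_1_over_n]) simp
      then show "(\<lambda>k. f k y) \<longlonglongrightarrow> (norm (?A y))\<^sup>2" by simp
    qed
  qed measurable
  then have A: "integrable lborel (\<lambda>y. (norm (?A y))\<^sup>2)"
    "(LINT y|lborel. (norm (?A y))\<^sup>2) = (2 * pi) powr (real CARD('n)) * (L2_fun_norm u)\<^sup>2"
    by (auto simp: has_bochner_integral_iff)
  let ?c = "(2 * pi) powr (- (real CARD('n) / 2))"
  have c: "?c\<^sup>2 * (2 * pi) powr (real CARD('n)) = 1"
    by (simp add: power2_eq_square flip: powr_add)
  have eq: "(norm (fourier_fun u y))\<^sup>2 = ?c\<^sup>2 * (norm (?A y))\<^sup>2" for y
    unfolding fourier_fun_lborel by (simp add: norm_mult power_mult_distrib)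
  have m: "fourier_fun u \<in> borel_measurable lebesgue"
    using fourier_fun_borel_measurable by (simp add: measurable_completion)
  have "integrable lborel (\<lambda>y. (norm (fourier_fun u y))\<^sup>2)"
    unfolding eq using A(1) by (rule integrable_mult_right)
  then show "fourier_fun u \<in> L2_fun"
    using m fourier_fun_borel_measurable by (simp add: L2_fun_def integrable_completion)
  have "(L2_fun_norm (fourier_fun u))\<^sup>2 = (LINT y|lborel. (norm (fourier_fun u y))\<^sup>2)"
    unfolding L2_fun_norm_power2 using fourier_fun_borel_measurable by (intro integral_completion) simp
  also have "\<dots> = ?c\<^sup>2 * ((2 * pi) powr (real CARD('n)) * (L2_fun_norm u)\<^sup>2)"
    unfolding eq integral_mult_right_zero A(2) ..
  also have "\<dots> = (L2_fun_norm u)\<^sup>2"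
    by (simp only: c mult.assoc[symmetric] mult_1)
  finally show "L2_fun_norm (fourier_fun u) = L2_fun_norm u"
    using L2_fun_norm_nonneg power2_eq_imp_eq by blast
qed

end

section \<open>The Fourier transform on square-integrable functions\<close>

lemma sigma_finite_lebesgue: "sigma_finite_measure (lebesgue :: 'a::euclidean_space measure)"
proof
  let ?A = "range (\<lambda>n. cball (0 :: 'a) (real n))"
  have "\<Union>?A = UNIV"
    by (auto simp: real_arch_simple)
  then show "\<exists>A::'a set set. countable A \<and> A \<subseteq> sets lebesgue \<and> \<Union>A = space lebesgue \<and> (\<forall>a\<in>A. emeasure lebesgue a \<noteq> \<infinity>)"
  proof (intro exI[of _ ?A] conjI)
    show "\<forall>a\<in>?A. emeasure lebesgue a \<noteq> \<infinity>"
      using fmeasurableD2[OF lmeasurable_cball[of "0 :: 'a"]] unfolding infinity_ennreal_def by blast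
  qed auto
qed

lemma borel_measurable_lebesgueI: "f \<in> borel_measurable borel \<Longrightarrow> f \<in> borel_measurable lebesgue"
  by (simp add: measurable_completion)

lemma integrable_exp_mult:
  fixes u :: "real^'n \<Rightarrow> complex"
  assumes "integrable lebesgue u"
  shows "integrable lebesgue (\<lambda>x. exp (\<i> * complex_of_real (y \<bullet> x)) * u x)"
    and "integrable lebesgue (\<lambda>x. exp (- (\<i> * complex_of_real (y \<bullet> x))) * u x)"
proof -
  have m: "(\<lambda>x. exp (\<i> * complex_of_real (y \<bullet> x))) \<in> borel_measurable lebesgue"
    "(\<lambda>x. exp (- (\<i> * complex_of_real (y \<bullet> x)))) \<in> borel_measurable lebesgue"
    by (intro borel_measurable_lebesgueI, measurable)+
  show "integrable lebesgue (\<lambda>x. exp (\<i> * complex_of_real (y \<bullet> x)) * u x)"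
    by (rule Bochner_Integration.integrable_bound[OF assms])
      (use m assms in \<open>auto simp: norm_mult\<close>)
  show "integrable lebesgue (\<lambda>x. exp (- (\<i> * complex_of_real (y \<bullet> x))) * u x)"
    by (rule Bochner_Integration.integrable_bound[OF assms])
      (use m assms in \<open>auto simp: norm_mult\<close>)
qed

lemma fourier_fun_cong_AE:
  fixes u v :: "real^'n \<Rightarrow> complex"
  assumes "u \<in> borel_measurable lebesgue" "v \<in> borel_measurable lebesgue" "AE x in lebesgue. u x = v x"
  shows "fourier_fun u = fourier_fun v"
proof
  fix y :: "real^'n"
  have "(\<lambda>x. exp (- (\<i> * complex_of_real (y \<bullet> x)))) \<in> borel_measurable lebesgue"
    by (intro borel_measurable_lebesgueI) measurable
  then show "fourier_fun u y = fourier_fun v y"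
    unfolding fourier_fun_def using assms by (intro arg_cong2[where f = "(*)"] refl integral_cong_AE) auto
qed

lemma Plancherel:
  assumes u: "u \<in> L1_fun \<inter> L2_fun"
  shows "fourier_fun u \<in> L2_fun" "L2_fun_norm (fourier_fun u) = L2_fun_norm u"
proof -
  have um: "u \<in> borel_measurable lebesgue" using u by (auto intro: L2_fun_measurable)
  obtain v where v: "v \<in> borel_measurable borel" "AE x in lebesgue. u x = v x"
    using AE_lebesgue_ex_borel[OF um] by blast
  have vm: "v \<in> borel_measurable lebesgue" using v(1) by (rule borel_measurable_lebesgueI)
  have v2: "v \<in> L2_fun" using u v(2) vm by (auto intro: L2_fun_cong_AE)
  have "integrable lebesgue v"
    using u v(2) vm um integrable_cong_AE[of u lebesgue v] by (auto simp: L1_fun_def)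
  then have v1: "integrable lborel v" using v(1) by (simp add: integrable_completion)
  have eq: "fourier_fun u = fourier_fun v" by (rule fourier_fun_cong_AE[OF um vm v(2)])
  show "fourier_fun u \<in> L2_fun"
    unfolding eq by (rule Plancherel_borel(1)[OF v(1) v1 v2])
  show "L2_fun_norm (fourier_fun u) = L2_fun_norm u"
    unfolding eq Plancherel_borel(2)[OF v(1) v1 v2] by (rule L2_fun_norm_cong_AE[OF um vm v(2), symmetric])
qed

text \<open>Conjugation exchanges the two kernels, so each fact about one transform yields the
  corresponding fact about the other.\<close>

lemma inv_fourier_fun_cnj: "inv_fourier_fun u x = cnj (fourier_fun (\<lambda>y. cnj (u y)) x)"
proof -
  have "cnj (LINT y|lebesgue. exp (- (\<i> * complex_of_real (x \<bullet> y))) * cnj (u y)) =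
      (LINT y|lebesgue. exp (\<i> * complex_of_real (x \<bullet> y)) * u y)"
    by (simp only: Bochner_Integration.integral_cnj[symmetric] exp_cnj complex_cnj_mult complex_cnj_minus
        complex_cnj_i complex_cnj_complex_of_real complex_cnj_cnj mult_minus_left minus_minus)
  then show ?thesis
    by (simp add: inv_fourier_fun_def fourier_fun_def)
qed

lemma L12_cnj: "u \<in> L1_fun \<inter> L2_fun \<Longrightarrow> (\<lambda>y. cnj (u y)) \<in> L1_fun \<inter> L2_fun"
  by (auto simp: L1_fun_def L2_fun_cnj)

lemma Plancherel_inv:
  assumes u: "u \<in> L1_fun \<inter> L2_fun"
  shows "inv_fourier_fun u \<in> L2_fun" "L2_fun_norm (inv_fourier_fun u) = L2_fun_norm u"
  using Plancherel[OF L12_cnj[OF u]] unfolding inv_fourier_fun_cnj[abs_def]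
  by (simp_all add: L2_fun_cnj L2_fun_norm_cnj)

lemma inv_fourier_fun_add:
  assumes "u \<in> L1_fun" "v \<in> L1_fun"
  shows "inv_fourier_fun (\<lambda>y. u y + v y) x = inv_fourier_fun u x + inv_fourier_fun v x"
  using assms by (simp add: inv_fourier_fun_def distrib_left L1_fun_def integrable_exp_mult)

lemma inv_fourier_fun_mult: "inv_fourier_fun (\<lambda>y. c * u y) x = c * inv_fourier_fun u x"
  by (simp add: inv_fourier_fun_def mult.left_commute[of _ c])

lemma C0inf_L12: "f \<in> C0inf \<Longrightarrow> f \<in> L1_fun \<inter> L2_fun"
  by (simp add: L1_fun_def C0inf_integrable C0inf_L2_fun)

lemma is_L2_inv_fourier_fun_iff:
  "is_L2_inv_fourier_fun g h \<longleftrightarrow>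
    (\<exists>u. (\<forall>i. u i \<in> L1_fun \<inter> L2_fun) \<and> L2_tendsto u g \<and> L2_tendsto (\<lambda>i. inv_fourier_fun (u i)) h)"
  unfolding is_L2_inv_fourier_fun_def L2_tendsto_def by (auto simp: Plancherel_inv(1))

text \<open>On L1 \<inter> L2 the inverse transform is linear and isometric, so it sends a
  convergent sequence of test functions to a Cauchy sequence, and completeness supplies the
  limit.\<close>

lemma is_L2_inv_fourier_fun_ex:
  assumes g: "g \<in> L2_fun" obtains h where "is_L2_inv_fourier_fun g h"
proof -
  obtain u where u: "\<forall>i. u i \<in> C0inf" "L2_tendsto u g"
    using C0inf_dense_L2_fun[OF g] by (auto simp: C0inf_approx_def)
  have u12: "u i \<in> L1_fun \<inter> L2_fun" for i using u(1) C0inf_L12 by blast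
  have diff: "L2_fun_norm (\<lambda>x. inv_fourier_fun (u i) x - inv_fourier_fun (u j) x) = L2_fun_norm (\<lambda>x. u i x - u j x)" for i j
  proof -
    have j: "(\<lambda>x. - 1 * u j x) \<in> L1_fun" using u12[of j] by (simp add: L1_fun_def)
    have "(\<lambda>x. u i x + - 1 * u j x) \<in> L1_fun \<inter> L2_fun"
      using u12[of i] u12[of j] L2_fun_diff[of "u i" "u j"] by (auto simp: L1_fun_def)
    moreover have "inv_fourier_fun (\<lambda>x. u i x + - 1 * u j x) = (\<lambda>x. inv_fourier_fun (u i) x - inv_fourier_fun (u j) x)"
      using inv_fourier_fun_add[OF _ j, of "u i"] u12[of i] unfolding inv_fourier_fun_mult by (intro ext) simp
    ultimately show ?thesis
      using Plancherel_inv(2)[of "\<lambda>x. u i x + - 1 * u j x"] by simp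
  qed
  obtain h where "L2_tendsto (\<lambda>i. inv_fourier_fun (u i)) h"
  proof (rule L2_fun_complete)
    show "inv_fourier_fun (u i) \<in> L2_fun" for i by (rule Plancherel_inv(1)[OF u12])
    fix e :: real assume "e > 0"
    then have "\<forall>\<^sub>F i in sequentially. L2_fun_norm (\<lambda>x. u i x - g x) < e / 2"
      using u(2) by (intro order_tendstoD) (auto simp: L2_tendsto_def)
    then obtain N where N: "\<And>i. i \<ge> N \<Longrightarrow> L2_fun_norm (\<lambda>x. u i x - g x) < e / 2"
      by (auto simp: eventually_sequentially)
    show "\<exists>N. \<forall>i\<ge>N. \<forall>j\<ge>N. L2_fun_norm (\<lambda>x. inv_fourier_fun (u i) x - inv_fourier_fun (u j) x) \<le> e"
    proof (intro exI allI impI)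
      fix i j assume "N \<le> i" "N \<le> j"
      have "L2_fun_norm (\<lambda>x. u i x - u j x) \<le> L2_fun_norm (\<lambda>x. u i x - g x) + L2_fun_norm (\<lambda>x. g x - u j x)"
        using u12 g by (intro L2_fun_norm_diff_triangle) auto
      then show "L2_fun_norm (\<lambda>x. inv_fourier_fun (u i) x - inv_fourier_fun (u j) x) \<le> e"
        using N[OF \<open>N \<le> i\<close>] N[OF \<open>N \<le> j\<close>] unfolding diff L2_fun_norm_minus_commute[of g] by simp
    qed
  qed auto
  with u12 u(2) that show ?thesis by (auto simp: is_L2_inv_fourier_fun_iff)
qed

lemma is_L2_inv_fourier_fun_norm:
  assumes "is_L2_inv_fourier_fun g h" shows "L2_fun_norm h = L2_fun_norm g"
proof -
  obtain u where u: "\<forall>i. u i \<in> L1_fun \<inter> L2_fun" "L2_tendsto u g" "L2_tendsto (\<lambda>i. inv_fourier_fun (u i)) h"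
    using assms by (auto simp: is_L2_inv_fourier_fun_iff)
  have "(\<lambda>i. L2_fun_norm (inv_fourier_fun (u i))) = (\<lambda>i. L2_fun_norm (u i))"
    using Plancherel_inv(2) u(1) by blast
  then show ?thesis
    using L2_tendsto_norm[OF u(2)] L2_tendsto_norm[OF u(3)] LIMSEQ_unique by auto
qed

lemma is_L2_inv_fourier_fun_add:
  assumes "is_L2_inv_fourier_fun g h" "is_L2_inv_fourier_fun g' h'"
  shows "is_L2_inv_fourier_fun (\<lambda>x. g x + g' x) (\<lambda>x. h x + h' x)"
proof -
  obtain u where u: "\<forall>i. u i \<in> L1_fun \<inter> L2_fun" "L2_tendsto u g" "L2_tendsto (\<lambda>i. inv_fourier_fun (u i)) h"
    using assms(1) by (auto simp: is_L2_inv_fourier_fun_iff)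
  obtain v where v: "\<forall>i. v i \<in> L1_fun \<inter> L2_fun" "L2_tendsto v g'" "L2_tendsto (\<lambda>i. inv_fourier_fun (v i)) h'"
    using assms(2) by (auto simp: is_L2_inv_fourier_fun_iff)
  have "inv_fourier_fun (\<lambda>x. u i x + v i x) = (\<lambda>x. inv_fourier_fun (u i) x + inv_fourier_fun (v i) x)" for i
    using u(1) v(1) inv_fourier_fun_add by blast
  moreover have "(\<lambda>x. u i x + v i x) \<in> L1_fun \<inter> L2_fun" for i
    using u(1) v(1) by (auto simp: L1_fun_def intro: L2_fun_add)
  ultimately show ?thesis
    unfolding is_L2_inv_fourier_fun_iff using L2_tendsto_add[OF u(2) v(2)] L2_tendsto_add[OF u(3) v(3)]
    by (intro exI[of _ "\<lambda>i x. u i x + v i x"]) simp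
qed

lemma is_L2_inv_fourier_fun_mult:
  assumes "is_L2_inv_fourier_fun g h"
  shows "is_L2_inv_fourier_fun (\<lambda>x. c * g x) (\<lambda>x. c * h x)"
proof -
  obtain u where u: "\<forall>i. u i \<in> L1_fun \<inter> L2_fun" "L2_tendsto u g" "L2_tendsto (\<lambda>i. inv_fourier_fun (u i)) h"
    using assms by (auto simp: is_L2_inv_fourier_fun_iff)
  have "(\<lambda>x. c * u i x) \<in> L1_fun \<inter> L2_fun" for i
    using u(1) by (auto simp: L1_fun_def intro: L2_fun_mult)
  then show ?thesis
    unfolding is_L2_inv_fourier_fun_iff using L2_tendsto_mult[OF u(2)] L2_tendsto_mult[OF u(3)]
    by (intro exI[of _ "\<lambda>i x. c * u i x"]) (simp add: inv_fourier_fun_mult[abs_def])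
qed

lemma is_L2_inv_fourier_fun_L2: "is_L2_inv_fourier_fun g h \<Longrightarrow> g \<in> L2_fun \<and> h \<in> L2_fun"
  by (simp add: is_L2_inv_fourier_fun_def)

text \<open>By linearity the difference of the two limits is a transform of g - g', which has norm
  0, and the transform is isometric. One statement thus covers uniqueness of the limit and
  independence of the representative of \<open>g\<close>.\<close>

lemma is_L2_inv_fourier_fun_unique:
  assumes 1: "is_L2_inv_fourier_fun g h" and 2: "is_L2_inv_fourier_fun g' h'" and AE: "AE x in lebesgue. g x = g' x"
  shows "AE x in lebesgue. h x = h' x"
proof -
  have "is_L2_inv_fourier_fun (\<lambda>x. g x - g' x) (\<lambda>x. h x - h' x)"
    using is_L2_inv_fourier_fun_add[OF 1 is_L2_inv_fourier_fun_mult[OF 2, of "-1"]] by simp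
  from is_L2_inv_fourier_fun_norm[OF this] have "L2_fun_norm (\<lambda>x. h x - h' x) = 0"
    using L2_fun_norm_diff_0_if_AE[OF _ _ AE] is_L2_inv_fourier_fun_L2[OF 1] is_L2_inv_fourier_fun_L2[OF 2]
    by (simp add: L2_fun_measurable)
  then show ?thesis
    using is_L2_inv_fourier_fun_L2[OF 1] is_L2_inv_fourier_fun_L2[OF 2] by (intro L2_fun_norm_diff_eq_0_AE) auto
qed

lemma L2_inv_fourier_fun_is: "g \<in> L2_fun \<Longrightarrow> is_L2_inv_fourier_fun g (L2_inv_fourier_fun g)"
  unfolding L2_inv_fourier_fun_def by (rule is_L2_inv_fourier_fun_ex) (auto intro: someI[of "is_L2_inv_fourier_fun g"])

lemma L2_inv_fourier_fun_L2: "g \<in> L2_fun \<Longrightarrow> L2_inv_fourier_fun g \<in> L2_fun"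
  using L2_inv_fourier_fun_is is_L2_inv_fourier_fun_L2 by blast

lemma L2_inv_fourier_fun_norm: "g \<in> L2_fun \<Longrightarrow> L2_fun_norm (L2_inv_fourier_fun g) = L2_fun_norm g"
  by (rule is_L2_inv_fourier_fun_norm[OF L2_inv_fourier_fun_is])

lemma L2_inv_fourier_fun_add:
  assumes "f \<in> L2_fun" "g \<in> L2_fun"
  shows "AE x in lebesgue. L2_inv_fourier_fun (\<lambda>y. f y + g y) x = L2_inv_fourier_fun f x + L2_inv_fourier_fun g x"
  by (rule is_L2_inv_fourier_fun_unique[OF L2_inv_fourier_fun_is[OF L2_fun_add[OF assms]]
        is_L2_inv_fourier_fun_add[OF L2_inv_fourier_fun_is[OF assms(1)] L2_inv_fourier_fun_is[OF assms(2)]]]) simp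

lemma L2_inv_fourier_fun_mult:
  assumes "f \<in> L2_fun"
  shows "AE x in lebesgue. L2_inv_fourier_fun (\<lambda>y. c * f y) x = c * L2_inv_fourier_fun f x"
  by (rule is_L2_inv_fourier_fun_unique[OF L2_inv_fourier_fun_is[OF L2_fun_mult[OF assms]]
        is_L2_inv_fourier_fun_mult[OF L2_inv_fourier_fun_is[OF assms]]]) simp

lemma L2_inv_fourier_fun_cong_AE:
  assumes "f \<in> L2_fun" "g \<in> L2_fun" "AE y in lebesgue. f y = g y"
  shows "AE x in lebesgue. L2_inv_fourier_fun f x = L2_inv_fourier_fun g x"
  by (rule is_L2_inv_fourier_fun_unique[OF L2_inv_fourier_fun_is[OF assms(1)] L2_inv_fourier_fun_is[OF assms(2)] assms(3)])

lemma L2_inv_fourier_fun_L12: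
  assumes "g \<in> L1_fun \<inter> L2_fun"
  shows "AE x in lebesgue. L2_inv_fourier_fun g x = inv_fourier_fun g x"
proof -
  have "is_L2_inv_fourier_fun g (inv_fourier_fun g)"
    unfolding is_L2_inv_fourier_fun_iff using assms
    by (intro exI[of _ "\<lambda>_. g"]) (simp add: L2_tendsto_const Plancherel_inv(1))
  then show ?thesis
    using assms by (intro is_L2_inv_fourier_fun_unique[OF L2_inv_fourier_fun_is]) auto
qed

text \<open>Defined from the inverse transform by conjugation instead of by a limit of its own: all
  properties are inherited, and the transform of a conjugate is literally the conjugate of the
  inverse transform, which is used when the composition of both is computed.\<close>

definition L2_fourier_fun :: "(real^'n \<Rightarrow> complex) \<Rightarrow> real^'n \<Rightarrow> complex" where
  "L2_fourier_fun f x = cnj (L2_inv_fourier_fun (\<lambda>y. cnj (f y)) x)"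

lemma L2_fourier_fun_L2: "f \<in> L2_fun \<Longrightarrow> L2_fourier_fun f \<in> L2_fun"
  unfolding L2_fourier_fun_def[abs_def] by (intro L2_fun_cnj L2_inv_fourier_fun_L2)

lemma L2_fourier_fun_norm: "f \<in> L2_fun \<Longrightarrow> L2_fun_norm (L2_fourier_fun f) = L2_fun_norm f"
  unfolding L2_fourier_fun_def[abs_def] by (simp add: L2_fun_cnj L2_fun_norm_cnj L2_inv_fourier_fun_norm)

lemma L2_fourier_fun_add:
  assumes "f \<in> L2_fun" "g \<in> L2_fun"
  shows "AE x in lebesgue. L2_fourier_fun (\<lambda>y. f y + g y) x = L2_fourier_fun f x + L2_fourier_fun g x"
  using L2_inv_fourier_fun_add[OF L2_fun_cnj[OF assms(1)] L2_fun_cnj[OF assms(2)]]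
  by eventually_elim (simp add: L2_fourier_fun_def)

lemma L2_fourier_fun_mult:
  assumes "f \<in> L2_fun"
  shows "AE x in lebesgue. L2_fourier_fun (\<lambda>y. c * f y) x = c * L2_fourier_fun f x"
  using L2_inv_fourier_fun_mult[OF L2_fun_cnj[OF assms], of "cnj c"]
  by eventually_elim (simp add: L2_fourier_fun_def)

lemma L2_fourier_fun_L12:
  assumes "f \<in> L1_fun \<inter> L2_fun"
  shows "AE x in lebesgue. L2_fourier_fun f x = fourier_fun f x"
  using L2_inv_fourier_fun_L12[OF L12_cnj[OF assms]]
  by eventually_elim (simp add: L2_fourier_fun_def inv_fourier_fun_cnj)

lemma L2_tendsto_L2_fourier_fun:
  assumes "L2_tendsto u g" shows "L2_tendsto (\<lambda>i. L2_fourier_fun (u i)) (L2_fourier_fun g)"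
proof -
  have L: "u i \<in> L2_fun" "g \<in> L2_fun" for i using assms by (auto simp: L2_tendsto_def)
  have "L2_fun_norm (\<lambda>x. L2_fourier_fun (u i) x - L2_fourier_fun g x) = L2_fun_norm (\<lambda>x. u i x - g x)" for i
  proof -
    have "AE x in lebesgue. L2_fourier_fun (\<lambda>y. u i y + - 1 * g y) x = L2_fourier_fun (u i) x - L2_fourier_fun g x"
      using L2_fourier_fun_add[OF L(1)[of i] L2_fun_mult[OF L(2), of "-1"]] L2_fourier_fun_mult[OF L(2), of "-1"]
      by eventually_elim simp
    moreover have "(\<lambda>y. u i y + - 1 * g y) = (\<lambda>y. u i y - g y)" by simp
    ultimately have "AE x in lebesgue. L2_fourier_fun (\<lambda>y. u i y - g y) x = L2_fourier_fun (u i) x - L2_fourier_fun g x"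
      by simp
    then have "L2_fun_norm (L2_fourier_fun (\<lambda>y. u i y - g y)) = L2_fun_norm (\<lambda>x. L2_fourier_fun (u i) x - L2_fourier_fun g x)"
      by (intro L2_fun_norm_cong_AE L2_fun_measurable L2_fun_diff L2_fourier_fun_L2 L)
    then show ?thesis using L2_fourier_fun_norm[OF L2_fun_diff[OF L(1)[of i] L(2)]] by simp
  qed
  then show ?thesis
    using assms L by (simp add: L2_tendsto_def L2_fourier_fun_L2)
qed

text \<open>The kernel is symmetric in its two variables, so Fubini moves the transform from one
  factor to the other.\<close>

lemma integral_fourier_fun_swap:
  fixes u v :: "real^'n \<Rightarrow> complex"
  assumes u: "u \<in> L1_fun" and v: "v \<in> L1_fun"
  shows "(LINT y|lebesgue. fourier_fun u y * v y) = (LINT y|lebesgue. u y * fourier_fun v y)"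
proof -
  let ?c = "complex_of_real ((2 * pi) powr (- (real CARD('n) / 2)))"
  let ?k = "\<lambda>(x::real^'n) y. exp (- (\<i> * complex_of_real (x \<bullet> y)))"
  interpret sigma_finite_measure "lebesgue :: (real^'n) measure" by (rule sigma_finite_lebesgue)
  interpret pair_sigma_finite "lebesgue :: (real^'n) measure" "lebesgue :: (real^'n) measure" ..
  have id: "(\<lambda>x. x) \<in> lebesgue \<rightarrow>\<^sub>M (borel :: (real^'n) measure)"
    by (rule borel_measurable_lebesgueI) simp
  \<comment> \<open>The product carries the Lebesgue sigma-algebras while the kernel is Borel; the
    projections are therefore read as maps into the Borel space.\<close>
  have [measurable]: "fst \<in> lebesgue \<Otimes>\<^sub>M lebesgue \<rightarrow>\<^sub>M (borel :: (real^'n) measure)"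
      "snd \<in> lebesgue \<Otimes>\<^sub>M lebesgue \<rightarrow>\<^sub>M (borel :: (real^'n) measure)"
    by (rule measurable_compose[OF measurable_fst id]) (rule measurable_compose[OF measurable_snd id])
  have km: "(\<lambda>(x, y). ?k x y) \<in> borel_measurable (lebesgue \<Otimes>\<^sub>M lebesgue)"
    unfolding case_prod_beta by measurable
  have int: "integrable (lebesgue \<Otimes>\<^sub>M lebesgue) (\<lambda>(x, y). u x * v y * ?k x y)"
    by (rule integrable_pair_mult_bounded[OF sigma_finite_lebesgue sigma_finite_lebesgue _ _ km])
      (use u v in \<open>auto simp: L1_fun_def\<close>)
  have "(LINT y|lebesgue. fourier_fun u y * v y) = (LINT y|lebesgue. ?c * (LINT x|lebesgue. u x * v y * ?k x y))"
    unfolding fourier_fun_def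
    by (simp only: integral_mult_right_zero[symmetric] integral_mult_left_zero[symmetric] mult.assoc mult.commute mult.left_commute inner_commute)
  also have "\<dots> = ?c * (LINT y|lebesgue. (LINT x|lebesgue. u x * v y * ?k x y))"
    by (rule integral_mult_right_zero)
  also have "\<dots> = ?c * (LINT x|lebesgue. (LINT y|lebesgue. u x * v y * ?k x y))"
    by (simp only: Fubini_integral[OF int])
  also have "\<dots> = (LINT x|lebesgue. ?c * (LINT y|lebesgue. u x * v y * ?k x y))"
    by (rule integral_mult_right_zero[symmetric])
  also have "\<dots> = (LINT y|lebesgue. u y * fourier_fun v y)"
    unfolding fourier_fun_def
    by (simp only: integral_mult_right_zero[symmetric] integral_mult_left_zero[symmetric] mult.assoc mult.commute mult.left_commute)
  finally show ?thesis .
qed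

text \<open>Test functions satisfy the identity by Fubini, and both sides are continuous in L2
  because the transform is isometric and the pairing is continuous.\<close>

lemma integral_L2_fourier_fun_swap:
  assumes f: "f \<in> L2_fun" and g: "g \<in> L2_fun"
  shows "(LINT y|lebesgue. L2_fourier_fun f y * g y) = (LINT y|lebesgue. f y * L2_fourier_fun g y)"
proof -
  obtain u where u: "\<forall>i. u i \<in> C0inf" "L2_tendsto u f"
    using C0inf_dense_L2_fun[OF f] by (auto simp: C0inf_approx_def)
  obtain v where v: "\<forall>i. v i \<in> C0inf" "L2_tendsto v g"
    using C0inf_dense_L2_fun[OF g] by (auto simp: C0inf_approx_def)
  have u12: "u i \<in> L1_fun \<inter> L2_fun" and v12: "v i \<in> L1_fun \<inter> L2_fun" for i
    using u(1) v(1) C0inf_L12 by blast+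
  have "(LINT y|lebesgue. L2_fourier_fun (u i) y * v i y) = (LINT y|lebesgue. u i y * L2_fourier_fun (v i) y)" for i
  proof -
    have m: "L2_fourier_fun (u i) \<in> borel_measurable lebesgue" "fourier_fun (u i) \<in> borel_measurable lebesgue"
       "L2_fourier_fun (v i) \<in> borel_measurable lebesgue" "fourier_fun (v i) \<in> borel_measurable lebesgue"
       "u i \<in> borel_measurable lebesgue" "v i \<in> borel_measurable lebesgue"
      using u12[of i] v12[of i] by (auto intro: L2_fun_measurable L2_fourier_fun_L2 Plancherel)
    have "(LINT y|lebesgue. L2_fourier_fun (u i) y * v i y) = (LINT y|lebesgue. fourier_fun (u i) y * v i y)"
      by (intro integral_cong_AE borel_measurable_times m)
        (use L2_fourier_fun_L12[OF u12[of i]] in \<open>eventually_elim, simp\<close>)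
    also have "\<dots> = (LINT y|lebesgue. u i y * fourier_fun (v i) y)"
      using integral_fourier_fun_swap u12[of i] v12[of i] by blast
    also have "\<dots> = (LINT y|lebesgue. u i y * L2_fourier_fun (v i) y)"
      by (intro integral_cong_AE borel_measurable_times m)
        (use L2_fourier_fun_L12[OF v12[of i]] in \<open>eventually_elim, simp\<close>)
    finally show ?thesis .
  qed
  then show ?thesis
    using L2_tendsto_integral_mult[OF L2_tendsto_L2_fourier_fun[OF u(2)] v(2)]
      L2_tendsto_integral_mult[OF u(2) L2_tendsto_L2_fourier_fun[OF v(2)]]
    by (simp add: LIMSEQ_unique)
qed

lemma integral_mult_cnj_self:
  assumes "f \<in> L2_fun"
  shows "(LINT x|lebesgue. f x * cnj (f x)) = complex_of_real ((L2_fun_norm f)\<^sup>2)"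
  unfolding L2_fun_norm_power2 complex_norm_square[symmetric] by (rule integral_complex_of_real)

lemma L2_fun_norm_diff_power2:
  assumes f: "f \<in> L2_fun" and g: "g \<in> L2_fun"
  shows "(L2_fun_norm (\<lambda>x. f x - g x))\<^sup>2 =
    (L2_fun_norm f)\<^sup>2 + (L2_fun_norm g)\<^sup>2 - 2 * Re (LINT x|lebesgue. f x * cnj (g x))"
proof -
  have eq: "(norm (f x - g x))\<^sup>2 = (norm (f x))\<^sup>2 + (norm (g x))\<^sup>2 - 2 * Re (f x * cnj (g x))" for x
    by (simp add: cmod_power2) (simp add: power2_eq_square algebra_simps)
  have int: "integrable lebesgue (\<lambda>x. f x * cnj (g x))"
    by (intro integrable_mult_L2_fun f L2_fun_cnj g)
  show ?thesis
    unfolding L2_fun_norm_power2 eq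
    using int f g by (simp add: L2_fun_integrable integral_Re[OF int] del: times_complex.simps)
qed

text \<open>\<open>U = L2_inv_fourier_fun\<close> is an isometry and its adjoint \<open>W = L2_fourier_fun\<close> is an isometry
  too, which makes the expansion of the squared norm of \<open>W U g - g\<close> vanish.\<close>

lemma L2_fourier_fun_L2_inv_fourier_fun:
  assumes g: "g \<in> L2_fun"
  shows "AE x in lebesgue. L2_fourier_fun (L2_inv_fourier_fun g) x = g x"
proof -
  let ?U = "L2_inv_fourier_fun g"
  let ?W = "L2_fourier_fun ?U"
  have U: "?U \<in> L2_fun" using g by (rule L2_inv_fourier_fun_L2)
  have W: "?W \<in> L2_fun" using U by (rule L2_fourier_fun_L2)
  have "(LINT x|lebesgue. ?W x * cnj (g x)) = (LINT x|lebesgue. ?U x * L2_fourier_fun (\<lambda>y. cnj (g y)) x)"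
    by (rule integral_L2_fourier_fun_swap[OF U L2_fun_cnj[OF g]])
  also have "\<dots> = (LINT x|lebesgue. ?U x * cnj (?U x))"
    by (simp add: L2_fourier_fun_def)
  also have "\<dots> = complex_of_real ((L2_fun_norm g)\<^sup>2)"
    using integral_mult_cnj_self[OF U] by (simp add: L2_inv_fourier_fun_norm[OF g])
  finally have "Re (LINT x|lebesgue. ?W x * cnj (g x)) = (L2_fun_norm g)\<^sup>2" by simp
  then have "(L2_fun_norm (\<lambda>x. ?W x - g x))\<^sup>2 = 0"
    unfolding L2_fun_norm_diff_power2[OF W g]
    by (simp add: L2_fourier_fun_norm[OF U] L2_inv_fourier_fun_norm[OF g])
  then show ?thesis
    by (intro L2_fun_norm_diff_eq_0_AE[OF W g]) simp
qed

text \<open>Test functions approximating the inverse transform of \<open>g\<close> have transforms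
  approximating \<open>g\<close> itself; on test functions the extended transform agrees almost
  everywhere with the integral.\<close>

lemma fourier_fun_C0inf_dense:
  assumes g: "g \<in> L2_fun"
  obtains \<phi> where "\<And>i. \<phi> i \<in> C0inf" "L2_tendsto (\<lambda>i. fourier_fun (\<phi> i)) g"
proof -
  obtain \<phi> where \<phi>: "\<forall>i. \<phi> i \<in> C0inf" "L2_tendsto \<phi> (L2_inv_fourier_fun g)"
    using C0inf_dense_L2_fun[OF L2_inv_fourier_fun_L2[OF g]] by (auto simp: C0inf_approx_def)
  have \<phi>12: "\<phi> i \<in> L1_fun \<inter> L2_fun" for i using \<phi>(1) C0inf_L12 by blast
  have "L2_tendsto (\<lambda>i. fourier_fun (\<phi> i)) g"
    by (rule L2_tendsto_cong_AE[OF L2_tendsto_L2_fourier_fun[OF \<phi>(2)] L2_fourier_fun_L12[OF \<phi>12]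
          L2_fourier_fun_L2_inv_fourier_fun[OF g]])
      (use g \<phi>12 in \<open>auto intro: L2_fun_measurable Plancherel\<close>)
  with \<phi>(1) show ?thesis by (intro that) auto
qed

text \<open>Transforms of test functions approximate the indicator of the set where \<open>w > K\<close>, so
  Fatou's lemma bounds the integral of \<open>w\<close> over bounded parts of this set.\<close>

lemma AE_le_if_fourier_weighted_le:
  fixes w :: "real^'n \<Rightarrow> real"
  assumes w: "w \<in> borel_measurable lebesgue" "\<And>y. w y \<ge> 0" and K: "K \<ge> 0"
    and bd: "\<And>\<phi>. \<phi> \<in> C0inf \<Longrightarrow>
      (\<integral>\<^sup>+y. ennreal ((norm (fourier_fun \<phi> y))\<^sup>2 * w y) \<partial>lebesgue) \<le> ennreal (K * (L2_fun_norm \<phi>)\<^sup>2)"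
  shows "AE y in lebesgue. w y \<le> K"
proof -
  note [measurable] = w(1)
  have set_bd: "(\<integral>\<^sup>+y. ennreal (w y * indicator A y) \<partial>lebesgue) \<le> ennreal (K * measure lebesgue A)"
    if A: "A \<in> lmeasurable" for A
  proof -
    obtain \<phi> where \<phi>: "\<And>i. \<phi> i \<in> C0inf" "L2_tendsto (\<lambda>i. fourier_fun (\<phi> i)) (indicator A)"
      using fourier_fun_C0inf_dense[OF L2_fun_indicator(1)[OF A]] by blast
    obtain r where r: "\<And>k. k \<le> r k" "AE x in lebesgue. (\<lambda>k. fourier_fun (\<phi> (r k)) x) \<longlonglongrightarrow> indicator A x"
      using L2_tendsto_AE_subseq[OF \<phi>(2)] by blast
    have m: "fourier_fun (\<phi> i) \<in> borel_measurable lebesgue" for i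
      using Plancherel(1)[OF C0inf_L12[OF \<phi>(1)]] by (rule L2_fun_measurable)
    have r_inf: "filterlim r at_top sequentially"
      by (rule filterlim_at_top_mono[OF filterlim_ident]) (simp add: r(1))
    have "(\<integral>\<^sup>+y. ennreal (w y * indicator A y) \<partial>lebesgue) =
        (\<integral>\<^sup>+y. liminf (\<lambda>k. ennreal ((norm (fourier_fun (\<phi> (r k)) y))\<^sup>2 * w y)) \<partial>lebesgue)"
    proof (rule nn_integral_cong_AE, use r(2) in eventually_elim)
      case (elim y)
      have "(\<lambda>k. ennreal ((norm (fourier_fun (\<phi> (r k)) y))\<^sup>2 * w y)) \<longlonglongrightarrow> ennreal ((norm (indicator A y :: complex))\<^sup>2 * w y)"
        by (intro tendsto_ennrealI tendsto_intros elim)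
      moreover have "(norm (indicator A y :: complex))\<^sup>2 * w y = w y * indicator A y"
        by (simp add: indicator_def)
      ultimately show ?case
        using lim_imp_Liminf[OF trivial_limit_sequentially] by metis
    qed
    also have "\<dots> \<le> liminf (\<lambda>k. \<integral>\<^sup>+y. ennreal ((norm (fourier_fun (\<phi> (r k)) y))\<^sup>2 * w y) \<partial>lebesgue)"
      by (rule nn_integral_liminf) (use m in measurable)
    also have "\<dots> \<le> liminf (\<lambda>k. ennreal (K * (L2_fun_norm (\<phi> (r k)))\<^sup>2))"
      by (intro Liminf_mono always_eventually allI bd \<phi>(1))
    also have "\<dots> = ennreal (K * measure lebesgue A)"
    proof (rule lim_imp_Liminf[OF trivial_limit_sequentially])
      \<comment> \<open>Plancherel again: the test functions have the norms of their transforms, and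
        those converge to the norm of the indicator.\<close>
      have "(\<lambda>i. L2_fun_norm (\<phi> i)) \<longlonglongrightarrow> sqrt (measure lebesgue A)"
        using L2_tendsto_norm[OF \<phi>(2)] Plancherel(2)[OF C0inf_L12[OF \<phi>(1)]] L2_fun_indicator(2)[OF A] by simp
      then have "(\<lambda>k. L2_fun_norm (\<phi> (r k))) \<longlonglongrightarrow> sqrt (measure lebesgue A)"
        by (rule filterlim_compose[OF _ r_inf])
      then have "(\<lambda>k. ennreal (K * (L2_fun_norm (\<phi> (r k)))\<^sup>2)) \<longlonglongrightarrow> ennreal (K * (sqrt (measure lebesgue A))\<^sup>2)"
        by (intro tendsto_ennrealI tendsto_intros)
      then show "(\<lambda>k. ennreal (K * (L2_fun_norm (\<phi> (r k)))\<^sup>2)) \<longlonglongrightarrow> ennreal (K * measure lebesgue A)"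
        by simp
    qed
    finally show ?thesis .
  qed
  have "AE y in lebesgue. y \<notin> {y. w y > K} \<inter> ball 0 (real j)" for j
  proof -
    define B where "B = {y. w y > K} \<inter> ball 0 (real j)"
    have "{y. w y > K} \<in> sets lebesgue"
      using measurable_sets[OF w(1), of "{K<..}"] by (simp add: vimage_def)
    then have B: "B \<in> lmeasurable"
      unfolding B_def by (intro fmeasurableI2[OF lmeasurable_ball[of 0 "real j"]]) auto
    then have [measurable]: "B \<in> sets lebesgue" by (rule fmeasurableD)
    \<comment> \<open>The term K times the measure of \<open>B\<close> is added to the excess over
      \<open>K\<close> and cancelled at the end. Cancellation is legitimate because \<open>B\<close>
      lies in a ball and so has finite measure.\<close>
    have "(\<integral>\<^sup>+y. ennreal ((w y - K) * indicator B y) \<partial>lebesgue) + ennreal (K * measure lebesgue B) =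
        (\<integral>\<^sup>+y. ennreal ((w y - K) * indicator B y) \<partial>lebesgue) + (\<integral>\<^sup>+y. ennreal K * indicator B y \<partial>lebesgue)"
      using B K by (simp add: nn_integral_cmult_indicator emeasure_eq_measure2 ennreal_mult)
    also have "\<dots> = (\<integral>\<^sup>+y. ennreal ((w y - K) * indicator B y) + ennreal K * indicator B y \<partial>lebesgue)"
      by (rule nn_integral_add[symmetric]) measurable
    also have "\<dots> = (\<integral>\<^sup>+y. ennreal (w y * indicator B y) \<partial>lebesgue)"
      using K by (intro nn_integral_cong) (auto simp: indicator_def B_def ennreal_plus[symmetric] simp del: ennreal_plus)
    also have "\<dots> \<le> ennreal (K * measure lebesgue B)"
      by (rule set_bd[OF B])
    finally have "(\<integral>\<^sup>+y. ennreal ((w y - K) * indicator B y) \<partial>lebesgue) = 0"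
      using ennreal_add_left_cancel_le[of "ennreal (K * measure lebesgue B)" _ 0] by (simp add: add.commute)
    then have "AE y in lebesgue. ennreal ((w y - K) * indicator B y) = 0"
      by (subst (asm) nn_integral_0_iff_AE) measurable
    then show ?thesis
      unfolding B_def[symmetric] by eventually_elim (auto simp: indicator_def B_def ennreal_eq_0_iff split: if_splits)
  qed
  then have "AE y in lebesgue. \<forall>j. y \<notin> {y. w y > K} \<inter> ball 0 (real j)"
    by (simp only: AE_all_countable) simp
  then show ?thesis
  proof eventually_elim
    case (elim y)
    obtain j :: nat where "norm y < real j" using reals_Archimedean2 by blast
    with elim[rule_format, of j] show ?case by auto
  qed
qed

section \<open>Matrices and matrix-valued functions\<close>

lemma norm_vec_power2: "(norm (x :: complex^'m))\<^sup>2 = (\<Sum>i\<in>UNIV. (norm (x $ i))\<^sup>2)"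
  by (simp add: norm_vec_def L2_set_def sum_nonneg)

lemma norm_vec_le_sum: "norm (x :: complex^'m) \<le> (\<Sum>i\<in>UNIV. norm (x $ i))"
  by (simp add: norm_vec_def L2_set_le_sum)

lemma mat_opnorm_bound: "norm (A *v x) \<le> mat_opnorm A * norm x"
  unfolding mat_opnorm_def by (rule onorm[OF matrix_vector_mul_bounded_linear])

lemma mat_opnorm_nonneg: "mat_opnorm A \<ge> 0"
  unfolding mat_opnorm_def by (rule onorm_pos_le[OF matrix_vector_mul_bounded_linear])

lemma mat_opnorm_le: "(\<And>x. norm (A *v x) \<le> b * norm x) \<Longrightarrow> mat_opnorm A \<le> b"
  unfolding mat_opnorm_def by (rule onorm_le)

lemma mat_opnorm_triangle: "mat_opnorm (A + B) \<le> mat_opnorm A + mat_opnorm B"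
  using onorm_triangle[OF matrix_vector_mul_bounded_linear matrix_vector_mul_bounded_linear, of A B]
  by (simp add: mat_opnorm_def matrix_vector_mult_add_rdistrib)

lemma norm_entry_le_mat_opnorm: "norm (A $ j $ k) \<le> mat_opnorm A"
proof -
  have "norm ((A *v axis k 1) $ j) \<le> mat_opnorm A * norm (axis k (1::complex))"
    by (rule order_trans[OF Finite_Cartesian_Product.norm_nth_le mat_opnorm_bound])
  moreover have "(A *v axis k 1) $ j = A $ j $ k"
    by (simp add: matrix_vector_mult_def axis_def if_distrib cong: if_cong)
  ultimately show ?thesis by (simp add: norm_axis_1)
qed

lemma mat_opnorm_le_sum: "mat_opnorm A \<le> (\<Sum>j\<in>UNIV. \<Sum>k\<in>UNIV. norm (A $ j $ k))"
proof (rule mat_opnorm_le)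
  fix x
  have "norm (A *v x) \<le> (\<Sum>j\<in>UNIV. norm (\<Sum>k\<in>UNIV. A $ j $ k * x $ k))"
    using norm_vec_le_sum[of "A *v x"] by (simp add: matrix_vector_mult_def)
  also have "\<dots> \<le> (\<Sum>j\<in>UNIV. \<Sum>k\<in>UNIV. norm (A $ j $ k) * norm x)"
    by (intro sum_mono order_trans[OF norm_sum]) (simp add: norm_mult mult_left_mono Finite_Cartesian_Product.norm_nth_le)
  finally show "norm (A *v x) \<le> (\<Sum>j\<in>UNIV. \<Sum>k\<in>UNIV. norm (A $ j $ k)) * norm x"
    by (simp add: sum_distrib_right)
qed

lemma norm_sum_mult_le_norm_vec:
  fixes x y :: "complex^'m"
  shows "norm (\<Sum>i\<in>UNIV. x $ i * y $ i) \<le> norm x * norm y"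
proof -
  have "norm (\<Sum>i\<in>UNIV. x $ i * y $ i) \<le> (\<Sum>i\<in>UNIV. \<bar>norm (x $ i)\<bar> * \<bar>norm (y $ i)\<bar>)"
    using norm_sum[of "\<lambda>i. x $ i * y $ i" UNIV] by (simp add: norm_mult)
  also have "\<dots> \<le> norm x * norm y"
    unfolding norm_vec_def by (rule L2_set_mult_ineq)
  finally show ?thesis .
qed

text \<open>With s = A^T r and c the entrywise conjugate of s one has |s|^2 = sum of r_l (A c)_l <=
  |r| |A| |s|. The conjugation sits in \<open>c\<close>, which has the norm of \<open>s\<close>, so
  the plain transpose appears and not the adjoint.\<close>

lemma mat_opnorm_transpose: "mat_opnorm (transpose A) = mat_opnorm A"
proof -
  have le: "mat_opnorm (transpose A) \<le> mat_opnorm A" for A :: "complex^'m^'m"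
  proof (rule mat_opnorm_le)
    fix r :: "complex^'m"
    define s where "s = transpose A *v r"
    define c where "c = (\<chi> k. cnj (s $ k))"
    have norm_c: "norm c = norm s" by (simp add: c_def norm_vec_def)
    have s: "s $ k = (\<Sum>l\<in>UNIV. A $ l $ k * r $ l)" for k
      by (simp add: s_def matrix_vector_mult_def transpose_def)
    have "complex_of_real ((norm s)\<^sup>2) = (\<Sum>k\<in>UNIV. s $ k * c $ k)"
      by (simp add: norm_vec_power2 c_def complex_norm_square[symmetric] del: of_real_power)
    also have "\<dots> = (\<Sum>l\<in>UNIV. r $ l * (A *v c) $ l)"
      unfolding s matrix_vector_mult_def
      by (simp add: sum_distrib_right sum_distrib_left ac_simps) (rule sum.swap)
    finally have "(norm s)\<^sup>2 = norm (\<Sum>l\<in>UNIV. r $ l * (A *v c) $ l)"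
      by (metis norm_of_real abs_of_nonneg zero_le_power2)
    also have "\<dots> \<le> norm r * norm (A *v c)"
      by (rule norm_sum_mult_le_norm_vec)
    also have "\<dots> \<le> norm r * (mat_opnorm A * norm s)"
      using mat_opnorm_bound[of A c] by (intro mult_left_mono) (auto simp: norm_c)
    finally have "norm s * norm s \<le> (mat_opnorm A * norm r) * norm s"
      by (simp add: power2_eq_square ac_simps)
    then show "norm (transpose A *v r) \<le> mat_opnorm A * norm r"
      unfolding s_def[symmetric] using mat_opnorm_nonneg[of A] by (cases "norm s = 0") auto
  qed
  show ?thesis
    using le[of A] le[of "transpose A"] by (simp add: transpose_transpose)
qed

lemma matrix_mult_row: "(M ** A) $ j = transpose A *v (M $ j)" for M A :: "complex^'m^'m"
  by (simp add: vec_eq_iff matrix_matrix_mult_def matrix_vector_mult_def transpose_def mult.commute)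

lemma matrix_mult_entry: "(M ** A) $ j $ k = (\<Sum>l\<in>UNIV. M $ j $ l * A $ l $ k)"
  by (simp add: matrix_matrix_mult_def)

text \<open>Needed for the measurability of the pointwise operator norm. The Lipschitz constant m^2
  counts the entries, each of which is at most the norm of the matrix.\<close>

lemma continuous_on_mat_opnorm: "continuous_on UNIV (mat_opnorm :: complex^'m^'m \<Rightarrow> real)"
proof -
  define C where "C = (\<Sum>j\<in>(UNIV :: 'm set). \<Sum>k\<in>(UNIV :: 'm set). 1 :: real)"
  have op: "mat_opnorm A \<le> C * norm A" for A :: "complex^'m^'m"
  proof -
    have "norm (A $ j $ k) \<le> 1 * norm A" for j k
      using order_trans[OF Finite_Cartesian_Product.norm_nth_le Finite_Cartesian_Product.norm_nth_le] by simp
    then have "(\<Sum>j\<in>UNIV. \<Sum>k\<in>UNIV. norm (A $ j $ k)) \<le> (\<Sum>j\<in>(UNIV :: 'm set). \<Sum>k\<in>(UNIV :: 'm set). 1 * norm A)"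
      by (intro sum_mono)
    then show ?thesis
      using mat_opnorm_le_sum[of A] by (simp add: C_def sum_distrib_right)
  qed
  have "C-lipschitz_on UNIV (mat_opnorm :: complex^'m^'m \<Rightarrow> real)"
  proof (rule lipschitz_onI)
    fix A B :: "complex^'m^'m"
    have "mat_opnorm A \<le> mat_opnorm B + C * norm (A - B)" for A B :: "complex^'m^'m"
      using mat_opnorm_triangle[of B "A - B"] op[of "A - B"] by simp
    from this[of A B] this[of B A] show "dist (mat_opnorm A) (mat_opnorm B) \<le> C * dist A B"
      by (simp add: dist_norm norm_minus_commute abs_le_iff)
  qed (simp add: C_def)
  then show ?thesis by (rule lipschitz_on_continuous_on)
qed

text \<open>A matrix is the sum of bounded linear images of its entries under these maps; this is
  how measurability and smoothness pass from the entries to the matrix.\<close>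

definition mat_unit :: "'m \<Rightarrow> 'm \<Rightarrow> complex \<Rightarrow> complex^'m^'m" where
  "mat_unit a b z = (\<chi> j k. if j = a \<and> k = b then z else 0)"

lemma mat_unit_entry: "mat_unit a b z $ j $ k = (if j = a \<and> k = b then z else 0)"
  by (simp add: mat_unit_def)

lemma bounded_linear_mat_unit: "bounded_linear (mat_unit a b :: complex \<Rightarrow> complex^'m^'m)"
  by (rule bounded_linearI') (auto simp: vec_eq_iff mat_unit_entry)

lemma mat_sum_units: "(\<Sum>a\<in>UNIV. \<Sum>b\<in>UNIV. mat_unit a b (c a b)) = (\<chi> j k. c j k)"
proof -
  have "(\<Sum>a\<in>UNIV. \<Sum>b\<in>UNIV. if j = a \<and> k = b then c a b else 0) = c j k" for j k
  proof -
    have "(\<Sum>a\<in>UNIV. \<Sum>b\<in>UNIV. if j = a \<and> k = b then c a b else 0) = (\<Sum>a\<in>UNIV. if j = a then (\<Sum>b\<in>UNIV. if k = b then c a b else 0) else 0)"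
      by (intro sum.cong) auto
    then show ?thesis by simp
  qed
  then show ?thesis
    by (simp add: vec_eq_iff mat_unit_entry)
qed

lemma bounded_linear_entry: "bounded_linear (\<lambda>A :: complex^'m^'m. A $ j $ k)"
  by (rule bounded_linear_compose[OF bounded_linear_vec_nth bounded_linear_vec_nth])

lemma borel_measurable_bounded_linear:
  assumes "bounded_linear L" "f \<in> borel_measurable M" shows "(\<lambda>x. L (f x)) \<in> borel_measurable M"
  by (rule borel_measurable_continuous_on[OF linear_continuous_on[OF assms(1)] assms(2)])

lemma borel_measurable_mat_iff:
  fixes f :: "'a \<Rightarrow> complex^'m^'m"
  shows "f \<in> borel_measurable M \<longleftrightarrow> (\<forall>j k. (\<lambda>x. f x $ j $ k) \<in> borel_measurable M)"
proof
  assume "f \<in> borel_measurable M"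
  then show "\<forall>j k. (\<lambda>x. f x $ j $ k) \<in> borel_measurable M"
    using borel_measurable_bounded_linear[OF bounded_linear_entry] by blast
next
  assume "\<forall>j k. (\<lambda>x. f x $ j $ k) \<in> borel_measurable M"
  then have "(\<lambda>x. \<Sum>a\<in>UNIV. \<Sum>b\<in>UNIV. mat_unit a b (f x $ a $ b)) \<in> borel_measurable M"
    by (intro borel_measurable_sum borel_measurable_bounded_linear[OF bounded_linear_mat_unit]) auto
  then show "f \<in> borel_measurable M"
    by (simp add: mat_sum_units)
qed

lemma borel_measurable_mat_opnorm:
  "f \<in> borel_measurable M \<Longrightarrow> (\<lambda>x. mat_opnorm (f x)) \<in> borel_measurable M"
  by (rule borel_measurable_continuous_on[OF continuous_on_mat_opnorm])

text \<open>The scalar theory is applied to the operator norm of \<open>f x\<close>, viewed as a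
  complex function whose L2 norm is \<open>L2_norm f\<close> and which dominates every
  entry.\<close>

lemma
  fixes f :: "real^'n \<Rightarrow> complex^'m^'m"
  assumes f: "f \<in> L2_mat"
  shows L2_mat_entry: "(\<lambda>x. f x $ j $ k) \<in> L2_fun"
    and L2_fun_norm_entry_le: "L2_fun_norm (\<lambda>x. f x $ j $ k) \<le> L2_norm f"
proof -
  have fm: "f \<in> borel_measurable lebesgue" using f by (simp add: L2_mat_def)
  let ?g = "\<lambda>x. complex_of_real (mat_opnorm (f x))"
  have g: "?g \<in> L2_fun"
    using f borel_measurable_mat_opnorm[OF fm] by (simp add: L2_mat_def L2_fun_def)
  have "AE x in lebesgue. norm (f x $ j $ k) \<le> 1 * norm (?g x)"
    by (intro AE_I2) (simp add: norm_entry_le_mat_opnorm mat_opnorm_nonneg)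
  from L2_fun_bound[OF _ g _ this] fm
  show "(\<lambda>x. f x $ j $ k) \<in> L2_fun" "L2_fun_norm (\<lambda>x. f x $ j $ k) \<le> L2_norm f"
    by (simp_all add: borel_measurable_mat_iff L2_fun_norm_def L2_norm_def)
qed

lemma
  fixes f :: "real^'n \<Rightarrow> complex^'m^'m"
  assumes f: "\<And>j k. (\<lambda>x. f x $ j $ k) \<in> L2_fun"
  shows L2_matI: "f \<in> L2_mat"
    and L2_norm_le: "L2_norm f \<le> (\<Sum>j\<in>UNIV. \<Sum>k\<in>UNIV. L2_fun_norm (\<lambda>x. f x $ j $ k))"
proof -
  have fm: "f \<in> borel_measurable lebesgue"
    using f by (simp add: borel_measurable_mat_iff L2_fun_measurable)
  let ?h = "\<lambda>x. \<Sum>j\<in>UNIV. \<Sum>k\<in>UNIV. complex_of_real (norm (f x $ j $ k))"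
  let ?g = "\<lambda>x. complex_of_real (mat_opnorm (f x))"
  have e: "(\<lambda>x. complex_of_real (norm (f x $ j $ k))) \<in> L2_fun" for j k
    using f[of j k] by (auto simp: L2_fun_def)
  have h: "?h \<in> L2_fun" by (intro L2_fun_sum e)
  have "AE x in lebesgue. norm (?g x) \<le> 1 * norm (?h x)"
  proof (rule AE_I2)
    fix x
    have "norm (?h x) = (\<Sum>j\<in>UNIV. \<Sum>k\<in>UNIV. norm (f x $ j $ k))"
      by (simp add: sum_nonneg flip: of_real_sum)
    then show "norm (?g x) \<le> 1 * norm (?h x)"
      using mat_opnorm_le_sum[of "f x"] mat_opnorm_nonneg[of "f x"] by simp
  qed
  from L2_fun_bound[OF _ h _ this] borel_measurable_mat_opnorm[OF fm]
  have g: "?g \<in> L2_fun" "L2_fun_norm ?g \<le> L2_fun_norm ?h" by simp_all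
  show "f \<in> L2_mat"
    using fm g(1) by (simp add: L2_mat_def L2_fun_def)
  have "L2_norm f = L2_fun_norm ?g"
    by (simp add: L2_norm_def L2_fun_norm_def)
  also have "\<dots> \<le> L2_fun_norm ?h" by (rule g)
  also have "\<dots> \<le> (\<Sum>j\<in>UNIV. \<Sum>k\<in>UNIV. L2_fun_norm (\<lambda>x. complex_of_real (norm (f x $ j $ k))))"
    by (intro order_trans[OF L2_fun_norm_sum] sum_mono L2_fun_norm_sum L2_fun_sum e)
  also have "\<dots> = (\<Sum>j\<in>UNIV. \<Sum>k\<in>UNIV. L2_fun_norm (\<lambda>x. f x $ j $ k))"
    by (simp add: L2_fun_norm_def)
  finally show "L2_norm f \<le> (\<Sum>j\<in>UNIV. \<Sum>k\<in>UNIV. L2_fun_norm (\<lambda>x. f x $ j $ k))" .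
qed

lemma C0inf_entry:
  fixes f :: "real^'n \<Rightarrow> complex^'m^'m"
  shows "f \<in> C0inf \<Longrightarrow> (\<lambda>x. f x $ j $ k) \<in> C0inf"
  by (rule C0inf_bounded_linear[OF bounded_linear_entry])

lemma C0inf_matI:
  fixes \<phi> :: "'m::finite \<Rightarrow> 'm \<Rightarrow> real^'n \<Rightarrow> complex"
  assumes "\<And>j k. \<phi> j k \<in> C0inf"
  shows "(\<lambda>x. \<chi> j k. \<phi> j k x) \<in> C0inf"
proof -
  have "(\<lambda>x. \<Sum>a\<in>UNIV. \<Sum>b\<in>UNIV. mat_unit a b (\<phi> a b x)) \<in> C0inf"
    by (intro C0inf_sum C0inf_bounded_linear[OF bounded_linear_mat_unit] assms)
  then show ?thesis by (simp add: mat_sum_units)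
qed

lemma C0inf_L2_mat: "f \<in> C0inf \<Longrightarrow> f \<in> L2_mat"
  by (intro L2_matI C0inf_L2_fun C0inf_entry)

lemma C0inf_dense_L2_mat:
  fixes f :: "real^'n \<Rightarrow> complex^'m^'m"
  assumes f: "f \<in> L2_mat"
  obtains g where "\<And>i. g i \<in> C0inf" "\<And>j k. L2_tendsto (\<lambda>i x. g i x $ j $ k) (\<lambda>x. f x $ j $ k)"
proof -
  have "\<exists>\<phi>. (\<forall>i. \<phi> i \<in> C0inf) \<and> L2_tendsto \<phi> (\<lambda>x. f x $ j $ k)" for j k
    using C0inf_dense_L2_fun[OF L2_mat_entry[OF f]] by (simp add: C0inf_approx_def)
  then obtain \<phi> where \<phi>: "\<And>j k i. \<phi> j k i \<in> C0inf" "\<And>j k. L2_tendsto (\<phi> j k) (\<lambda>x. f x $ j $ k)"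
    by metis
  show ?thesis
    by (rule that[of "\<lambda>i x. \<chi> j k. \<phi> j k i x"]) (use \<phi> in \<open>auto intro!: C0inf_matI\<close>)
qed

lemma fourier_entry: "fourier f y $ j $ k = fourier_fun (\<lambda>x. f x $ j $ k) y"
  by (simp add: fourier_def)

lemma multiplier_entry:
  "multiplier F f x $ j $ k = L2_inv_fourier_fun (\<lambda>y. (fourier f y ** F y) $ j $ k) x"
  by (simp add: multiplier_def L2_inv_fourier_def)

lemma L2_mat_diff: "f \<in> L2_mat \<Longrightarrow> g \<in> L2_mat \<Longrightarrow> (\<lambda>x. f x - g x) \<in> L2_mat"
  by (intro L2_matI) (simp add: L2_fun_diff L2_mat_entry)

lemma L2_mat_scale: "f \<in> L2_mat \<Longrightarrow> (\<lambda>x. mat_scale c (f x)) \<in> L2_mat"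
  by (intro L2_matI) (simp add: L2_fun_mult L2_mat_entry mat_scale_def)

section \<open>Bounded operators on L2 and norms depending on the entry norms\<close>

lemma bounded_L2_operator_L2: "bounded_L2_operator T \<Longrightarrow> f \<in> L2_mat \<Longrightarrow> T f \<in> L2_mat"
  by (simp add: bounded_L2_operator_def)

lemma bounded_L2_operator_add:
  "bounded_L2_operator T \<Longrightarrow> f \<in> L2_mat \<Longrightarrow> g \<in> L2_mat \<Longrightarrow>
    AE x in lebesgue. T (\<lambda>y. f y + g y) x = T f x + T g x"
  by (simp add: bounded_L2_operator_def)

lemma bounded_L2_operator_scale:
  "bounded_L2_operator T \<Longrightarrow> f \<in> L2_mat \<Longrightarrow>
    AE x in lebesgue. T (\<lambda>y. mat_scale c (f y)) x = mat_scale c (T f x)"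
  by (simp add: bounded_L2_operator_def)

lemma bounded_L2_operator_entries_tendsto:
  assumes T: "bounded_L2_operator T"
    and g: "\<And>i. g i \<in> L2_mat" and f: "f \<in> L2_mat"
    and lim: "\<And>j k. L2_tendsto (\<lambda>i x. g i x $ j $ k) (\<lambda>x. f x $ j $ k)"
  shows "L2_tendsto (\<lambda>i x. T (g i) x $ j $ k) (\<lambda>x. T f x $ j $ k)"
proof -
  obtain K where K: "\<And>f. f \<in> L2_mat \<Longrightarrow> L2_norm (T f) \<le> K * L2_norm f"
    using T unfolding bounded_L2_operator_def by blast
  let ?d = "\<lambda>i x. g i x - f x"
  let ?s = "\<lambda>i. \<Sum>j\<in>UNIV. \<Sum>k\<in>UNIV. L2_fun_norm (\<lambda>x. g i x $ j $ k - f x $ j $ k)"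
  have d: "?d i \<in> L2_mat" for i using g f by (rule L2_mat_diff)
  note TL = bounded_L2_operator_L2[OF T]
  have le: "L2_fun_norm (\<lambda>x. T (g i) x $ j $ k - T f x $ j $ k) \<le> \<bar>K\<bar> * ?s i" for i
  proof -
    \<comment> \<open>Additivity is applied to g i = (g i - f) + f and solved for the image of the
      difference.\<close>
    have "AE x in lebesgue. T (\<lambda>y. ?d i y + f y) x = T (?d i) x + T f x"
      by (rule bounded_L2_operator_add[OF T d f])
    then have "AE x in lebesgue. T (?d i) x $ j $ k = T (g i) x $ j $ k - T f x $ j $ k"
      by eventually_elim simp
    then have "L2_fun_norm (\<lambda>x. T (?d i) x $ j $ k) = L2_fun_norm (\<lambda>x. T (g i) x $ j $ k - T f x $ j $ k)"
      by (intro L2_fun_norm_cong_AE L2_fun_measurable L2_fun_diff L2_mat_entry TL d g f)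
    then have "L2_fun_norm (\<lambda>x. T (g i) x $ j $ k - T f x $ j $ k) \<le> L2_norm (T (?d i))"
      using L2_fun_norm_entry_le[OF TL[OF d[of i]], of j k] by simp
    also have "\<dots> \<le> K * L2_norm (?d i)" by (rule K[OF d])
    also have "\<dots> \<le> \<bar>K\<bar> * L2_norm (?d i)"
      by (intro mult_right_mono) (auto simp: L2_norm_def)
    also have "\<dots> \<le> \<bar>K\<bar> * ?s i"
      using L2_norm_le[OF L2_mat_entry[OF d[of i]]] by (intro mult_left_mono) auto
    finally show ?thesis .
  qed
  have "(\<lambda>i. \<bar>K\<bar> * ?s i) \<longlonglongrightarrow> \<bar>K\<bar> * (\<Sum>j\<in>(UNIV :: 'b set). \<Sum>k\<in>(UNIV :: 'b set). 0)"
    using lim by (intro tendsto_mult tendsto_const tendsto_sum) (simp add: L2_tendsto_def)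
  then have lim0: "(\<lambda>i. \<bar>K\<bar> * ?s i) \<longlonglongrightarrow> 0" by simp
  have "(\<lambda>i. L2_fun_norm (\<lambda>x. T (g i) x $ j $ k - T f x $ j $ k)) \<longlonglongrightarrow> 0"
  proof (rule Lim_null_comparison[OF always_eventually lim0], rule allI)
    fix i
    show "norm (L2_fun_norm (\<lambda>x. T (g i) x $ j $ k - T f x $ j $ k)) \<le> \<bar>K\<bar> * ?s i"
      unfolding real_norm_def abs_of_nonneg[OF L2_fun_norm_nonneg] by (rule le)
  qed
  then show ?thesis
    using TL g f by (simp add: L2_tendsto_def L2_mat_entry)
qed

text \<open>The norms \<open>L2_HS_norm\<close> and \<open>L2_triple_norm\<close> depend on the matrix of entry norms only,
  through a continuous positively homogeneous function \<open>\<Phi>\<close> dominating the entries.\<close>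

definition entrywise_norm ::
  "((real^'n \<Rightarrow> complex^'m^'m) \<Rightarrow> real) \<Rightarrow> (('m \<Rightarrow> 'm \<Rightarrow> real) \<Rightarrow> real) \<Rightarrow> bool" where
  "entrywise_norm N \<Phi> \<longleftrightarrow>
    (\<forall>f\<in>L2_mat. N f = \<Phi> (\<lambda>j k. L2_fun_norm (\<lambda>x. f x $ j $ k))) \<and>
    (\<forall>a b. (\<forall>j k. (\<lambda>i::nat. a i j k) \<longlonglongrightarrow> b j k) \<longrightarrow> (\<lambda>i. \<Phi> (a i)) \<longlonglongrightarrow> \<Phi> b) \<and>
    (\<forall>a c. c \<ge> 0 \<longrightarrow> \<Phi> (\<lambda>j k. c * a j k) = c * \<Phi> a) \<and>
    (\<forall>a j k. (\<forall>j k. a j k \<ge> 0) \<longrightarrow> a j k \<le> \<Phi> a)"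

lemma entrywise_norm_triple:
  "entrywise_norm (L2_triple_norm :: (real^'n \<Rightarrow> complex^'m^'m) \<Rightarrow> real) (\<lambda>a. \<Sum>j\<in>UNIV. \<Sum>k\<in>UNIV. a j k)"
  unfolding entrywise_norm_def
proof (intro conjI ballI allI impI)
  fix a :: "'m \<Rightarrow> 'm \<Rightarrow> real" and j k assume a: "\<forall>j k. a j k \<ge> 0"
  have "a j k \<le> (\<Sum>k\<in>UNIV. a j k)" using a by (intro member_le_sum) auto
  also have "\<dots> \<le> (\<Sum>j\<in>UNIV. \<Sum>k\<in>UNIV. a j k)"
    using a by (intro member_le_sum[of j UNIV "\<lambda>j. \<Sum>k\<in>UNIV. a j k"] sum_nonneg) auto
  finally show "a j k \<le> (\<Sum>j\<in>UNIV. \<Sum>k\<in>UNIV. a j k)" .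
qed (auto simp: L2_triple_norm_def sum_distrib_left intro!: tendsto_sum)

lemma entrywise_norm_HS:
  "entrywise_norm (L2_HS_norm :: (real^'n \<Rightarrow> complex^'m^'m) \<Rightarrow> real) (\<lambda>a. sqrt (\<Sum>j\<in>UNIV. \<Sum>k\<in>UNIV. (a j k)\<^sup>2))"
  unfolding entrywise_norm_def
proof (intro conjI ballI allI impI)
  fix f :: "real^'n \<Rightarrow> complex^'m^'m" assume f: "f \<in> L2_mat"
  show "L2_HS_norm f = sqrt (\<Sum>j\<in>UNIV. \<Sum>k\<in>UNIV. (L2_fun_norm (\<lambda>x. f x $ j $ k))\<^sup>2)"
    unfolding L2_HS_norm_def L2_fun_norm_power2
    by (simp add: Bochner_Integration.integral_sum Bochner_Integration.integrable_sum L2_fun_integrable[OF L2_mat_entry[OF f]])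
next
  fix a :: "nat \<Rightarrow> 'm \<Rightarrow> 'm \<Rightarrow> real" and b
  assume "\<forall>j k. (\<lambda>i. a i j k) \<longlonglongrightarrow> b j k"
  then show "(\<lambda>i. sqrt (\<Sum>j\<in>UNIV. \<Sum>k\<in>UNIV. (a i j k)\<^sup>2)) \<longlonglongrightarrow> sqrt (\<Sum>j\<in>UNIV. \<Sum>k\<in>UNIV. (b j k)\<^sup>2)"
    by (intro tendsto_real_sqrt tendsto_sum tendsto_power) auto
next
  fix a :: "'m \<Rightarrow> 'm \<Rightarrow> real" and c :: real assume "c \<ge> 0"
  then show "sqrt (\<Sum>j\<in>UNIV. \<Sum>k\<in>UNIV. (c * a j k)\<^sup>2) = c * sqrt (\<Sum>j\<in>UNIV. \<Sum>k\<in>UNIV. (a j k)\<^sup>2)"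
    by (simp add: power_mult_distrib real_sqrt_mult flip: sum_distrib_left)
next
  fix a :: "'m \<Rightarrow> 'm \<Rightarrow> real" and j k assume a: "\<forall>j k. a j k \<ge> 0"
  have "(a j k)\<^sup>2 \<le> (\<Sum>k\<in>UNIV. (a j k)\<^sup>2)" by (intro member_le_sum) auto
  also have "\<dots> \<le> (\<Sum>j\<in>UNIV. \<Sum>k\<in>UNIV. (a j k)\<^sup>2)"
    by (intro member_le_sum[of j UNIV "\<lambda>j. \<Sum>k\<in>UNIV. (a j k)\<^sup>2"] sum_nonneg) auto
  finally show "a j k \<le> sqrt (\<Sum>j\<in>UNIV. \<Sum>k\<in>UNIV. (a j k)\<^sup>2)"
    by (rule real_le_rsqrt)
qed

section \<open>Bounds for multipliers\<close>

lemma entrywise_norm_eq: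
  "entrywise_norm N \<Phi> \<Longrightarrow> f \<in> L2_mat \<Longrightarrow> N f = \<Phi> (\<lambda>j k. L2_fun_norm (\<lambda>x. f x $ j $ k))"
  by (simp add: entrywise_norm_def)

lemma entrywise_norm_cong:
  assumes "entrywise_norm N \<Phi>" "f \<in> L2_mat" "g \<in> L2_mat"
    "\<And>j k. L2_fun_norm (\<lambda>x. f x $ j $ k) = L2_fun_norm (\<lambda>x. g x $ j $ k)"
  shows "N f = N g"
  using assms by (simp add: entrywise_norm_eq)

lemma entrywise_norm_tendsto_cont:
  "entrywise_norm N \<Phi> \<Longrightarrow> (\<And>j k. (\<lambda>i. a i j k) \<longlonglongrightarrow> b j k) \<Longrightarrow> (\<lambda>i. \<Phi> (a i)) \<longlonglongrightarrow> \<Phi> b"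
  by (simp add: entrywise_norm_def)

lemma entrywise_norm_entry_le: "entrywise_norm N \<Phi> \<Longrightarrow> (\<And>j k. a j k \<ge> 0) \<Longrightarrow> a j k \<le> \<Phi> a"
  by (simp add: entrywise_norm_def)

lemma entry_le_entrywise_norm:
  assumes "entrywise_norm N \<Phi>" "f \<in> L2_mat"
  shows "L2_fun_norm (\<lambda>x. f x $ j $ k) \<le> N f"
proof -
  have "L2_fun_norm (\<lambda>x. f x $ j $ k) \<le> \<Phi> (\<lambda>j k. L2_fun_norm (\<lambda>x. f x $ j $ k))"
    by (rule entrywise_norm_entry_le[OF assms(1), where a = "\<lambda>j k. L2_fun_norm (\<lambda>x. f x $ j $ k)"])
      (rule L2_fun_norm_nonneg)
  then show ?thesis
    unfolding entrywise_norm_eq[OF assms] .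
qed

lemma entrywise_norm_nonneg: "entrywise_norm N \<Phi> \<Longrightarrow> f \<in> L2_mat \<Longrightarrow> N f \<ge> 0"
  using entry_le_entrywise_norm L2_fun_norm_nonneg order_trans by blast

lemma entrywise_norm_scale:
  assumes "entrywise_norm N \<Phi>" "f \<in> L2_mat" "g \<in> L2_mat" "c \<ge> 0"
    "\<And>j k. L2_fun_norm (\<lambda>x. g x $ j $ k) = c * L2_fun_norm (\<lambda>x. f x $ j $ k)"
  shows "N g = c * N f"
  using assms(1,4) unfolding entrywise_norm_eq[OF assms(1,2)] entrywise_norm_eq[OF assms(1,3)] assms(5)
  by (simp add: entrywise_norm_def)

lemma entrywise_norm_tendsto:
  assumes N: "entrywise_norm N \<Phi>"
    and lim: "\<And>j k. L2_tendsto (\<lambda>i x. g i x $ j $ k) (\<lambda>x. f x $ j $ k)"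
  shows "(\<lambda>i. N (g i)) \<longlonglongrightarrow> N f"
proof -
  have L: "f \<in> L2_mat" "g i \<in> L2_mat" for i
    using lim by (auto intro!: L2_matI simp: L2_tendsto_def)
  have "(\<lambda>i. \<Phi> (\<lambda>j k. L2_fun_norm (\<lambda>x. g i x $ j $ k))) \<longlonglongrightarrow> \<Phi> (\<lambda>j k. L2_fun_norm (\<lambda>x. f x $ j $ k))"
    by (rule entrywise_norm_tendsto_cont[OF N, where a = "\<lambda>i j k. L2_fun_norm (\<lambda>x. g i x $ j $ k)"])
      (rule L2_tendsto_norm[OF lim])
  then show ?thesis
    unfolding entrywise_norm_eq[OF N L(1)] entrywise_norm_eq[OF N L(2)] .
qed

lemma L2_operator_norm_leI:
  assumes "\<And>f. f \<in> L2_mat \<Longrightarrow> N (T f) \<le> R * N f" "R \<ge> 0"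
  shows "L2_operator_norm N T \<le> ereal R"
  unfolding L2_operator_norm_def
proof (rule SUP_least, clarsimp)
  fix f assume "f \<in> L2_mat" "N f \<le> 1"
  then show "N (T f) \<le> R"
    using assms(1)[of f] mult_left_mono[of "N f" 1 R] assms(2) by simp
qed

text \<open>Scaling to the unit ball works if \<open>N f\<close> is positive. If \<open>N f\<close>
  is 0, all entries of \<open>f\<close> have norm 0, and boundedness with respect to
  \<open>L2_norm\<close> makes the entries of \<open>T f\<close> vanish in norm as well.\<close>

lemma L2_operator_norm_leD:
  assumes N: "entrywise_norm N \<Phi>" and T: "bounded_L2_operator T"
    and R: "L2_operator_norm N T \<le> ereal R" and f: "f \<in> L2_mat"
  shows "N (T f) \<le> R * N f"
proof (cases "N f = 0")
  case True
  have Tf: "T f \<in> L2_mat" using T f by (rule bounded_L2_operator_L2)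
  have "L2_fun_norm (\<lambda>x. f x $ j $ k) = 0" for j k
    using entry_le_entrywise_norm[OF N f, of j k] L2_fun_norm_nonneg[of "\<lambda>x. f x $ j $ k"] True by simp
  then have "L2_norm f \<le> 0"
    using L2_norm_le[OF L2_mat_entry[OF f]] by simp
  moreover have "L2_norm f \<ge> 0" by (simp add: L2_norm_def)
  ultimately have "L2_norm (T f) \<le> 0"
    using T f unfolding bounded_L2_operator_def by (metis mult_zero_right order_antisym)
  then have "L2_fun_norm (\<lambda>x. T f x $ j $ k) = 0" for j k
    using L2_fun_norm_entry_le[OF Tf, of j k] L2_fun_norm_nonneg[of "\<lambda>x. T f x $ j $ k"] by simp
  \<comment> \<open>Homogeneity with the factor 0 shows that \<open>N\<close> vanishes as soon as
    all entry norms do.\<close>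
  then have "N (T f) = 0 * N (T f)"
    by (intro entrywise_norm_scale[OF N Tf Tf]) auto
  then show ?thesis using True by simp
next
  case False
  then have pos: "N f > 0" using entrywise_norm_nonneg[OF N f] by simp
  define c where "c = 1 / N f"
  have c: "c > 0" using pos by (simp add: c_def)
  define g where "g = (\<lambda>x. mat_scale (complex_of_real c) (f x))"
  have g: "g \<in> L2_mat" unfolding g_def by (rule L2_mat_scale[OF f])
  have Tf: "T f \<in> L2_mat" and Tg: "T g \<in> L2_mat" using T f g by (auto intro: bounded_L2_operator_L2)
  have "L2_fun_norm (\<lambda>x. g x $ j $ k) = c * L2_fun_norm (\<lambda>x. f x $ j $ k)" for j k
    using c L2_fun_norm_mult[of "complex_of_real c" "\<lambda>x. f x $ j $ k"] by (simp add: g_def mat_scale_def)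
  then have "N g = c * N f"
    using c by (intro entrywise_norm_scale[OF N f g]) auto
  then have "N g \<le> 1" using pos by (simp add: c_def)
  then have "ereal (N (T g)) \<le> L2_operator_norm N T"
    unfolding L2_operator_norm_def using g by (intro SUP_upper) simp
  then have "N (T g) \<le> R" using R order_trans by fastforce
  moreover have "N (T g) = c * N (T f)"
  proof (rule entrywise_norm_scale[OF N Tf Tg])
    fix j k
    have "AE x in lebesgue. T g x $ j $ k = complex_of_real c * T f x $ j $ k"
      using bounded_L2_operator_scale[OF T f, of "complex_of_real c"]
      unfolding g_def[symmetric] by eventually_elim (simp add: mat_scale_def)
    then have "L2_fun_norm (\<lambda>x. T g x $ j $ k) = L2_fun_norm (\<lambda>x. complex_of_real c * T f x $ j $ k)"
      by (intro L2_fun_norm_cong_AE L2_fun_measurable L2_mat_entry[OF Tg] L2_fun_mult L2_mat_entry[OF Tf])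
    then show "L2_fun_norm (\<lambda>x. T g x $ j $ k) = c * L2_fun_norm (\<lambda>x. T f x $ j $ k)"
      using c L2_fun_norm_mult[of "complex_of_real c" "\<lambda>x. T f x $ j $ k"] by simp
  qed (use c in simp)
  ultimately show ?thesis using pos by (simp add: c_def field_simps)
qed

lemma multiplier_symbol_L2_mat:
  "multiplier_symbol F \<Longrightarrow> f \<in> C0inf \<Longrightarrow> (\<lambda>y. fourier f y ** F y) \<in> L2_mat"
  by (simp add: multiplier_symbol_def)

lemma bounded_extension_entry_norm:
  assumes F: "multiplier_symbol F" and T: "bounded_extension F T" and f: "f \<in> C0inf"
  shows "L2_fun_norm (\<lambda>x. T f x $ j $ k) = L2_fun_norm (\<lambda>y. (fourier f y ** F y) $ j $ k)"
proof -
  have g: "(\<lambda>y. (fourier f y ** F y) $ j $ k) \<in> L2_fun"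
    by (rule L2_mat_entry[OF multiplier_symbol_L2_mat[OF F f]])
  have Tf: "T f \<in> L2_mat"
    using T C0inf_L2_mat[OF f] by (auto simp: bounded_extension_def intro: bounded_L2_operator_L2)
  have "AE x in lebesgue. T f x = multiplier F f x"
    using T f by (simp add: bounded_extension_def)
  then have "AE x in lebesgue. T f x $ j $ k = L2_inv_fourier_fun (\<lambda>y. (fourier f y ** F y) $ j $ k) x"
    by eventually_elim (simp add: multiplier_entry)
  then have "L2_fun_norm (\<lambda>x. T f x $ j $ k) = L2_fun_norm (L2_inv_fourier_fun (\<lambda>y. (fourier f y ** F y) $ j $ k))"
    by (intro L2_fun_norm_cong_AE L2_fun_measurable L2_mat_entry[OF Tf] L2_inv_fourier_fun_L2[OF g])
  then show ?thesis
    using L2_inv_fourier_fun_norm[OF g] by simp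
qed

text \<open>\<open>N\<close> sees only the norms of the entries, so an isometry applied to each
  entry separately leaves it unchanged.\<close>

lemma bounded_extension_norm:
  assumes N: "entrywise_norm N \<Phi>" and F: "multiplier_symbol F" and T: "bounded_extension F T" and f: "f \<in> C0inf"
  shows "N (T f) = N (\<lambda>y. fourier f y ** F y)"
proof (rule entrywise_norm_cong[OF N _ multiplier_symbol_L2_mat[OF F f]])
  show "T f \<in> L2_mat"
    using T C0inf_L2_mat[OF f] by (auto simp: bounded_extension_def intro: bounded_L2_operator_L2)
qed (rule bounded_extension_entry_norm[OF F T f])

lemma fourier_L2_mat:
  assumes f: "f \<in> C0inf" shows "fourier f \<in> L2_mat"
  by (intro L2_matI) (simp add: fourier_entry Plancherel(1)[OF C0inf_L12[OF C0inf_entry[OF f]]])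

lemma fourier_norm:
  assumes N: "entrywise_norm N \<Phi>" and f: "f \<in> C0inf"
  shows "N (fourier f) = N f"
  by (rule entrywise_norm_cong[OF N fourier_L2_mat[OF f] C0inf_L2_mat[OF f]])
    (simp add: fourier_entry Plancherel(2)[OF C0inf_L12[OF C0inf_entry[OF f]]])

text \<open>\<open>T\<close> is a multiplier only on test functions. Both sides of the inequality
  are continuous under entrywise L2 convergence, so density carries the bound to every
  \<open>f\<close>.\<close>

lemma bounded_extension_norm_le:
  assumes N: "entrywise_norm N \<Phi>" and F: "multiplier_symbol F" and T: "bounded_extension F T"
    and R: "R \<ge> 0" "\<And>g. g \<in> L2_mat \<Longrightarrow> (\<lambda>y. g y ** F y) \<in> L2_mat \<Longrightarrow> N (\<lambda>y. g y ** F y) \<le> R * N g"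
  shows "L2_operator_norm N T \<le> ereal R"
proof (rule L2_operator_norm_leI[OF _ R(1)])
  have bT: "bounded_L2_operator T" using T by (simp add: bounded_extension_def)
  fix f :: "real^'a \<Rightarrow> complex^'b^'b" assume f: "f \<in> L2_mat"
  obtain g where g: "\<And>i. g i \<in> C0inf" "\<And>j k. L2_tendsto (\<lambda>i x. g i x $ j $ k) (\<lambda>x. f x $ j $ k)"
    using C0inf_dense_L2_mat[OF f] by blast
  have "N (T (g i)) \<le> R * N (g i)" for i
    using R(2)[OF fourier_L2_mat[OF g(1)] multiplier_symbol_L2_mat[OF F g(1)]]
    unfolding bounded_extension_norm[OF N F T g(1)] fourier_norm[OF N g(1)] .
  moreover have "(\<lambda>i. N (T (g i))) \<longlonglongrightarrow> N (T f)"
    by (intro entrywise_norm_tendsto[OF N] bounded_L2_operator_entries_tendsto[OF bT C0inf_L2_mat[OF g(1)] f g(2)])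
  moreover have "(\<lambda>i. R * N (g i)) \<longlonglongrightarrow> R * N f"
    by (intro tendsto_mult tendsto_const entrywise_norm_tendsto[OF N g(2)])
  ultimately show "N (T f) \<le> R * N f"
    using LIMSEQ_le by blast
qed

lemma L2_HS_norm_mult_le:
  assumes g: "g \<in> L2_mat" and gF: "(\<lambda>y. g y ** F y) \<in> L2_mat" and R: "R \<ge> 0"
    and F: "AE y in lebesgue. mat_opnorm (F y) \<le> R"
  shows "L2_HS_norm (\<lambda>y. g y ** F y) \<le> R * L2_HS_norm g"
proof -
  have int: "integrable lebesgue (\<lambda>y. \<Sum>j\<in>UNIV. \<Sum>k\<in>UNIV. (norm (h y $ j $ k))\<^sup>2)" if "h \<in> L2_mat" for h
    by (intro Bochner_Integration.integrable_sum L2_fun_integrable L2_mat_entry that)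
  have rows: "(\<Sum>j\<in>UNIV. \<Sum>k\<in>UNIV. (norm (A $ j $ k))\<^sup>2) = (\<Sum>j\<in>UNIV. (norm (A $ j))\<^sup>2)" for A :: "complex^'b^'b"
    by (simp add: norm_vec_power2)
  have "(LINT y|lebesgue. (\<Sum>j\<in>UNIV. \<Sum>k\<in>UNIV. (norm ((g y ** F y) $ j $ k))\<^sup>2)) \<le>
      (LINT y|lebesgue. R\<^sup>2 * (\<Sum>j\<in>UNIV. \<Sum>k\<in>UNIV. (norm (g y $ j $ k))\<^sup>2))"
  proof (rule integral_mono_AE[OF int[OF gF] integrable_mult_right[OF int[OF g]]])
    show "AE y in lebesgue. (\<Sum>j\<in>UNIV. \<Sum>k\<in>UNIV. (norm ((g y ** F y) $ j $ k))\<^sup>2) \<le>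
        R\<^sup>2 * (\<Sum>j\<in>UNIV. \<Sum>k\<in>UNIV. (norm (g y $ j $ k))\<^sup>2)"
      using F
    proof eventually_elim
      case (elim y)
      have "norm ((g y ** F y) $ j) \<le> R * norm (g y $ j)" for j
      proof -
        have "norm ((g y ** F y) $ j) \<le> mat_opnorm (F y) * norm (g y $ j)"
          unfolding matrix_mult_row using mat_opnorm_bound mat_opnorm_transpose by metis
        also have "\<dots> \<le> R * norm (g y $ j)" using elim by (rule mult_right_mono) simp
        finally show ?thesis .
      qed
      then have "(\<Sum>j\<in>UNIV. (norm ((g y ** F y) $ j))\<^sup>2) \<le> (\<Sum>j\<in>UNIV. (R * norm (g y $ j))\<^sup>2)"
        by (intro sum_mono power_mono) auto
      then show ?case
        unfolding rows by (simp add: power_mult_distrib sum_distrib_left)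
    qed
  qed
  then have "L2_HS_norm (\<lambda>y. g y ** F y) \<le> sqrt (R\<^sup>2 * (LINT y|lebesgue. (\<Sum>j\<in>UNIV. \<Sum>k\<in>UNIV. (norm (g y $ j $ k))\<^sup>2)))"
    unfolding L2_HS_norm_def by (intro real_sqrt_le_mono) simp
  then show ?thesis
    using R by (simp add: L2_HS_norm_def real_sqrt_mult)
qed

text \<open>The bounds \<open>c l k\<close> may differ from entry to entry: for the identity matrix,
  which shows that the constant 1 is sharp, they have to be 0 off the diagonal.\<close>

lemma
  fixes F :: "real^'n \<Rightarrow> complex^'m^'m" and c :: "'m \<Rightarrow> 'm \<Rightarrow> real"
  assumes Fm: "F \<in> borel_measurable lebesgue"
    and F: "\<And>l k. AE y in lebesgue. norm (F y $ l $ k) \<le> c l k" and c: "\<And>l k. c l k \<ge> 0"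
    and g: "\<And>l. (\<lambda>y. g l y) \<in> L2_fun"
  shows L2_fun_sum_mult_entry: "(\<lambda>y. \<Sum>l\<in>UNIV. g l y * F y $ l $ k) \<in> L2_fun"
    and L2_fun_norm_sum_mult_entry:
      "L2_fun_norm (\<lambda>y. \<Sum>l\<in>UNIV. g l y * F y $ l $ k) \<le> (\<Sum>l\<in>UNIV. c l k * L2_fun_norm (g l))"
proof -
  have *: "(\<lambda>y. g l y * F y $ l $ k) \<in> L2_fun \<and> L2_fun_norm (\<lambda>y. g l y * F y $ l $ k) \<le> c l k * L2_fun_norm (g l)" for l
  proof -
    have "(\<lambda>y. g l y * F y $ l $ k) \<in> borel_measurable lebesgue"
      using Fm L2_fun_measurable[OF g] by (intro borel_measurable_times) (simp_all add: borel_measurable_mat_iff)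
    moreover have "AE y in lebesgue. norm (g l y * F y $ l $ k) \<le> c l k * norm (g l y)"
      using F[of l k] by eventually_elim (simp add: norm_mult mult.commute[of "norm (g l _)"] mult_right_mono)
    ultimately show ?thesis
      using L2_fun_bound[OF _ g c] by blast
  qed
  then show "(\<lambda>y. \<Sum>l\<in>UNIV. g l y * F y $ l $ k) \<in> L2_fun"
    by (intro L2_fun_sum) blast
  have "L2_fun_norm (\<lambda>y. \<Sum>l\<in>UNIV. g l y * F y $ l $ k) \<le> (\<Sum>l\<in>UNIV. L2_fun_norm (\<lambda>y. g l y * F y $ l $ k))"
    using * by (intro L2_fun_norm_sum) blast
  also have "\<dots> \<le> (\<Sum>l\<in>UNIV. c l k * L2_fun_norm (g l))"
    using * by (intro sum_mono) blast
  finally show "L2_fun_norm (\<lambda>y. \<Sum>l\<in>UNIV. g l y * F y $ l $ k) \<le> (\<Sum>l\<in>UNIV. c l k * L2_fun_norm (g l))" .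
qed

text \<open>Entry (j, l) of \<open>g\<close> contributes to the entries (j, k) of the product with
  weights at most \<open>c l k\<close>, hence altogether with the weight of row l; the rows of
  \<open>F\<close> count, not its columns.\<close>

lemma L2_triple_norm_mult_le:
  fixes F :: "real^'n \<Rightarrow> complex^'m^'m" and c :: "'m \<Rightarrow> 'm \<Rightarrow> real"
  assumes Fm: "F \<in> borel_measurable lebesgue"
    and F: "\<And>l k. AE y in lebesgue. norm (F y $ l $ k) \<le> c l k" and c: "\<And>l k. c l k \<ge> 0"
    and R: "\<And>l. (\<Sum>k\<in>UNIV. c l k) \<le> R" and g: "g \<in> L2_mat"
  shows "L2_triple_norm (\<lambda>y. g y ** F y) \<le> R * L2_triple_norm g"
proof -
  let ?n = "\<lambda>j l. L2_fun_norm (\<lambda>y. g y $ j $ l)"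
  have "L2_triple_norm (\<lambda>y. g y ** F y) \<le> (\<Sum>j\<in>UNIV. \<Sum>k\<in>UNIV. \<Sum>l\<in>UNIV. c l k * ?n j l)"
    unfolding L2_triple_norm_def matrix_mult_entry
    by (intro sum_mono L2_fun_norm_sum_mult_entry[OF Fm F c] L2_mat_entry g)
  also have "\<dots> = (\<Sum>j\<in>UNIV. \<Sum>l\<in>UNIV. (\<Sum>k\<in>UNIV. c l k) * ?n j l)"
    unfolding sum_distrib_right by (intro sum.cong refl sum.swap)
  also have "\<dots> \<le> (\<Sum>j\<in>UNIV. \<Sum>l\<in>UNIV. R * ?n j l)"
    by (intro sum_mono mult_right_mono R L2_fun_norm_nonneg)
  also have "\<dots> = R * L2_triple_norm g"
    by (simp add: L2_triple_norm_def sum_distrib_left)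
  finally show ?thesis .
qed

section \<open>Testing with matrices that have a single nonzero row\<close>

definition row_fun :: "'m \<Rightarrow> complex^'m \<Rightarrow> (real^'n \<Rightarrow> complex) \<Rightarrow> real^'n \<Rightarrow> complex^'m^'m" where
  "row_fun a v \<phi> x = (\<chi> j k. if j = a then v $ k * \<phi> x else 0)"

lemma row_fun_C0inf: "\<phi> \<in> C0inf \<Longrightarrow> row_fun a v \<phi> \<in> C0inf"
proof -
  assume \<phi>: "\<phi> \<in> C0inf"
  have "(\<lambda>x. if j = a then v $ k * \<phi> x else 0) \<in> C0inf" for j k
    using C0inf_bounded_linear[OF bounded_linear_mult_right \<phi>] by (cases "j = a") (simp_all add: C0inf_zero)
  then show ?thesis
    unfolding row_fun_def[abs_def] by (rule C0inf_matI)
qed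

lemma fourier_fun_mult: "fourier_fun (\<lambda>x. c * u x) y = c * fourier_fun u y"
  by (simp add: fourier_fun_def mult.left_commute[of _ c])

lemma row_fun_entry: "row_fun a v \<phi> x $ j $ k = (if j = a then v $ k * \<phi> x else 0)"
  by (simp add: row_fun_def)

lemma fourier_row_fun: "fourier (row_fun a v \<phi>) = row_fun a v (fourier_fun \<phi>)"
proof
  fix y
  have "fourier_fun (\<lambda>x. if j = a then v $ k * \<phi> x else 0) y = (if j = a then v $ k * fourier_fun \<phi> y else 0)" for j k
    by (simp add: fourier_fun_mult) (simp add: fourier_fun_def)
  then show "fourier (row_fun a v \<phi>) y = row_fun a v (fourier_fun \<phi>) y"
    by (simp add: fourier_def row_fun_def)
qed

lemma row_fun_mult_entry:
  "(row_fun a v \<psi> y ** A) $ j $ k = (if j = a then \<psi> y * (transpose A *v v) $ k else 0)"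
  by (simp add: matrix_mult_entry row_fun_entry matrix_vector_mult_def transpose_def sum_distrib_left ac_simps)

lemma L2_triple_norm_row_fun_axis: "L2_triple_norm (row_fun a (axis b 1) \<phi>) = L2_fun_norm \<phi>"
proof -
  have "L2_fun_norm (\<lambda>x. row_fun a (axis b 1) \<phi> x $ j $ k) = (if j = a then if k = b then L2_fun_norm \<phi> else 0 else 0)" for j k
    by (cases "j = a"; cases "k = b") (simp_all add: row_fun_entry axis_def L2_fun_norm_zero)
  then have "(\<Sum>k\<in>UNIV. L2_fun_norm (\<lambda>x. row_fun a (axis b 1) \<phi> x $ j $ k)) = (if j = a then L2_fun_norm \<phi> else 0)" for j
    by (cases "j = a") simp_all
  then show ?thesis by (simp add: L2_triple_norm_def)
qed

lemma transpose_mult_axis: "(transpose A *v axis a 1) $ b = (A $ a $ b :: complex)"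
  by (simp add: matrix_vector_mult_def transpose_def axis_def if_distrib cong: if_cong)

text \<open>The entry (a, b) of the product is the transform of \<open>\<phi>\<close> times the
  entry (a, b) of \<open>F\<close>, and \<open>N\<close> dominates it. The index \<open>a\<close>
  has two roles: it is the row carrying the test function, and its unit vector selects row
  \<open>a\<close> of \<open>F\<close>.\<close>

lemma AE_entry_le_if_norm_le:
  assumes N: "entrywise_norm N \<Phi>" and F: "multiplier_symbol F" and R: "R \<ge> 0"
    and bd: "\<And>\<phi>. \<phi> \<in> C0inf \<Longrightarrow>
      N (\<lambda>y. fourier (row_fun a (axis a 1) \<phi>) y ** F y) \<le> R * L2_fun_norm \<phi>"
  shows "AE y in lebesgue. norm (F y $ a $ b) \<le> R"
proof -
  have Fm: "F \<in> borel_measurable lebesgue" using F by (simp add: multiplier_symbol_def)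
  have [measurable]: "(\<lambda>y. F y $ j $ k) \<in> borel_measurable lebesgue" for j k
    using Fm by (simp add: borel_measurable_mat_iff)
  have "AE y in lebesgue. (norm (F y $ a $ b))\<^sup>2 \<le> R\<^sup>2"
  proof (rule AE_le_if_fourier_weighted_le)
    show "(\<lambda>y. (norm (F y $ a $ b))\<^sup>2) \<in> borel_measurable lebesgue"
      by measurable
    fix \<phi> :: "real^'a \<Rightarrow> complex" assume \<phi>: "\<phi> \<in> C0inf"
    let ?g = "\<lambda>y. fourier (row_fun a (axis a 1) \<phi>) y ** F y"
    have g: "?g \<in> L2_mat" by (rule multiplier_symbol_L2_mat[OF F row_fun_C0inf[OF \<phi>]])
    have entry: "?g y $ a $ b = fourier_fun \<phi> y * F y $ a $ b" for y
      by (simp add: fourier_row_fun row_fun_mult_entry transpose_mult_axis del: transpose_matrix_vector)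
    have "(\<integral>\<^sup>+y. ennreal ((norm (fourier_fun \<phi> y))\<^sup>2 * (norm (F y $ a $ b))\<^sup>2) \<partial>lebesgue) =
        ennreal ((L2_fun_norm (\<lambda>y. ?g y $ a $ b))\<^sup>2)"
      using nn_integral_L2_fun[OF L2_mat_entry[OF g, of a b]] by (simp add: entry norm_mult power_mult_distrib)
    also have "\<dots> \<le> ennreal ((R * L2_fun_norm \<phi>)\<^sup>2)"
      by (intro ennreal_leI power_mono L2_fun_norm_nonneg order_trans[OF entry_le_entrywise_norm[OF N g] bd[OF \<phi>]])
    finally show "(\<integral>\<^sup>+y. ennreal ((norm (fourier_fun \<phi> y))\<^sup>2 * (norm (F y $ a $ b))\<^sup>2) \<partial>lebesgue) \<le>
        ennreal (R\<^sup>2 * (L2_fun_norm \<phi>)\<^sup>2)"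
      by (simp add: power_mult_distrib)
  qed auto
  then show ?thesis
    by eventually_elim (use R power2_le_imp_le in blast)
qed

text \<open>For each fixed v the weight |F^T v|^2 is bounded outside a null set depending on v. A
  countable dense set of vectors leaves one null set, and off it continuity in v gives all
  vectors.\<close>

lemma AE_mat_opnorm_le_if_HS_norm_le:
  fixes F :: "real^'n \<Rightarrow> complex^'m^'m"
  assumes F: "multiplier_symbol F" and R: "R \<ge> 0"
    and bd: "\<And>f. f \<in> C0inf \<Longrightarrow> L2_HS_norm (\<lambda>y. fourier f y ** F y) \<le> R * L2_HS_norm f"
  shows "AE y in lebesgue. mat_opnorm (F y) \<le> R"
proof -
  have Fm: "F \<in> borel_measurable lebesgue" using F by (simp add: multiplier_symbol_def)
  have [measurable]: "(\<lambda>y. F y $ j $ k) \<in> borel_measurable lebesgue" for j k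
    using Fm by (simp add: borel_measurable_mat_iff)
  \<comment> \<open>Any row index serves.\<close>
  define a :: 'm where "a = undefined"
  have v: "AE y in lebesgue. norm (transpose (F y) *v v) \<le> R * norm v" for v
  proof -
    have wm: "(\<lambda>y. (norm (transpose (F y) *v v))\<^sup>2) \<in> borel_measurable lebesgue"
      unfolding norm_vec_power2 by (simp add: matrix_vector_mult_def transpose_def)
    \<comment> \<open>Used twice: for the transformed product, with the vector F^T v depending on
      the point, and for the test function itself, with the constant vector v.\<close>
    have HS: "L2_HS_norm h = sqrt (LINT y|lebesgue. (norm (\<psi> y))\<^sup>2 * (norm (w y))\<^sup>2)"
      if "\<And>y j k. h y $ j $ k = (if j = a then \<psi> y * w y $ k else 0)" for h :: "real^'n \<Rightarrow> complex^'m^'m" and \<psi> and w :: "real^'n \<Rightarrow> complex^'m"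
    proof -
      have "(\<Sum>j\<in>UNIV. \<Sum>k\<in>UNIV. (norm (h y $ j $ k))\<^sup>2) = (\<Sum>j\<in>UNIV. if j = a then (\<Sum>k\<in>UNIV. (norm (\<psi> y * w y $ k))\<^sup>2) else 0)" for y
        unfolding that by (intro sum.cong) auto
      then have "(\<Sum>j\<in>UNIV. \<Sum>k\<in>UNIV. (norm (h y $ j $ k))\<^sup>2) = (norm (\<psi> y))\<^sup>2 * (norm (w y))\<^sup>2" for y
        by (simp add: norm_mult power_mult_distrib norm_vec_power2 sum_distrib_left)
      then show ?thesis by (simp add: L2_HS_norm_def)
    qed
    have "AE y in lebesgue. (norm (transpose (F y) *v v))\<^sup>2 \<le> (R * norm v)\<^sup>2"
    proof (rule AE_le_if_fourier_weighted_le[OF wm])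
      fix \<phi> :: "real^'n \<Rightarrow> complex" assume \<phi>: "\<phi> \<in> C0inf"
      let ?f = "row_fun a v \<phi>"
      let ?g = "\<lambda>y. fourier ?f y ** F y"
      have g: "?g \<in> L2_mat" by (rule multiplier_symbol_L2_mat[OF F row_fun_C0inf[OF \<phi>]])
      have entry: "?g y $ j $ k = (if j = a then fourier_fun \<phi> y * (transpose (F y) *v v) $ k else 0)" for y j k
        by (simp add: fourier_row_fun row_fun_mult_entry)
      have int: "integrable lebesgue (\<lambda>y. (norm (fourier_fun \<phi> y))\<^sup>2 * (norm (transpose (F y) *v v))\<^sup>2)"
      proof -
        have "integrable lebesgue (\<lambda>y. \<Sum>k\<in>UNIV. (norm (?g y $ a $ k))\<^sup>2)"
          by (intro Bochner_Integration.integrable_sum L2_fun_integrable L2_mat_entry g)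
        then show ?thesis
          by (simp add: entry norm_mult power_mult_distrib norm_vec_power2 sum_distrib_left)
      qed
      have "L2_HS_norm ?g = sqrt (LINT y|lebesgue. (norm (fourier_fun \<phi> y))\<^sup>2 * (norm (transpose (F y) *v v))\<^sup>2)"
        by (rule HS) (rule entry)
      then have "(LINT y|lebesgue. (norm (fourier_fun \<phi> y))\<^sup>2 * (norm (transpose (F y) *v v))\<^sup>2) = (L2_HS_norm ?g)\<^sup>2"
        by simp
      also have "\<dots> \<le> (R * L2_HS_norm ?f)\<^sup>2"
        by (intro power_mono bd row_fun_C0inf \<phi>) (simp add: L2_HS_norm_def sum_nonneg)
      also have "L2_HS_norm ?f = sqrt (LINT x|lebesgue. (norm (\<phi> x))\<^sup>2 * (norm v)\<^sup>2)"
        by (rule HS) (simp add: row_fun_entry)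
      also have "\<dots> = L2_fun_norm \<phi> * norm v"
        by (simp add: L2_fun_norm_def real_sqrt_mult)
      finally have le: "(LINT y|lebesgue. (norm (fourier_fun \<phi> y))\<^sup>2 * (norm (transpose (F y) *v v))\<^sup>2) \<le> (R * norm v)\<^sup>2 * (L2_fun_norm \<phi>)\<^sup>2"
        by (simp add: power_mult_distrib ac_simps)
      have "(\<integral>\<^sup>+y. ennreal ((norm (fourier_fun \<phi> y))\<^sup>2 * (norm (transpose (F y) *v v))\<^sup>2) \<partial>lebesgue) =
          ennreal (LINT y|lebesgue. (norm (fourier_fun \<phi> y))\<^sup>2 * (norm (transpose (F y) *v v))\<^sup>2)"
        by (intro nn_integral_eq_integral int AE_I2) simp
      with le show "(\<integral>\<^sup>+y. ennreal ((norm (fourier_fun \<phi> y))\<^sup>2 * (norm (transpose (F y) *v v))\<^sup>2) \<partial>lebesgue)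
          \<le> ennreal ((R * norm v)\<^sup>2 * (L2_fun_norm \<phi>)\<^sup>2)"
        by (simp add: ennreal_leI)
    qed auto
    then show ?thesis
    proof eventually_elim
      case (elim y)
      then show ?case using R by (intro power2_le_imp_le[OF elim]) simp
    qed
  qed
  obtain D :: "(complex^'m) set" where D: "countable D" "\<And>X. open X \<Longrightarrow> X \<noteq> {} \<Longrightarrow> \<exists>d\<in>D. d \<in> X"
    using countable_dense_exists by blast
  have "AE y in lebesgue. \<forall>v\<in>D. norm (transpose (F y) *v v) \<le> R * norm v"
    using v D(1) by (simp add: AE_ball_countable)
  then show ?thesis
  proof eventually_elim
    case (elim y)
    let ?S = "{v. norm (transpose (F y) *v v) \<le> R * norm v}"
    have "closed ?S"
      by (intro closed_Collect_le continuous_intros linear_continuous_on[OF matrix_vector_mul_bounded_linear])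
    then have "open (- ?S)" by (simp add: open_Compl)
    then have "- ?S = {}" using D(2)[of "- ?S"] elim by blast
    then have "norm (transpose (F y) *v v) \<le> R * norm v" for v by blast
    then show ?case using mat_opnorm_le mat_opnorm_transpose by metis
  qed
qed

text \<open>The extension is given by the same formula with the extended transform, which makes
  sense for every L2 function. Since transforms are chosen representatives, linearity holds almost
  everywhere. Only finiteness of the bound matters, so the entries are added crudely, with the
  constant m^3 C.\<close>

lemma bounded_extension_exists:
  fixes F :: "real^'n \<Rightarrow> complex^'m^'m"
  assumes Fm: "F \<in> borel_measurable lebesgue" and C: "C \<ge> 0"
    and F: "\<And>l k. AE y in lebesgue. norm (F y $ l $ k) \<le> C"
  shows "\<exists>T. bounded_extension F T"
proof -
  define g where "g f j k y = (\<Sum>l\<in>UNIV. L2_fourier_fun (\<lambda>x. f x $ j $ l) y * F y $ l $ k)"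
    for f :: "real^'n \<Rightarrow> complex^'m^'m" and j k y
  define T where "T f x = (\<chi> j k. L2_inv_fourier_fun (g f j k) x)" for f x
  have g: "g f j k \<in> L2_fun" "L2_fun_norm (g f j k) \<le> (\<Sum>l\<in>UNIV. C * L2_fun_norm (\<lambda>x. f x $ j $ l))"
    if "f \<in> L2_mat" for f j k
    using L2_fun_sum_mult_entry[OF Fm F C L2_fourier_fun_L2[OF L2_mat_entry[OF that]]]
      L2_fun_norm_sum_mult_entry[OF Fm F C L2_fourier_fun_L2[OF L2_mat_entry[OF that]]]
    unfolding g_def[abs_def] by (auto simp: L2_fourier_fun_norm[OF L2_mat_entry[OF that]])
  have T_entry: "T f x $ j $ k = L2_inv_fourier_fun (g f j k) x" for f x j k
    by (simp add: T_def)
  have T_L2: "T f \<in> L2_mat" if "f \<in> L2_mat" for f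
    by (intro L2_matI) (simp add: T_entry L2_inv_fourier_fun_L2 g[OF that])
  have eqI: "AE x in lebesgue. A x = B x" if "\<And>j k. AE x in lebesgue. A x $ j $ k = B x $ j $ k"
    for A B :: "real^'n \<Rightarrow> complex^'m^'m"
  proof -
    have "AE x in lebesgue. \<forall>j k. A x $ j $ k = B x $ j $ k"
      by (intro eventually_all_finite that)
    then show ?thesis by eventually_elim (simp add: vec_eq_iff)
  qed
  have "bounded_L2_operator T"
    unfolding bounded_L2_operator_def
  proof (intro conjI ballI allI)
    fix f h :: "real^'n \<Rightarrow> complex^'m^'m" assume f: "f \<in> L2_mat" and h: "h \<in> L2_mat"
    have fh: "(\<lambda>y. f y + h y) \<in> L2_mat" using f h by (intro L2_matI) (simp add: L2_fun_add L2_mat_entry)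
    show "AE x in lebesgue. T (\<lambda>y. f y + h y) x = T f x + T h x"
    proof (rule eqI)
      fix j k
      have "AE y in lebesgue. \<forall>l. L2_fourier_fun (\<lambda>x. f x $ j $ l + h x $ j $ l) y =
          L2_fourier_fun (\<lambda>x. f x $ j $ l) y + L2_fourier_fun (\<lambda>x. h x $ j $ l) y"
        by (intro eventually_all_finite L2_fourier_fun_add L2_mat_entry f h)
      then have "AE y in lebesgue. g (\<lambda>y. f y + h y) j k y = g f j k y + g h j k y"
        by eventually_elim (simp add: g_def distrib_right sum.distrib)
      from L2_inv_fourier_fun_cong_AE[OF g(1)[OF fh] L2_fun_add[OF g(1)[OF f] g(1)[OF h]] this]
        L2_inv_fourier_fun_add[OF g(1)[OF f, of j k] g(1)[OF h, of j k]]
      show "AE x in lebesgue. T (\<lambda>y. f y + h y) x $ j $ k = (T f x + T h x) $ j $ k"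
        by eventually_elim (simp add: T_entry)
    qed
  next
    fix c and f :: "real^'n \<Rightarrow> complex^'m^'m" assume f: "f \<in> L2_mat"
    show "AE x in lebesgue. T (\<lambda>y. mat_scale c (f y)) x = mat_scale c (T f x)"
    proof (rule eqI)
      fix j k
      have "AE y in lebesgue. \<forall>l. L2_fourier_fun (\<lambda>x. c * f x $ j $ l) y = c * L2_fourier_fun (\<lambda>x. f x $ j $ l) y"
        by (intro eventually_all_finite L2_fourier_fun_mult L2_mat_entry f)
      then have "AE y in lebesgue. g (\<lambda>y. mat_scale c (f y)) j k y = c * g f j k y"
        by eventually_elim (simp add: g_def mat_scale_def sum_distrib_left mult.assoc)
      from L2_inv_fourier_fun_cong_AE[OF g(1)[OF L2_mat_scale[OF f]] L2_fun_mult[OF g(1)[OF f]] this]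
        L2_inv_fourier_fun_mult[OF g(1)[OF f, of j k], of c]
      show "AE x in lebesgue. T (\<lambda>y. mat_scale c (f y)) x $ j $ k = mat_scale c (T f x) $ j $ k"
        by eventually_elim (simp add: T_entry mat_scale_def)
    qed
  next
    show "\<exists>K. \<forall>f\<in>L2_mat. L2_norm (T f) \<le> K * L2_norm f"
    proof (intro exI ballI)
      fix f :: "real^'n \<Rightarrow> complex^'m^'m" assume f: "f \<in> L2_mat"
      have "L2_norm (T f) \<le> (\<Sum>j\<in>UNIV. \<Sum>k\<in>UNIV. L2_fun_norm (\<lambda>x. T f x $ j $ k))"
        by (rule L2_norm_le[OF L2_mat_entry[OF T_L2[OF f]]])
      also have "\<dots> \<le> (\<Sum>j\<in>(UNIV :: 'm set). \<Sum>k\<in>(UNIV :: 'm set). \<Sum>l\<in>(UNIV :: 'm set). C * L2_norm f)"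
      proof (intro sum_mono)
        fix j k
        have "L2_fun_norm (\<lambda>x. T f x $ j $ k) = L2_fun_norm (g f j k)"
          by (simp add: T_entry L2_inv_fourier_fun_norm[OF g(1)[OF f]])
        also have "\<dots> \<le> (\<Sum>l\<in>UNIV. C * L2_fun_norm (\<lambda>x. f x $ j $ l))" by (rule g(2)[OF f])
        also have "\<dots> \<le> (\<Sum>l\<in>(UNIV :: 'm set). C * L2_norm f)"
          by (intro sum_mono mult_left_mono L2_fun_norm_entry_le f C)
        finally show "L2_fun_norm (\<lambda>x. T f x $ j $ k) \<le> (\<Sum>l\<in>(UNIV :: 'm set). C * L2_norm f)" .
      qed
      also have "\<dots> = (\<Sum>j\<in>(UNIV :: 'm set). \<Sum>k\<in>(UNIV :: 'm set). \<Sum>l\<in>(UNIV :: 'm set). C) * L2_norm f"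
        by (simp add: sum_distrib_right)
      finally show "L2_norm (T f) \<le> (\<Sum>j\<in>(UNIV :: 'm set). \<Sum>k\<in>(UNIV :: 'm set). \<Sum>l\<in>(UNIV :: 'm set). C) * L2_norm f" .
    qed
  qed (rule T_L2)
  moreover have "AE x in lebesgue. T f x = multiplier F f x" if f: "f \<in> C0inf" for f
  proof (rule eqI)
    fix j k
    have fL: "f \<in> L2_mat" using f by (rule C0inf_L2_mat)
    have "AE y in lebesgue. \<forall>l. L2_fourier_fun (\<lambda>x. f x $ j $ l) y = fourier_fun (\<lambda>x. f x $ j $ l) y"
      by (intro eventually_all_finite L2_fourier_fun_L12 C0inf_L12 C0inf_entry f)
    then have AE: "AE y in lebesgue. g f j k y = (fourier f y ** F y) $ j $ k"
      by eventually_elim (simp add: g_def matrix_mult_entry fourier_entry)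
    have "(\<lambda>y. (fourier f y ** F y) $ j $ k) \<in> L2_fun"
      unfolding matrix_mult_entry by (rule L2_fun_sum_mult_entry[OF Fm F C L2_mat_entry[OF fourier_L2_mat[OF f]]])
    from L2_inv_fourier_fun_cong_AE[OF g(1)[OF fL] this AE]
    show "AE x in lebesgue. T f x $ j $ k = multiplier F f x $ j $ k"
      by (simp add: T_entry multiplier_entry)
  qed
  ultimately show ?thesis
    by (auto simp: bounded_extension_def)
qed

section \<open>The multiplier theorem\<close>

text \<open>Lets each claim about an essential supremum be settled as an almost everywhere bound by
  a real number.\<close>

lemma esssup_ereal_le_iff:
  assumes "g \<in> borel_measurable M"
  shows "esssup M (\<lambda>x. ereal (g x)) \<le> ereal R \<longleftrightarrow> (AE x in M. g x \<le> R)"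
proof
  assume le: "esssup M (\<lambda>x. ereal (g x)) \<le> ereal R"
  show "AE x in M. g x \<le> R"
    using esssup_AE[of "\<lambda>x. ereal (g x)" M]
  proof eventually_elim
    case (elim x)
    then have "ereal (g x) \<le> ereal R" using le by (rule order_trans)
    then show ?case by simp
  qed
next
  assume "AE x in M. g x \<le> R"
  then show "esssup M (\<lambda>x. ereal (g x)) \<le> ereal R"
    using assms by (intro esssup_I) auto
qed

text \<open>The essential supremum over a null measure would be minus infinity; here the measure is
  not null, so an inequality that holds almost everywhere holds at some point.\<close>

lemma esssup_lebesgue_ereal_nonneg:
  assumes "\<And>x. g x \<ge> 0"
  shows "0 \<le> esssup (lebesgue :: 'a::euclidean_space measure) (\<lambda>x. ereal (g x))"
proof -
  have "ae_filter (lebesgue :: 'a measure) \<noteq> bot"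
    by (simp add: ae_filter_eq_bot_iff emeasure_lborel_UNIV)
  moreover have "AE x::'a in lebesgue. 0 \<le> esssup lebesgue (\<lambda>x. ereal (g x))"
    using esssup_AE[of "\<lambda>x. ereal (g x)" lebesgue]
  proof eventually_elim
    case (elim x)
    have "0 \<le> ereal (g x)" using assms by simp
    then show ?case using elim by (rule order_trans)
  qed
  ultimately show ?thesis
    using eventually_happens' by blast
qed

lemma Linf_triple_norm_le_iff:
  fixes F :: "real^'n \<Rightarrow> complex^'m^'m"
  assumes "F \<in> borel_measurable lebesgue"
  shows "Linf_triple_norm F \<le> ereal R \<longleftrightarrow> (\<forall>j k. AE x in lebesgue. norm (F x $ j $ k) \<le> R)"
proof -
  have [measurable]: "(\<lambda>x. F x $ j $ k) \<in> borel_measurable lebesgue" for j k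
    using assms by (simp add: borel_measurable_mat_iff)
  have eq: "{Linf_fun_norm (\<lambda>x. F x $ j $ k) | j k. True} = (\<lambda>(j, k). Linf_fun_norm (\<lambda>x. F x $ j $ k)) ` UNIV"
    by auto
  have "Linf_fun_norm (\<lambda>x. F x $ j $ k) \<le> ereal R \<longleftrightarrow> (AE x in lebesgue. norm (F x $ j $ k) \<le> R)" for j k
    unfolding Linf_fun_norm_def by (rule esssup_ereal_le_iff) measurable
  then show ?thesis
    unfolding Linf_triple_norm_def eq by (subst Max_le_iff) auto
qed

lemma Linf_triple_norm_nonneg:
  fixes F :: "real^'n \<Rightarrow> complex^'m^'m"
  shows "0 \<le> Linf_triple_norm F"
proof -
  have eq: "{Linf_fun_norm (\<lambda>x. F x $ j $ k) | j k. True} = (\<lambda>(j, k). Linf_fun_norm (\<lambda>x. F x $ j $ k)) ` UNIV"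
    by auto
  have "0 \<le> Linf_fun_norm (\<lambda>x. F x $ undefined $ undefined)"
    unfolding Linf_fun_norm_def by (rule esssup_lebesgue_ereal_nonneg) simp
  also have "\<dots> \<le> Linf_triple_norm F"
    unfolding Linf_triple_norm_def eq by (rule Max_ge) auto
  finally show ?thesis .
qed

lemma Linf_triple_norm_const_eq_1:
  fixes A :: "complex^'m^'m"
  assumes "\<And>j k. norm (A $ j $ k) \<le> 1" "norm (A $ a $ b) = 1"
  shows "Linf_triple_norm (\<lambda>x::real^'n. A) = 1"
proof (rule antisym)
  show "Linf_triple_norm (\<lambda>x::real^'n. A) \<le> 1"
    unfolding one_ereal_def by (subst Linf_triple_norm_le_iff) (use assms(1) in auto)
  have eq: "{Linf_fun_norm (\<lambda>x::real^'n. A $ j $ k) | j k. True} = (\<lambda>(j, k). Linf_fun_norm (\<lambda>x::real^'n. A $ j $ k)) ` UNIV"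
    by auto
  have "1 = Linf_fun_norm (\<lambda>x::real^'n. A $ a $ b)"
    unfolding Linf_fun_norm_def assms(2) by (subst esssup_const) (auto simp: emeasure_lborel_UNIV)
  also have "\<dots> \<le> Linf_triple_norm (\<lambda>x::real^'n. A)"
    unfolding Linf_triple_norm_def eq by (rule Max_ge) auto
  finally show "1 \<le> Linf_triple_norm (\<lambda>x::real^'n. A)" .
qed

lemma L2_operator_norm_nonneg:
  assumes "entrywise_norm N \<Phi>" "bounded_L2_operator T"
  shows "0 \<le> L2_operator_norm N T"
proof -
  have 0: "(\<lambda>_. 0) \<in> L2_mat" by (intro L2_matI) (simp add: L2_fun_zero)
  then have "N (\<lambda>_. 0) = 0 * N (\<lambda>_. 0)"
    by (intro entrywise_norm_scale[OF assms(1)]) (simp_all add: L2_fun_norm_zero)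
  then have "ereal (N (T (\<lambda>_. 0))) \<le> L2_operator_norm N T"
    unfolding L2_operator_norm_def using 0 by (intro SUP_upper) simp
  moreover have "0 \<le> N (T (\<lambda>_. 0))"
    by (rule entrywise_norm_nonneg[OF assms(1) bounded_L2_operator_L2[OF assms(2) 0]])
  ultimately show ?thesis
    using order_trans by (metis ereal_less_eq(5))
qed

lemma multiplier_symbol_const: "multiplier_symbol (\<lambda>x::real^'n. A :: complex^'m^'m)"
  unfolding multiplier_symbol_def
proof (intro conjI ballI)
  fix f :: "real^'n \<Rightarrow> complex^'m^'m" assume f: "f \<in> C0inf"
  show "(\<lambda>y. fourier f y ** A) \<in> L2_mat"
  proof (rule L2_matI)
    fix j k
    have "(\<lambda>y. \<Sum>l\<in>UNIV. A $ l $ k * fourier f y $ j $ l) \<in> L2_fun"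
      by (intro L2_fun_sum L2_fun_mult L2_mat_entry fourier_L2_mat f)
    then show "(\<lambda>y. (fourier f y ** A) $ j $ k) \<in> L2_fun"
      by (simp add: matrix_mult_entry mult.commute)
  qed
qed simp

lemma bounded_extension_const:
  obtains T where "bounded_extension (\<lambda>x::real^'n. A :: complex^'m^'m) T"
proof -
  have "norm (A $ l $ k) \<le> mat_opnorm A" for l k by (rule norm_entry_le_mat_opnorm)
  then have "\<exists>T. bounded_extension (\<lambda>x::real^'n. A) T"
    by (intro bounded_extension_exists[OF _ mat_opnorm_nonneg[of A]]) auto
  then show ?thesis using that by blast
qed

text \<open>Test functions approximating the indicator of a ball have norms tending to a positive
  number.\<close>

lemma ex_C0inf_pos_norm: obtains \<phi> :: "real^'n \<Rightarrow> complex" where "\<phi> \<in> C0inf" "L2_fun_norm \<phi> > 0"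
proof -
  let ?B = "ball (0 :: real^'n) 1"
  obtain \<phi> where \<phi>: "\<forall>i. \<phi> i \<in> C0inf" "L2_tendsto \<phi> (indicator ?B)"
    using C0inf_approx_indicator[OF lmeasurable_ball[of "0 :: real^'n" 1]] by (auto simp: C0inf_approx_def)
  have "L2_fun_norm (indicator ?B) > 0"
    unfolding L2_fun_indicator(2)[OF lmeasurable_ball] using content_ball_pos[of 1 "0 :: real^'n"]
    by simp
  then have "\<forall>\<^sub>F i in sequentially. L2_fun_norm (\<phi> i) > 0"
    by (rule order_tendstoD(1)[OF L2_tendsto_norm[OF \<phi>(2)]])
  then obtain i where "L2_fun_norm (\<phi> i) > 0"
    by (auto simp: eventually_sequentially)
  with \<phi>(1) that show ?thesis by blast
qed

text \<open>Boundedness is given for \<open>L2_norm\<close>, whereas testing requires a norm of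
  entry norms. Comparing the two costs a factor m^2, harmless since only the existence of a bound is
  claimed; |K| appears because the sign of \<open>K\<close> is unspecified.\<close>

lemma bounded_extension_imp_AE_entry_le:
  fixes F :: "real^'n \<Rightarrow> complex^'m^'m"
  assumes F: "multiplier_symbol F" and T: "bounded_extension F T"
  shows "\<exists>C\<ge>0. \<forall>j k. AE x in lebesgue. norm (F x $ j $ k) \<le> C"
proof -
  have bT: "bounded_L2_operator T" using T by (simp add: bounded_extension_def)
  then obtain K where K: "\<And>f. f \<in> L2_mat \<Longrightarrow> L2_norm (T f) \<le> K * L2_norm f"
    unfolding bounded_L2_operator_def by blast
  define C where "C = real (CARD('m)) * (real (CARD('m)) * \<bar>K\<bar>)"
  have C: "C \<ge> 0" by (simp add: C_def)
  have "AE x in lebesgue. norm (F x $ a $ b) \<le> C" for a b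
  proof (rule AE_entry_le_if_norm_le[OF entrywise_norm_triple F C])
    fix \<phi> :: "real^'n \<Rightarrow> complex" assume \<phi>: "\<phi> \<in> C0inf"
    let ?f = "row_fun a (axis a 1) \<phi>"
    have f: "?f \<in> C0inf" "?f \<in> L2_mat" using row_fun_C0inf[OF \<phi>] C0inf_L2_mat by auto
    have "L2_triple_norm (\<lambda>y. fourier ?f y ** F y) = L2_triple_norm (T ?f)"
      by (rule bounded_extension_norm[OF entrywise_norm_triple F T f(1), symmetric])
    also have "\<dots> \<le> (\<Sum>j\<in>(UNIV :: 'm set). \<Sum>k\<in>(UNIV :: 'm set). \<bar>K\<bar> * L2_fun_norm \<phi>)"
      unfolding L2_triple_norm_def
    proof (intro sum_mono)
      fix j k
      have "L2_fun_norm (\<lambda>x. T ?f x $ j $ k) \<le> L2_norm (T ?f)"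
        by (rule L2_fun_norm_entry_le[OF bounded_L2_operator_L2[OF bT f(2)]])
      also have "\<dots> \<le> K * L2_norm ?f" by (rule K[OF f(2)])
      also have "\<dots> \<le> \<bar>K\<bar> * L2_norm ?f" by (intro mult_right_mono) (auto simp: L2_norm_def)
      also have "\<dots> \<le> \<bar>K\<bar> * L2_triple_norm ?f"
        unfolding L2_triple_norm_def by (intro mult_left_mono L2_norm_le L2_mat_entry f) auto
      finally show "L2_fun_norm (\<lambda>x. T ?f x $ j $ k) \<le> \<bar>K\<bar> * L2_fun_norm \<phi>"
        by (simp add: L2_triple_norm_row_fun_axis)
    qed
    also have "\<dots> = C * L2_fun_norm \<phi>" by (simp add: C_def)
    finally show "L2_triple_norm (\<lambda>y. fourier ?f y ** F y) \<le> C * L2_fun_norm \<phi>" .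
  qed
  with C show ?thesis by blast
qed

lemma Linf_norm_less_top_iff:
  fixes F :: "real^'n \<Rightarrow> complex^'m^'m"
  assumes F: "F \<in> borel_measurable lebesgue"
  shows "Linf_norm F < \<infinity> \<longleftrightarrow> (\<exists>C\<ge>0. \<forall>j k. AE x in lebesgue. norm (F x $ j $ k) \<le> C)"
proof
  assume "Linf_norm F < \<infinity>"
  then obtain C where C: "Linf_norm F = ereal C" "C \<ge> 0"
    using esssup_lebesgue_ereal_nonneg[of "\<lambda>x. mat_opnorm (F x)"] mat_opnorm_nonneg
    by (cases "Linf_norm F") (auto simp: Linf_norm_def)
  then have "AE x in lebesgue. mat_opnorm (F x) \<le> C"
    unfolding Linf_norm_def using esssup_ereal_le_iff[OF borel_measurable_mat_opnorm[OF F]] by (metis order_refl)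
  then have "AE x in lebesgue. norm (F x $ j $ k) \<le> C" for j k
    by eventually_elim (rule order_trans[OF norm_entry_le_mat_opnorm])
  with C(2) show "\<exists>C\<ge>0. \<forall>j k. AE x in lebesgue. norm (F x $ j $ k) \<le> C" by blast
next
  assume "\<exists>C\<ge>0. \<forall>j k. AE x in lebesgue. norm (F x $ j $ k) \<le> C"
  then obtain C where "\<And>j k. AE x in lebesgue. norm (F x $ j $ k) \<le> C" by blast
  then have "AE x in lebesgue. \<forall>j k. norm (F x $ j $ k) \<le> C"
    by (intro eventually_all_finite)
  then have "AE x in lebesgue. mat_opnorm (F x) \<le> (\<Sum>j\<in>(UNIV :: 'm set). \<Sum>k\<in>(UNIV :: 'm set). C)"
    by eventually_elim (intro order_trans[OF mat_opnorm_le_sum] sum_mono, blast)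
  then have "Linf_norm F \<le> ereal (\<Sum>j\<in>(UNIV :: 'm set). \<Sum>k\<in>(UNIV :: 'm set). C)"
    unfolding Linf_norm_def by (subst esssup_ereal_le_iff[OF borel_measurable_mat_opnorm[OF F]])
  then show "Linf_norm F < \<infinity>" by (rule le_less_trans) simp
qed

lemma bounded_extension_iff:
  fixes F :: "real^'n \<Rightarrow> complex^'m^'m"
  assumes F: "multiplier_symbol F"
  shows "(\<exists>T. bounded_extension F T) \<longleftrightarrow> F \<in> Linf_mat"
proof -
  have Fm: "F \<in> borel_measurable lebesgue" using F by (simp add: multiplier_symbol_def)
  then have iff: "F \<in> Linf_mat \<longleftrightarrow> (\<exists>C\<ge>0. \<forall>j k. AE x in lebesgue. norm (F x $ j $ k) \<le> C)"
    unfolding Linf_mat_def using Linf_norm_less_top_iff[OF Fm] by blast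
  show ?thesis
  proof
    assume "\<exists>T. bounded_extension F T"
    then obtain T where "bounded_extension F T" ..
    from bounded_extension_imp_AE_entry_le[OF F this] show "F \<in> Linf_mat"
      unfolding iff .
  next
    assume "F \<in> Linf_mat"
    then obtain C where "C \<ge> 0" "\<forall>j k. AE x in lebesgue. norm (F x $ j $ k) \<le> C"
      unfolding iff by blast
    then show "\<exists>T. bounded_extension F T"
      by (intro bounded_extension_exists[OF Fm]) auto
  qed
qed

text \<open>Both inequalities compare with real bounds, so finiteness of the essential supremum
  comes first. The upper bound then makes the operator norm a real number, and with this number the
  test by single rows gives the lower bound.\<close>

lemma bounded_extension_HS_norm:
  fixes F :: "real^'n \<Rightarrow> complex^'m^'m"
  assumes F: "multiplier_symbol F" and T: "bounded_extension F T"
  shows "L2_operator_norm L2_HS_norm T = esssup lebesgue (\<lambda>x. ereal (mat_opnorm (F x)))" (is "?P = ?S")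
proof -
  have Fm: "F \<in> borel_measurable lebesgue" using F by (simp add: multiplier_symbol_def)
  have bT: "bounded_L2_operator T" using T by (simp add: bounded_extension_def)
  note S_iff = esssup_ereal_le_iff[OF borel_measurable_mat_opnorm[OF Fm]]
  have "F \<in> Linf_mat" using F T bounded_extension_iff by blast
  then have "?S < \<infinity>" by (simp add: Linf_mat_def Linf_norm_def)
  moreover have "0 \<le> ?S" by (rule esssup_lebesgue_ereal_nonneg[OF mat_opnorm_nonneg])
  ultimately obtain C where C: "?S = ereal C" "C \<ge> 0" by (cases ?S) auto
  then have AE: "AE x in lebesgue. mat_opnorm (F x) \<le> C" using S_iff[of C] by simp
  have P: "?P \<le> ?S"
    unfolding C(1) by (intro bounded_extension_norm_le[OF entrywise_norm_HS F T C(2)] L2_HS_norm_mult_le C(2) AE)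
  then obtain R where R: "?P = ereal R" "R \<ge> 0"
    using L2_operator_norm_nonneg[OF entrywise_norm_HS bT] C(1) by (cases ?P) auto
  have "AE y in lebesgue. mat_opnorm (F y) \<le> R"
  proof (rule AE_mat_opnorm_le_if_HS_norm_le[OF F R(2)])
    fix f :: "real^'n \<Rightarrow> complex^'m^'m" assume f: "f \<in> C0inf"
    show "L2_HS_norm (\<lambda>y. fourier f y ** F y) \<le> R * L2_HS_norm f"
      using L2_operator_norm_leD[OF entrywise_norm_HS bT eq_refl[OF R(1)] C0inf_L2_mat[OF f]]
      unfolding bounded_extension_norm[OF entrywise_norm_HS F T f] .
  qed
  then have "?S \<le> ?P" unfolding R(1) by (simp only: S_iff)
  with P show ?thesis by (rule antisym)
qed

text \<open>A test function with the single entry \<open>\<phi>\<close> has the triple norm of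
  \<open>\<phi>\<close>, and one entry of the image is at most the triple norm of the image, so no
  constant is lost.\<close>

lemma bounded_extension_triple_norm_ge:
  fixes F :: "real^'n \<Rightarrow> complex^'m^'m"
  assumes F: "multiplier_symbol F" and T: "bounded_extension F T"
  shows "Linf_triple_norm F \<le> L2_operator_norm L2_triple_norm T" (is "_ \<le> ?P")
proof (cases "?P = \<infinity>")
  case False
  have Fm: "F \<in> borel_measurable lebesgue" using F by (simp add: multiplier_symbol_def)
  have bT: "bounded_L2_operator T" using T by (simp add: bounded_extension_def)
  obtain R where R: "?P = ereal R" "R \<ge> 0"
    using L2_operator_norm_nonneg[OF entrywise_norm_triple bT] False by (cases ?P) auto
  have "AE y in lebesgue. norm (F y $ a $ b) \<le> R" for a b
  proof (rule AE_entry_le_if_norm_le[OF entrywise_norm_triple F R(2)])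
    fix \<phi> :: "real^'n \<Rightarrow> complex" assume \<phi>: "\<phi> \<in> C0inf"
    show "L2_triple_norm (\<lambda>y. fourier (row_fun a (axis a 1) \<phi>) y ** F y) \<le> R * L2_fun_norm \<phi>"
      using L2_operator_norm_leD[OF entrywise_norm_triple bT eq_refl[OF R(1)]
          C0inf_L2_mat[OF row_fun_C0inf[OF \<phi>, of a "axis a 1"]]]
      unfolding bounded_extension_norm[OF entrywise_norm_triple F T row_fun_C0inf[OF \<phi>]] L2_triple_norm_row_fun_axis .
  qed
  then show ?thesis
    unfolding R(1) by (simp only: Linf_triple_norm_le_iff[OF Fm]) blast
qed simp

lemma bounded_extension_triple_norm_le:
  fixes F :: "real^'n \<Rightarrow> complex^'m^'m"
  assumes F: "multiplier_symbol F" and T: "bounded_extension F T"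
    and c: "\<And>l k. AE y in lebesgue. norm (F y $ l $ k) \<le> c l k" "\<And>l k. c l k \<ge> 0"
    and R: "\<And>l. (\<Sum>k\<in>UNIV. c l k) \<le> R" "R \<ge> 0"
  shows "L2_operator_norm L2_triple_norm T \<le> ereal R"
  using F by (intro bounded_extension_norm_le[OF entrywise_norm_triple F T R(2)] L2_triple_norm_mult_le[OF _ c R(1)])
    (simp_all add: multiplier_symbol_def)

text \<open>The dimensions are types, fixed throughout the statement, so the sharpness clauses
  assert that the constants are best for every pair of dimensions and not only in the supremum over
  all of them.\<close>

theorem theorem4p6:
  shows "(\<forall>F :: real^'n \<Rightarrow> complex^'m^'m. multiplier_symbol F \<longrightarrow>
      ((\<exists>T. bounded_extension F T) \<longleftrightarrow> F \<in> Linf_mat) \<and>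
      ((\<exists>T. bounded_extension F T) \<or> F \<in> Linf_mat \<longrightarrow>
        (\<forall>T. bounded_extension F T \<longrightarrow>
          L2_operator_norm L2_HS_norm T = esssup lebesgue (\<lambda>x. ereal (mat_opnorm (F x))) \<and>
          esssup lebesgue (\<lambda>x. ereal (mat_opnorm (F x))) = Linf_norm F \<and>
          Linf_triple_norm F \<le> L2_operator_norm L2_triple_norm T \<and>
          L2_operator_norm L2_triple_norm T \<le> ereal (real CARD('m)) * Linf_triple_norm F))) \<and>
    (\<forall>c::real.
      (\<forall>(F :: real^'n \<Rightarrow> complex^'m^'m) T. multiplier_symbol F \<and> bounded_extension F T \<longrightarrow>
        ereal c * Linf_triple_norm F \<le> L2_operator_norm L2_triple_norm T) \<longrightarrow> c \<le> 1) \<and>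
    (\<forall>C::real.
      (\<forall>(F :: real^'n \<Rightarrow> complex^'m^'m) T. multiplier_symbol F \<and> bounded_extension F T \<longrightarrow>
        L2_operator_norm L2_triple_norm T \<le> ereal C * Linf_triple_norm F) \<longrightarrow> real CARD('m) \<le> C)"
proof (intro conjI allI impI)
  fix F :: "real^'n \<Rightarrow> complex^'m^'m" assume F: "multiplier_symbol F"
  show "(\<exists>T. bounded_extension F T) \<longleftrightarrow> F \<in> Linf_mat"
    by (rule bounded_extension_iff[OF F])
  fix T assume T: "bounded_extension F T"
  show "L2_operator_norm L2_HS_norm T = esssup lebesgue (\<lambda>x. ereal (mat_opnorm (F x)))"
    by (rule bounded_extension_HS_norm[OF F T])
  show "esssup lebesgue (\<lambda>x. ereal (mat_opnorm (F x))) = Linf_norm F"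
    by (simp add: Linf_norm_def)
  show "Linf_triple_norm F \<le> L2_operator_norm L2_triple_norm T"
    by (rule bounded_extension_triple_norm_ge[OF F T])
  have Fm: "F \<in> borel_measurable lebesgue" using F by (simp add: multiplier_symbol_def)
  obtain C where C: "\<And>j k. AE x in lebesgue. norm (F x $ j $ k) \<le> C"
    using bounded_extension_imp_AE_entry_le[OF F T] by blast
  have "Linf_triple_norm F \<le> ereal C"
    using C by (simp add: Linf_triple_norm_le_iff[OF Fm])
  then obtain M where M: "Linf_triple_norm F = ereal M" "M \<ge> 0"
    using Linf_triple_norm_nonneg[of F] by (cases "Linf_triple_norm F") auto
  have "AE y in lebesgue. norm (F y $ l $ k) \<le> M" for l k
    using Linf_triple_norm_le_iff[OF Fm, of M] M(1) by simp
  \<comment> \<open>With the same bound \<open>M\<close> for each entry, every row sum of bounds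
    equals m M.\<close>
  then have "L2_operator_norm L2_triple_norm T \<le> ereal (real CARD('m) * M)"
    by (rule bounded_extension_triple_norm_le[OF F T, where c = "\<lambda>_ _. M"]) (use M(2) in auto)
  then show "L2_operator_norm L2_triple_norm T \<le> ereal (real CARD('m)) * Linf_triple_norm F"
    by (simp add: M(1))
next
  fix c :: real
  assume *: "\<forall>(F :: real^'n \<Rightarrow> complex^'m^'m) T. multiplier_symbol F \<and> bounded_extension F T \<longrightarrow>
    ereal c * Linf_triple_norm F \<le> L2_operator_norm L2_triple_norm T"
  let ?I = "mat 1 :: complex^'m^'m"
  \<comment> \<open>The assumption on \<open>c\<close> speaks only of symbols with an extension, so
    one has to be produced before it can be applied.\<close>
  obtain T where T: "bounded_extension (\<lambda>x::real^'n. ?I) T"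
    by (rule bounded_extension_const)
  have "Linf_triple_norm (\<lambda>x::real^'n. ?I) = 1"
    by (rule Linf_triple_norm_const_eq_1[of _ undefined undefined]) (simp_all add: mat_def)
  then have "ereal c \<le> L2_operator_norm L2_triple_norm T"
    using * multiplier_symbol_const T by (metis mult.right_neutral)
  \<comment> \<open>The entry bounds of the identity have row sums 1 because the off-diagonal bounds
    are 0; the uniform bound 1 would only give m.\<close>
  also have "\<dots> \<le> ereal 1"
    by (rule bounded_extension_triple_norm_le[OF multiplier_symbol_const T, where c = "\<lambda>l k. if l = k then 1 else 0"])
      (auto simp: mat_def)
  finally show "c \<le> 1" by simp
next
  fix C :: real
  assume *: "\<forall>(F :: real^'n \<Rightarrow> complex^'m^'m) T. multiplier_symbol F \<and> bounded_extension F T \<longrightarrow>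
    L2_operator_norm L2_triple_norm T \<le> ereal C * Linf_triple_norm F"
  let ?J = "(\<chi> j k. 1) :: complex^'m^'m"
  obtain T where T: "bounded_extension (\<lambda>x::real^'n. ?J) T"
    by (rule bounded_extension_const)
  have J: "multiplier_symbol (\<lambda>x::real^'n. ?J)" by (rule multiplier_symbol_const)
  have bT: "bounded_L2_operator T" using T by (simp add: bounded_extension_def)
  have "Linf_triple_norm (\<lambda>x::real^'n. ?J) = 1"
    by (rule Linf_triple_norm_const_eq_1[of _ undefined undefined]) simp_all
  then have le: "L2_operator_norm L2_triple_norm T \<le> ereal C"
    using * J T by (metis mult.right_neutral)
  obtain \<phi> :: "real^'n \<Rightarrow> complex" where \<phi>: "\<phi> \<in> C0inf" "L2_fun_norm \<phi> > 0"
    by (rule ex_C0inf_pos_norm)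
  define a :: 'm where "a = undefined"
  let ?f = "row_fun a (axis a 1) \<phi>"
  have f: "?f \<in> C0inf" by (rule row_fun_C0inf[OF \<phi>(1)])
  \<comment> \<open>Multiplication by the matrix of ones copies the single entry at (a, a) to all m
    places of row \<open>a\<close>, and each copy has the norm of \<open>\<phi>\<close>.\<close>
  have "L2_fun_norm (\<lambda>y. (fourier ?f y ** ?J) $ j $ k) = (if j = a then L2_fun_norm \<phi> else 0)" for j k
    using Plancherel(2)[OF C0inf_L12[OF \<phi>(1)]]
    by (simp add: fourier_row_fun row_fun_mult_entry transpose_mult_axis L2_fun_norm_zero del: transpose_matrix_vector)
  then have "real CARD('m) * L2_fun_norm \<phi> = L2_triple_norm (\<lambda>y. fourier ?f y ** ?J)"
    by (simp add: L2_triple_norm_def flip: sum_distrib_left)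
  also have "\<dots> = L2_triple_norm (T ?f)"
    by (rule bounded_extension_norm[OF entrywise_norm_triple J T f, symmetric])
  also have "\<dots> \<le> C * L2_fun_norm \<phi>"
    using L2_operator_norm_leD[OF entrywise_norm_triple bT le C0inf_L2_mat[OF f]]
    by (simp add: L2_triple_norm_row_fun_axis)
  finally show "real CARD('m) \<le> C" using \<phi>(2) by simp
qed

end
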